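(* Let $\mathcal{R}$ be a bounded Reinhardt domain in $\mathbb{C}^n$, let $1<p<\infty$ and let $f\in A^p(\mathcal{R})$. Then $$\|S_Nf-f\|_p\to0\qquad\text{as }N\to\infty,$$ where $S_Nf$ are the square partial sums of the Laurent series of $f$.
   Context: A domain $\mathcal{R}\subset\mathbb{C}^n$ is Reinhardt if $(z_1,\dots,z_n)\in\mathcal{R}$ implies $(e^{i\theta_1}z_1,\dots,e^{i\theta_n}z_n)\in\mathcal{R}$ for all real $\theta_1,\dots,\theta_n$ (it need not contain $0$). $A^p(\mathcal{R})$ is the Bergman space of holomorphic functions in $L^p(\mathcal{R})$ (Lebesgue measure), with the $L^p$ norm $\|\cdot\|_p$. Every holomorphic function $f$ on $\mathcal{R}$ has a unique Laurent expansion $f(z)=\sum_{\alpha\in\mathbb{Z}^n}a_\alpha z^\alpha$ converging uniformly on compact subsets of $\mathcal{R}$. For $\alpha\in\mathbb{Z}^n$ let $|\alpha|_\infty=\max_j|\alpha_j|$; the square partial sum is $S_Nf(z)=\sum_{|\alpha|_\infty\le N}a_\alpha z^\alpha$. *)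

theory Defs
  imports "HOL-Analysis.Analysis"
begin

definition is_domain :: "(complex ^ 'n) set \<Rightarrow> bool" where
  "is_domain R \<longleftrightarrow> open R \<and> connected R \<and> R \<noteq> {}"

definition reinhardt :: "(complex ^ 'n) set \<Rightarrow> bool" where
  "reinhardt R \<longleftrightarrow> (\<forall>z\<in>R. \<forall>\<theta> :: real ^ 'n. (\<chi> j. cis (\<theta> $ j) * z $ j) \<in> R)"

(* Complex Frechet differentiability: the real derivative exists and is complex linear.
   Meant for open R only. *)
definition holo_on :: "(complex ^ 'n \<Rightarrow> complex) \<Rightarrow> (complex ^ 'n) set \<Rightarrow> bool" where
  "holo_on f R \<longleftrightarrow>
     (\<forall>z\<in>R. \<exists>D. (f has_derivative D) (at z) \<and> (\<forall>c v. D (c *s v) = c * D v))"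

(* The L^p norm takes values in [0, \<infinity>], so that a function outside L^p has norm \<infinity>
   instead of the value 0 that the Bochner integral would assign to it. *)
definition lp_norm :: "real \<Rightarrow> (complex ^ 'n) set \<Rightarrow> (complex ^ 'n \<Rightarrow> complex) \<Rightarrow> ennreal" where
  "lp_norm p R g =
     (let I = (\<integral>\<^sup>+z\<in>R. ennreal (norm (g z) powr p) \<partial>lebesgue)
      in if I = \<infinity> then \<infinity> else ennreal (enn2real I powr (1 / p)))"

definition lp_space :: "real \<Rightarrow> (complex ^ 'n) set \<Rightarrow> (complex ^ 'n \<Rightarrow> complex) set" where
  "lp_space p R = {g. set_borel_measurable lebesgue R g \<and> lp_norm p R g < \<infinity>}"

definition bergman_space :: "real \<Rightarrow> (complex ^ 'n) set \<Rightarrow> (complex ^ 'n \<Rightarrow> complex) set" where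
  "bergman_space p R = {f \<in> lp_space p R. holo_on f R}"

(* Here 0 powi k = 0 for k < 0.  This convention is harmless: if a Reinhardt domain R contains
   a point with z $ j = 0, then every Laurent coefficient with \<alpha> $ j < 0 of a holomorphic
   function on R vanishes. *)
definition laurent_monomial :: "int ^ 'n \<Rightarrow> complex ^ 'n \<Rightarrow> complex" where
  "laurent_monomial \<alpha> z = (\<Prod>j\<in>UNIV. (z $ j) powi (\<alpha> $ j))"

(* The series over the lattice is summed unconditionally, i.e. along the net of finite index
   sets, uniformly on each compact subset of R. *)
definition has_laurent_expansion ::
    "(complex ^ 'n \<Rightarrow> complex) \<Rightarrow> (int ^ 'n \<Rightarrow> complex) \<Rightarrow> (complex ^ 'n) set \<Rightarrow> bool" where
  "has_laurent_expansion f a R \<longleftrightarrow>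
     (\<forall>K. compact K \<and> K \<subseteq> R \<longrightarrow>
        uniform_limit K (\<lambda>F z. \<Sum>\<alpha>\<in>F. a \<alpha> * laurent_monomial \<alpha> z) f
          (finite_subsets_at_top UNIV))"

(* Well defined when f is holomorphic on a Reinhardt domain R: the expansion then exists and
   is unique. *)
definition laurent_coeff ::
    "(complex ^ 'n) set \<Rightarrow> (complex ^ 'n \<Rightarrow> complex) \<Rightarrow> int ^ 'n \<Rightarrow> complex" where
  "laurent_coeff R f = (THE a. has_laurent_expansion f a R)"

definition index_norm :: "int ^ 'n \<Rightarrow> int" where
  "index_norm \<alpha> = Max (range (\<lambda>j. \<bar>\<alpha> $ j\<bar>))"

definition square_partial_sum ::
    "(complex ^ 'n) set \<Rightarrow> nat \<Rightarrow> (complex ^ 'n \<Rightarrow> complex) \<Rightarrow> complex ^ 'n \<Rightarrow> complex" where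
  "square_partial_sum R N f z =
     (\<Sum>\<alpha> | index_norm \<alpha> \<le> int N. laurent_coeff R f \<alpha> * laurent_monomial \<alpha> z)"

(* The index set of the square partial sum is finite, so the sum is a genuine one. *)
lemma finite_index_square: "finite {\<alpha> :: int ^ 'n. index_norm \<alpha> \<le> int N}"
proof -
  have "{\<alpha> :: int ^ 'n. index_norm \<alpha> \<le> int N}
      \<subseteq> vec_lambda ` (UNIV \<rightarrow>\<^sub>E {- int N..int N})"
  proof
    fix \<alpha> :: "int ^ 'n"
    assume "\<alpha> \<in> {\<alpha>. index_norm \<alpha> \<le> int N}"
    then have "\<bar>\<alpha> $ j\<bar> \<le> int N" for j
      by (simp add: index_norm_def)
    then have "vec_nth \<alpha> \<in> UNIV \<rightarrow>\<^sub>E {- int N..int N}"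
      by (auto simp: PiE_def Pi_def abs_le_iff minus_le_iff)
    moreover have "\<alpha> = vec_lambda (vec_nth \<alpha>)"
      by simp
    ultimately show "\<alpha> \<in> vec_lambda ` (UNIV \<rightarrow>\<^sub>E {- int N..int N})"
      by blast
  qed
  then show ?thesis
    by (rule finite_subset) (intro finite_imageI finite_PiE; simp)
qed

end

theory Submission
  imports Defs "HOL-Complex_Analysis.Cauchy_Integral_Formula"
begin

text \<open>
  The square partial sums are bounded on \<open>L\<^sup>p\<close> of every measurable set \<open>X\<close> invariant under the torus,
  uniformly in \<open>N\<close>: since Lebesgue measure is invariant under rotation of one coordinate, this reduces,
  one coordinate at a time, to M. Riesz' theorem for the partial sums of trigonometric polynomials.
  Riesz' theorem follows from the sub-mean value inequality for the subharmonic functions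
  \<open>K (\<epsilon> + u\<^sup>2)\<^sup>q - (\<epsilon> + |F|\<^sup>2)\<^sup>q\<close> (for \<open>p \<le> 2\<close>) and \<open>2q\<^sup>2u\<^sup>2 (\<epsilon> + |F|\<^sup>2)\<^bsup>q-1\<^esup> - (\<epsilon> + |F|\<^sup>2)\<^sup>q\<close>
  (for \<open>p \<ge> 2\<close>), where \<open>F\<close> is entire, \<open>u = Re F\<close> and \<open>q = p/2\<close>.

  The compact sets \<open>K\<close> of points at distance at least \<open>d\<close> from the complement of \<open>R\<close> are torus invariant and
  exhaust \<open>R\<close>. On \<open>K\<close> the Laurent series converges uniformly, and on \<open>R - K\<close> the uniform bound controls
  \<open>S\<^sub>N f - f\<close> by the norm of \<open>f\<close> there, which is small for small \<open>d\<close>.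

  The Laurent expansion itself is obtained by taking Fourier coefficients in one coordinate after the
  other: the result is homogeneous of the prescribed degree in each coordinate, hence a multiple of a
  monomial on the connected set \<open>R\<close>.
\<close>

section \<open>A sub-mean value inequality\<close>

text \<open>The regularisation \<epsilon> keeps the bases of the powers positive, so that real
  powers stay twice differentiable where \<open>F\<close> or \<open>u\<close> vanishes; it tends to
  0 only after integration. For p \<le> 2 the Laplacian of the power of \<epsilon> + u^2 is bounded
  below with a factor 2q - 1, positive because p > 1. For p \<ge> 2 that power cannot dominate where
  \<open>u\<close> is small compared with Im F; the factor (\<epsilon> + |F|^2)^(q-1) beside u^2
  repairs this, but then \<open>F\<close> occurs on both sides of the estimate and has to be
  absorbed pointwise.

  Riesz' theorem concerns finite sums, whereas the Laurent series need not converge uniformly near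
  the boundary. The bridge is that for M \<ge> N the sum S_N f is a truncation of S_M f, so the
  finite bound compares these two; M tends to infinity on invariant sets lying inside a compact part
  of R, and such sets then exhaust R - K.

  Norms enter as integrals of p-th powers, which are additive over sets; differences are estimated
  by |a - b|^p \<le> 2^p (|a|^p + |b|^p).\<close>

text \<open>\<open>D1 d\<close> and \<open>D2 d\<close> are the first and second derivatives in the real direction \<open>d\<close>, so that the
  Laplacian is \<open>D2 1 + D2 \<i>\<close>.\<close>

definition twice_diff ::
    "(complex \<Rightarrow> real) \<Rightarrow> (complex \<Rightarrow> complex \<Rightarrow> real) \<Rightarrow> (complex \<Rightarrow> complex \<Rightarrow> real) \<Rightarrow> bool" where
  "twice_diff k D1 D2 \<longleftrightarrow> continuous_on UNIV k \<and>
     (\<forall>d. continuous_on UNIV (D1 d) \<and> continuous_on UNIV (D2 d) \<and>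
       (\<forall>z. ((\<lambda>x. k (z + of_real x * d)) has_real_derivative D1 d z) (at 0) \<and>
            ((\<lambda>x. D1 d (z + of_real x * d)) has_real_derivative D2 d z) (at 0)))"

lemma twice_diffD:
  assumes "twice_diff k D1 D2"
  shows "continuous_on A k" "continuous_on A (D1 d)" "continuous_on A (D2 d)"
    "((\<lambda>x. k (z + of_real x * d)) has_real_derivative D1 d (z + of_real x * d)) (at x)"
    "((\<lambda>x. D1 d (z + of_real x * d)) has_real_derivative D2 d (z + of_real x * d)) (at x)"
proof -
  show "continuous_on A k" "continuous_on A (D1 d)" "continuous_on A (D2 d)"
    using assms by (auto simp: twice_diff_def intro: continuous_on_subset)
  have "((\<lambda>y. k ((z + of_real x * d) + of_real y * d)) has_real_derivative D1 d (z + of_real x * d)) (at 0)"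
    "((\<lambda>y. D1 d ((z + of_real x * d) + of_real y * d)) has_real_derivative D2 d (z + of_real x * d)) (at 0)"
    using assms unfolding twice_diff_def by blast+
  then show "((\<lambda>x. k (z + of_real x * d)) has_real_derivative D1 d (z + of_real x * d)) (at x)"
    "((\<lambda>x. D1 d (z + of_real x * d)) has_real_derivative D2 d (z + of_real x * d)) (at x)"
    using DERIV_shift[of "\<lambda>x. k (z + of_real x * d)" "D1 d (z + of_real x * d)" 0 x]
      DERIV_shift[of "\<lambda>x. D1 d (z + of_real x * d)" "D2 d (z + of_real x * d)" 0 x]
    by (simp_all add: algebra_simps)
qed

lemma twice_diff_const: "twice_diff (\<lambda>z. c) (\<lambda>d z. 0) (\<lambda>d z. 0)"
  by (simp add: twice_diff_def)

lemma twice_diff_add: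
  assumes "twice_diff f f1 f2" "twice_diff g g1 g2"
  shows "twice_diff (\<lambda>z. f z + g z) (\<lambda>d z. f1 d z + g1 d z) (\<lambda>d z. f2 d z + g2 d z)"
  using assms unfolding twice_diff_def
  by (auto intro!: continuous_intros DERIV_add)

lemma twice_diff_mult:
  assumes "twice_diff f f1 f2" "twice_diff g g1 g2"
  shows "twice_diff (\<lambda>z. f z * g z) (\<lambda>d z. f1 d z * g z + f z * g1 d z)
           (\<lambda>d z. f2 d z * g z + 2 * f1 d z * g1 d z + f z * g2 d z)"
  using assms unfolding twice_diff_def
  by (auto intro!: continuous_intros derivative_eq_intros simp: algebra_simps)

text \<open>Positivity of the base is what makes an arbitrary real exponent admissible; the
  \<epsilon> in the later energies is there to supply it.\<close>

lemma twice_diff_powr: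
  assumes f: "twice_diff f f1 f2" and pos: "\<And>z. f z > 0"
  shows "twice_diff (\<lambda>z. f z powr q) (\<lambda>d z. q * f z powr (q - 1) * f1 d z)
           (\<lambda>d z. q * (q - 1) * f z powr (q - 2) * (f1 d z)\<^sup>2 + q * f z powr (q - 1) * f2 d z)"
proof -
  have ne: "f z \<noteq> 0" for z using pos[of z] by simp
  have d: "((\<lambda>x. f (z + of_real x * d)) has_real_derivative f1 d z) (at 0)"
          "((\<lambda>x. f1 d (z + of_real x * d)) has_real_derivative f2 d z) (at 0)" for z d
    using f by (auto simp: twice_diff_def)
  have p: "((\<lambda>x. f (z + of_real x * d) powr r) has_real_derivative r * f z powr (r - 1) * f1 d z) (at 0)" for z d r
    using DERIV_fun_powr[OF d(1), of z d r] pos by simp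
  show ?thesis
    unfolding twice_diff_def
  proof (intro conjI allI)
    show "continuous_on UNIV (\<lambda>z. f z powr q)"
      "\<And>d. continuous_on UNIV (\<lambda>z. q * f z powr (q - 1) * f1 d z)"
      "\<And>d. continuous_on UNIV (\<lambda>z. q * (q - 1) * f z powr (q - 2) * (f1 d z)\<^sup>2 + q * f z powr (q - 1) * f2 d z)"
      by (intro continuous_intros twice_diffD[OF f]; simp add: ne)+
    show "((\<lambda>x. f (z + of_real x * d) powr q) has_real_derivative q * f z powr (q - 1) * f1 d z) (at 0)" for z d
      by (rule p)
    show "((\<lambda>x. q * f (z + of_real x * d) powr (q - 1) * f1 d (z + of_real x * d)) has_real_derivative
       q * (q - 1) * f z powr (q - 2) * (f1 d z)\<^sup>2 + q * f z powr (q - 1) * f2 d z) (at 0)" for z d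
      by (rule derivative_eq_intros p d refl)+ (simp add: power2_eq_square algebra_simps)
  qed
qed

lemma twice_diff_Re:
  fixes L :: "complex \<Rightarrow> complex"
  assumes L: "\<And>z. (L has_field_derivative L1 z) (at z)" "\<And>z. (L1 has_field_derivative L2 z) (at z)"
    and c: "continuous_on UNIV L2"
  shows "twice_diff (\<lambda>z. Re (L z)) (\<lambda>d z. Re (d * L1 z)) (\<lambda>d z. Re (d\<^sup>2 * L2 z))"
proof -
  have cL: "continuous_on UNIV L" "continuous_on UNIV L1"
    by (intro continuous_at_imp_continuous_on ballI DERIV_isCont[OF L(1)] DERIV_isCont[OF L(2)])+
  have R: "((\<lambda>x. Re (c * G (z + of_real x * d))) has_real_derivative Re (c * (d * G1 z))) (at 0)"
    if "\<And>z. (G has_field_derivative G1 z) (at z)" for G G1 :: "complex \<Rightarrow> complex" and z d c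
  proof -
    have "((\<lambda>w. c * G (z + w * d)) has_field_derivative c * (d * G1 z)) (at (of_real 0))"
    proof -
      have "((\<lambda>w. z + w * d) has_field_derivative d) (at 0)"
        by (auto intro!: derivative_eq_intros)
      then have "((\<lambda>w. G (z + w * d)) has_field_derivative G1 z * d) (at 0)"
        using DERIV_chain2[of G "G1 z" "\<lambda>w. z + w * d" 0] that[of z] by simp
      from DERIV_cmult[OF this, of c] show ?thesis by (simp add: mult.commute)
    qed
    then have "((\<lambda>x. c * G (z + of_real x * d)) has_vector_derivative c * (d * G1 z)) (at 0)"
      by (rule has_vector_derivative_real_field)
    then have "((\<lambda>x. Re (c * G (z + of_real x * d))) has_vector_derivative Re (c * (d * G1 z))) (at 0)"
      by (rule bounded_linear.has_vector_derivative[OF bounded_linear_Re])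
    then show ?thesis by (simp add: has_real_derivative_iff_has_vector_derivative)
  qed
  show ?thesis
    unfolding twice_diff_def
    using R[OF L(1), of 1] R[OF L(2)] by (auto intro!: continuous_intros cL c simp: power2_eq_square mult.assoc)
qed

text \<open>In the coordinate \<open>log w = x + \<i>t\<close> the circular mean of a function with non-negative Laplacian is
  convex in \<open>x\<close>; being bounded as \<open>x\<close> tends to \<open>-\<infinity>\<close>, it increases.\<close>

lemma submean_inequality:
  fixes \<Phi> :: "complex \<Rightarrow> real"
  assumes cont: "continuous_on UNIV \<Phi>"
    and k: "twice_diff (\<lambda>z. \<Phi> (exp z)) D1 D2"
    and lap: "\<And>z. D2 1 z + D2 \<i> z \<ge> 0"
  shows "2 * pi * \<Phi> 0 \<le> integral {0..2*pi} (\<lambda>t. \<Phi> (cis t))"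
proof -
  define G where "G r = integral {0..2*pi} (\<lambda>t. \<Phi> (of_real r * cis t))" for r
  define M where "M x = integral {0..2*pi} (\<lambda>t. \<Phi> (exp (of_real x + \<i> * of_real t)))" for x
  define M1 where "M1 x = integral {0..2*pi} (\<lambda>t. D1 1 (of_real x + \<i> * of_real t))" for x
  define M2 where "M2 x = integral {0..2*pi} (\<lambda>t. D2 1 (of_real x + \<i> * of_real t))" for x
  have c\<Phi>: "continuous_on A (\<lambda>x. \<Phi> (g x))" if "continuous_on A g" for A and g :: "'a::topological_space \<Rightarrow> complex"
    by (rule continuous_on_compose2[OF cont that]) auto
  have cD1: "continuous_on A (\<lambda>x. D1 d (g x))" if "continuous_on A g" for A and g :: "'a::topological_space \<Rightarrow> complex" and d
    by (rule continuous_on_compose2[OF twice_diffD(2)[OF k] that subset_UNIV])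
  have cD2: "continuous_on A (\<lambda>x. D2 d (g x))" if "continuous_on A g" for A and g :: "'a::topological_space \<Rightarrow> complex" and d
    by (rule continuous_on_compose2[OF twice_diffD(3)[OF k] that subset_UNIV])
  note cs = c\<Phi> cD1 cD2
  have MG: "M x = G (exp x)" for x
    by (simp add: M_def G_def exp_add cis_conv_exp exp_of_real)
  have dM: "(M has_real_derivative M1 x) (at x)" for x
  proof -
    have "((\<lambda>x. integral (cbox 0 (2*pi)) (\<lambda>t. \<Phi> (exp (of_real x + \<i> * of_real t)))) has_field_derivative
        integral (cbox 0 (2*pi)) (\<lambda>t. D1 1 (of_real x + \<i> * of_real t))) (at x within UNIV)"
    proof (rule leibniz_rule_field_derivative)
      show "((\<lambda>x. \<Phi> (exp (of_real x + \<i> * of_real t))) has_field_derivative D1 1 (of_real x + \<i> * of_real t)) (at x within UNIV)" for x t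
        using twice_diffD(4)[OF k, where z = "\<i> * of_real t" and d = 1 and x = x] by (simp add: add.commute)
      show "continuous_on (UNIV \<times> cbox 0 (2 * pi)) (\<lambda>(x, t). D1 1 (of_real x + \<i> * of_real t))"
        unfolding case_prod_unfold by (intro cs continuous_intros)
      show "(\<lambda>t. \<Phi> (exp (of_real x + \<i> * of_real t))) integrable_on cbox 0 (2 * pi)" for x
        by (intro integrable_continuous cs continuous_intros)
    qed auto
    then show ?thesis by (simp add: M_def[abs_def] M1_def)
  qed
  have dM1: "(M1 has_real_derivative M2 x) (at x)" for x
  proof -
    have "((\<lambda>x. integral (cbox 0 (2*pi)) (\<lambda>t. D1 1 (of_real x + \<i> * of_real t))) has_field_derivative
        integral (cbox 0 (2*pi)) (\<lambda>t. D2 1 (of_real x + \<i> * of_real t))) (at x within UNIV)"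
    proof (rule leibniz_rule_field_derivative)
      show "((\<lambda>x. D1 1 (of_real x + \<i> * of_real t)) has_field_derivative D2 1 (of_real x + \<i> * of_real t)) (at x within UNIV)" for x t
        using twice_diffD(5)[OF k, where z = "\<i> * of_real t" and d = 1 and x = x] by (simp add: add.commute)
      show "continuous_on (UNIV \<times> cbox 0 (2 * pi)) (\<lambda>(x, t). D2 1 (of_real x + \<i> * of_real t))"
        unfolding case_prod_unfold by (intro cs continuous_intros)
      show "(\<lambda>t. D1 1 (of_real x + \<i> * of_real t)) integrable_on cbox 0 (2 * pi)" for x
        by (intro integrable_continuous cs continuous_intros)
    qed auto
    then show ?thesis by (simp add: M1_def[abs_def] M2_def)
  qed
  \<comment> \<open>The second derivative in direction \<i> integrates to zero over the period 2 pi
    of \<open>exp\<close>, so \<open>M2 x\<close> is in fact the integral of the full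
    Laplacian.\<close>
  have M2: "M2 x \<ge> 0" for x
  proof -
    have der: "((\<lambda>t. D1 \<i> (of_real x + of_real t * \<i>)) has_real_derivative D2 \<i> (of_real x + of_real t * \<i>)) (at t)" for t
      by (rule twice_diffD(5)[OF k])
    have d1: "((\<lambda>t. \<Phi> (exp (of_real x + of_real t * \<i>))) has_real_derivative D1 \<i> (of_real x + of_real t * \<i>)) (at t)" for t
      by (rule twice_diffD(4)[OF k])
    have "((\<lambda>t. \<Phi> (exp (of_real x + of_real (t + 2*pi) * \<i>))) has_real_derivative D1 \<i> (of_real x + of_real (0 + 2*pi) * \<i>)) (at 0)"
      using d1[of "2*pi"] DERIV_shift[of "\<lambda>t. \<Phi> (exp (of_real x + of_real t * \<i>))" _ 0 "2*pi"] by simp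
    moreover have "exp (of_real x + of_real (t + 2*pi) * \<i>) = exp (of_real x + of_real t * \<i>)" for t
      by (auto simp: exp_eq algebra_simps intro!: exI[of _ 1])
    ultimately have per: "D1 \<i> (of_real x + of_real (2*pi) * \<i>) = D1 \<i> (of_real x + of_real 0 * \<i>)"
      using DERIV_unique[OF d1[of 0]] by simp
    have "((\<lambda>t. D2 \<i> (of_real x + of_real t * \<i>)) has_integral
       (D1 \<i> (of_real x + of_real (2*pi) * \<i>) - D1 \<i> (of_real x + of_real 0 * \<i>))) {0..2*pi}"
      by (rule fundamental_theorem_of_calculus)
        (use der in \<open>auto simp: has_real_derivative_iff_has_vector_derivative[symmetric] intro: has_field_derivative_at_within\<close>)
    then have i0: "((\<lambda>t. D2 \<i> (of_real x + \<i> * of_real t)) has_integral 0) {0..2*pi}"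
      by (simp only: per) (simp add: mult.commute)
    have "((\<lambda>t. D2 1 (of_real x + \<i> * of_real t)) has_integral M2 x) {0..2*pi}"
      unfolding M2_def by (intro integrable_integral integrable_continuous_interval cs continuous_intros)
    from has_integral_add[OF this i0] have "0 \<le> M2 x + 0"
      by (rule has_integral_nonneg) (use lap in simp)
    then show ?thesis by simp
  qed
  have contG: "continuous_on {0..1} G"
  proof -
    have "continuous_on {0..1} (\<lambda>r. integral (cbox 0 (2*pi)) (\<lambda>t. \<Phi> (of_real r * cis t)))"
      by (rule integral_continuous_on_param)
        (unfold case_prod_unfold, intro cs continuous_intros)
    then show ?thesis by (simp add: G_def[abs_def])
  qed
  have "compact (G ` {0..1})" by (rule compact_continuous_image[OF contG]) simp
  then obtain B where B: "\<And>r. 0 \<le> r \<Longrightarrow> r \<le> 1 \<Longrightarrow> G r \<le> B"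
    using bounded_imp_bdd_above[OF compact_imp_bounded] unfolding bdd_above_def by fastforce
  have M1_mono: "M1 x \<le> M1 y" if "x \<le> y" for x y
    by (rule DERIV_nonneg_imp_nondecreasing[OF that]) (use dM1 M2 in blast)
  have M1_nonneg: "M1 x \<ge> 0" if "x \<le> 0" for x
  proof (rule ccontr)
    assume "\<not> M1 x \<ge> 0"
    then have neg: "M1 x < 0" by simp
    \<comment> \<open>Going left from \<open>x\<close> by this distance with slope at most
      \<open>M1 x\<close> raises \<open>M\<close> by at least \<bar>B\<bar> + \<bar>M x\<bar> + 1,
      which carries it past the bound \<open>B\<close>.\<close>
    define y where "y = x - (\<bar>B\<bar> + \<bar>M x\<bar> + 1) / - M1 x"
    have yx: "y < x" using neg by (simp add: y_def divide_pos_pos del: divide_minus_right)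
    obtain z where z: "y < z" "z < x" "M x - M y = (x - y) * M1 z"
      using MVT2[OF yx, of M M1] dM by blast
    have "(x - y) * M1 z \<le> (x - y) * M1 x" using z yx by (intro mult_left_mono M1_mono) auto
    also have "\<dots> = - (\<bar>B\<bar> + \<bar>M x\<bar> + 1)" using neg by (simp add: y_def field_simps)
    finally have "M y > B" using z by linarith
    moreover have "M y \<le> B" using B[of "exp y"] yx that by (simp add: MG)
    ultimately show False by simp
  qed
  have mono: "M x \<le> M 0" if "x \<le> 0" for x
    by (rule DERIV_nonneg_imp_nondecreasing[OF that]) (use dM M1_nonneg in blast)
  have le: "G r \<le> G 1" if "0 < r" "r \<le> 1" for r
    using mono[of "ln r"] that by (simp add: MG)
  have "(\<lambda>n. G (inverse (real (Suc n)))) \<longlonglongrightarrow> G 0"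
    by (rule continuous_on_tendsto_compose[OF contG LIMSEQ_inverse_real_of_nat])
       (auto simp: inverse_le_1_iff)
  then have "G 0 \<le> G 1"
    by (rule LIMSEQ_le_const2) (auto intro!: le simp: inverse_le_1_iff)
  then show ?thesis by (simp add: G_def)
qed

section \<open>M. Riesz' theorem on the circle\<close>

lemma powr_mult_cancel:
  fixes x :: real assumes "x > 0" shows "x powr (q - 1) = x powr (q - 2) * x"
  using powr_add[of x "q - 2" 1] assms by simp

lemma cmod_power2': "(cmod w)\<^sup>2 = Re w * Re w + Im w * Im w"
  unfolding cmod_power2 by (simp add: power2_eq_square)

text \<open>These are the Cauchy-Riemann equations for L = F o exp. The derivatives of Re L along
  \<open>d\<close> are Re (d L') and Re (d^2 L''), and 1 + \<i>^2 = 0 makes it harmonic; Im L is the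
  real part of -\<i> L. The two gradients are orthogonal and share the squared length
  \<open>e\<close> = |L'|^2.\<close>

lemma entire_exp_twice_diff:
  assumes F: "F holomorphic_on UNIV"
  obtains U1 U2 V1 V2 e where
    "twice_diff (\<lambda>z. Re (F (exp z))) U1 U2" "twice_diff (\<lambda>z. Im (F (exp z))) V1 V2"
    "\<And>z. U2 1 z + U2 \<i> z = 0" "\<And>z. V2 1 z + V2 \<i> z = 0"
    "\<And>z. (U1 1 z)\<^sup>2 + (U1 \<i> z)\<^sup>2 = e z" "\<And>z. (V1 1 z)\<^sup>2 + (V1 \<i> z)\<^sup>2 = e z"
    "\<And>z. U1 1 z * V1 1 z + U1 \<i> z * V1 \<i> z = 0"
proof -
  define L where "L z = F (exp z)" for z
  define L1 where "L1 z = deriv F (exp z) * exp z" for z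
  define L2 where "L2 z = deriv (deriv F) (exp z) * exp z * exp z + deriv F (exp z) * exp z" for z
  have hF: "deriv F holomorphic_on UNIV" "deriv (deriv F) holomorphic_on UNIV"
    using F by (auto intro: holomorphic_deriv)
  have dF: "(F has_field_derivative deriv F z) (at z)" "(deriv F has_field_derivative deriv (deriv F) z) (at z)" for z
    using F hF holomorphic_derivI[of _ UNIV z] by auto
  have dL: "(L has_field_derivative L1 z) (at z)" "(L1 has_field_derivative L2 z) (at z)" for z
    unfolding L_def[abs_def] L1_def[abs_def] L2_def
    by (auto intro!: derivative_eq_intros DERIV_chain2[OF dF(1)] DERIV_chain2[OF dF(2)])
  have c: "continuous_on UNIV L2"
    unfolding L2_def[abs_def]
    by (intro continuous_intros continuous_on_compose2[OF holomorphic_on_imp_continuous_on[OF hF(1)]]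
        continuous_on_compose2[OF holomorphic_on_imp_continuous_on[OF hF(2)]]) auto
  have U: "twice_diff (\<lambda>z. Re (L z)) (\<lambda>d z. Re (d * L1 z)) (\<lambda>d z. Re (d\<^sup>2 * L2 z))"
    by (rule twice_diff_Re[OF dL c])
  have "twice_diff (\<lambda>z. Re (- \<i> * L z)) (\<lambda>d z. Re (d * (- \<i> * L1 z))) (\<lambda>d z. Re (d\<^sup>2 * (- \<i> * L2 z)))"
    by (rule twice_diff_Re) (intro continuous_intros c dL DERIV_cmult)+
  then have V: "twice_diff (\<lambda>z. Im (L z)) (\<lambda>d z. Re (d * (- \<i> * L1 z))) (\<lambda>d z. Re (d\<^sup>2 * (- \<i> * L2 z)))"
    by simp
  show ?thesis
    by (rule that[OF U[unfolded L_def] V[unfolded L_def], where e = "\<lambda>z. (cmod (L1 z))\<^sup>2"])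
       (simp_all add: cmod_power2)
qed

text \<open>Here and below \<open>u\<close>, \<open>v\<close> and \<open>e\<close> stand for \<open>Re F\<close>, \<open>Im F\<close> and their common squared gradient in the
  coordinate \<open>log w\<close>; the two sides are then the Laplacians of the powers compared, with
  \<open>q = p / 2\<close>.\<close>

lemma riesz_algebra_le_2:
  fixes q u v e :: real
  assumes q: "1/2 < q" "q \<le> 1" and \<epsilon>: "\<epsilon> > 0" and e: "e \<ge> 0"
  defines "Y \<equiv> \<epsilon> + u * u" and "S \<equiv> \<epsilon> + (u * u + v * v)"
  shows "q * (q - 1) * S powr (q - 2) * (4 * (u * u + v * v) * e) + q * S powr (q - 1) * (4 * e)
    \<le> 2 / (2 * q - 1) * (q * (q - 1) * Y powr (q - 2) * (4 * (u * u) * e) + q * Y powr (q - 1) * (2 * e))"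
proof -
  have Y: "Y > 0" and S: "S > 0" and YS: "Y \<le> S"
    using \<epsilon> by (simp_all add: Y_def S_def add_pos_nonneg)
  have "q * (q - 1) * S powr (q - 2) * (4 * (u * u + v * v) * e) \<le> 0"
    using q e by (intro mult_nonpos_nonneg mult_nonneg_nonpos) auto
  then have "q * (q - 1) * S powr (q - 2) * (4 * (u * u + v * v) * e) + q * S powr (q - 1) * (4 * e)
      \<le> q * S powr (q - 1) * (4 * e)"
    by simp
  also have "\<dots> \<le> q * Y powr (q - 1) * (4 * e)"
    using q e Y YS by (intro mult_right_mono mult_left_mono powr_mono2') auto
  also have "\<dots> = 2 / (2 * q - 1) * ((2 * q - 1) * (q * Y powr (q - 1) * (2 * e)))"
    using q by simp
  also have "\<dots> \<le> 2 / (2 * q - 1) * (q * (q - 1) * Y powr (q - 2) * (4 * (u * u) * e) + q * Y powr (q - 1) * (2 * e))"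
  proof (rule mult_left_mono)
    \<comment> \<open>As q - 1 \<le> 0, enlarging u^2 to \<open>Y\<close> lowers the first summand.
      It then equals 2(q - 1) times the second, so that the factor 2q - 1 remains; this fixes the
      constant 2 / (2q - 1).\<close>
    have "q * (q - 1) * Y powr (q - 2) * (4 * (u * u) * e) \<ge> q * (q - 1) * Y powr (q - 2) * (4 * Y * e)"
      using q e \<epsilon> by (intro mult_left_mono_neg mult_right_mono mult_left_mono mult_nonpos_nonneg mult_nonneg_nonpos) (auto simp: Y_def)
    moreover have "q * (q - 1) * Y powr (q - 2) * (4 * Y * e) = 2 * (q - 1) * (q * Y powr (q - 1) * (2 * e))"
      using powr_mult_cancel[OF Y, of q] by simp
    ultimately show "(2 * q - 1) * (q * Y powr (q - 1) * (2 * e)) \<le> q * (q - 1) * Y powr (q - 2) * (4 * (u * u) * e) + q * Y powr (q - 1) * (2 * e)"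
      by (simp add: algebra_simps)
  qed (use q in simp)
  finally show ?thesis .
qed

text \<open>The sub-mean value inequality is applied to the \<Phi> of the proof. The last summand is
  what remains of 2 pi \<Phi>(0) once its non-negative part, the multiple of \<open>K\<close>, is
  dropped.\<close>

lemma riesz_energy_le_2:
  fixes q \<epsilon> :: real
  assumes F: "F holomorphic_on UNIV" and q: "1/2 < q" "q \<le> 1" and \<epsilon>: "\<epsilon> > 0"
  shows "integral {0..2*pi} (\<lambda>t. (\<epsilon> + (cmod (F (cis t)))\<^sup>2) powr q) \<le>
    2 / (2 * q - 1) * integral {0..2*pi} (\<lambda>t. (\<epsilon> + (Re (F (cis t)))\<^sup>2) powr q)
     + 2 * pi * (\<epsilon> + (cmod (F 0))\<^sup>2) powr q"
proof -
  obtain U1 U2 V1 V2 e where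
    U: "twice_diff (\<lambda>z. Re (F (exp z))) U1 U2" and V: "twice_diff (\<lambda>z. Im (F (exp z))) V1 V2"
    and lap: "\<And>z. U2 1 z + U2 \<i> z = 0" "\<And>z. V2 1 z + V2 \<i> z = 0"
    and grad: "\<And>z. (U1 1 z)\<^sup>2 + (U1 \<i> z)\<^sup>2 = e z" "\<And>z. (V1 1 z)\<^sup>2 + (V1 \<i> z)\<^sup>2 = e z"
      "\<And>z. U1 1 z * V1 1 z + U1 \<i> z * V1 \<i> z = 0"
    using entire_exp_twice_diff[OF F] by blast
  define K where "K = 2 / (2 * q - 1)"
  have K: "K \<ge> 0" using q by (simp add: K_def)
  define \<Phi> where "\<Phi> w = K * (\<epsilon> + Re (F w) * Re (F w)) powr q
     + (-1) * (\<epsilon> + (Re (F w) * Re (F w) + Im (F w) * Im (F w))) powr q" for w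
  have pos: "\<epsilon> + Re w * Re w > 0" "\<epsilon> + (Re w * Re w + Im w * Im w) > 0" for w
    using \<epsilon> by (simp_all add: add_pos_nonneg)
  have cF: "continuous_on UNIV F" using F by (rule holomorphic_on_imp_continuous_on)
  have c1: "continuous_on A (\<lambda>x. (\<epsilon> + Re (F (g x)) * Re (F (g x))) powr q)"
    "continuous_on A (\<lambda>x. (\<epsilon> + (Re (F (g x)) * Re (F (g x)) + Im (F (g x)) * Im (F (g x)))) powr q)"
    if "continuous_on A g" for A and g :: "'b::topological_space \<Rightarrow> complex"
    using pos by (intro continuous_intros continuous_on_compose2[OF cF that]; simp add: less_imp_neq[symmetric])+
  have c\<Phi>: "continuous_on UNIV \<Phi>"
    unfolding \<Phi>_def[abs_def] by (intro continuous_intros c1)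
  note tY = twice_diff_add[OF twice_diff_const[of \<epsilon>] twice_diff_mult[OF U U]]
  note tS = twice_diff_add[OF twice_diff_const[of \<epsilon>] twice_diff_add[OF twice_diff_mult[OF U U] twice_diff_mult[OF V V]]]
  note tY' = twice_diff_powr[OF tY, of q, OF pos(1)]
  note tS' = twice_diff_powr[OF tS, of q, OF pos(2)]
  note t\<Phi> = twice_diff_add[OF twice_diff_mult[OF twice_diff_const[of K] tY'] twice_diff_mult[OF twice_diff_const[of "-1"] tS']]
  have "2 * pi * \<Phi> 0 \<le> integral {0..2*pi} (\<lambda>t. \<Phi> (cis t))"
  proof (rule submean_inequality[OF c\<Phi> t\<Phi>[folded \<Phi>_def]], goal_cases)
    case (1 z)
    define u v where "u = Re (F (exp z))" and "v = Im (F (exp z))"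
    define a a' b b' c c' d d' where vars: "a = U1 1 z" "a' = U1 \<i> z" "b = V1 1 z" "b' = V1 \<i> z"
      "c = U2 1 z" "c' = U2 \<i> z" "d = V2 1 z" "d' = V2 \<i> z"
    define X1 X2 Z1 Z2 where pw: "X1 = (\<epsilon> + (u * u + v * v)) powr (q - 1)" "X2 = (\<epsilon> + (u * u + v * v)) powr (q - 2)"
      "Z1 = (\<epsilon> + u * u) powr (q - 1)" "Z2 = (\<epsilon> + u * u) powr (q - 2)"
    have e: "e z \<ge> 0" using grad(1)[of z] by (metis sum_power2_ge_zero)
    have c': "c' = - c" "d' = - d" and e1: "e z = a\<^sup>2 + a'\<^sup>2" and e2: "a\<^sup>2 + a'\<^sup>2 = b\<^sup>2 + b'\<^sup>2"
      and e3: "a * b + a' * b' = 0"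
      using lap[of z] grad[of z] by (simp_all add: vars)
    have "0 \<le> K * (q * (q - 1) * Z2 * (4 * (u * u) * e z) + q * Z1 * (2 * e z)) -
      (q * (q - 1) * X2 * (4 * (u * u + v * v) * e z) + q * X1 * (4 * e z))"
      using riesz_algebra_le_2[OF q \<epsilon> e, of u v] by (simp add: pw K_def)
    also have "4 * (u * u) * e z = (a * u + u * a)\<^sup>2 + (a' * u + u * a')\<^sup>2"
      by (simp add: e1) algebra
    also have "2 * e z = (c * u + 2 * a * a + u * c) + (c' * u + 2 * a' * a' + u * c')"
      by (simp add: e1 c' power2_eq_square)
    \<comment> \<open>The right-hand side is the squared gradient of u^2 + v^2; the mixed terms
      cancel because the gradients of \<open>u\<close> and \<open>v\<close> are orthogonal.\<close>
    also have "4 * (u * u + v * v) * e z = (a * u + u * a + (b * v + v * b))\<^sup>2 + (a' * u + u * a' + (b' * v + v * b'))\<^sup>2"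
      using e1 e2 e3 by algebra
    also have "4 * e z = (c * u + 2 * a * a + u * c + (d * v + 2 * b * b + v * d)) + (c' * u + 2 * a' * a' + u * c' + (d' * v + 2 * b' * b' + v * d'))"
      using e1 e2 c' by algebra
    finally show ?case
      unfolding vars[symmetric] u_def[symmetric] v_def[symmetric] pw[symmetric]
      by (simp add: ring_distribs)
  qed
  moreover have "2 * pi * \<Phi> 0 \<ge> 2 * pi * - ((\<epsilon> + (cmod (F 0))\<^sup>2) powr q)"
    using K by (intro mult_left_mono) (auto simp: \<Phi>_def cmod_power2')
  moreover have "integral {0..2*pi} (\<lambda>t. \<Phi> (cis t)) =
      K * integral {0..2*pi} (\<lambda>t. (\<epsilon> + (Re (F (cis t)))\<^sup>2) powr q)
      - integral {0..2*pi} (\<lambda>t. (\<epsilon> + (cmod (F (cis t)))\<^sup>2) powr q)"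
  proof -
    have "(\<lambda>t. (\<epsilon> + (Re (F (cis t)))\<^sup>2) powr q) integrable_on {0..2*pi}"
      "(\<lambda>t. (\<epsilon> + (cmod (F (cis t)))\<^sup>2) powr q) integrable_on {0..2*pi}"
      unfolding cmod_power2' by (unfold power2_eq_square) (intro integrable_continuous_interval c1 continuous_on_cis continuous_on_id)+
    note integral_diff[OF integrable_on_cmult_left[OF this(1), of K] this(2)]
    then show ?thesis unfolding \<Phi>_def cmod_power2' power2_eq_square[of "Re _"] by simp
  qed
  ultimately show ?thesis unfolding K_def by linarith
qed

text \<open>By |grad S|^2 \<le> 4 S e the left-hand side is at most 4 q^2 e S^(q-1). The Laplacian
  of u^2 S^(q-1) is at least 2 e S^(q-1), since its other two contributions are non-negative. Hence
  the factor 2 q^2.\<close>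

lemma riesz_algebra_ge_2:
  fixes q u v e :: real
  assumes q: "1 \<le> q" and \<epsilon>: "\<epsilon> > 0" and e: "e \<ge> 0"
  defines "S \<equiv> \<epsilon> + (u * u + v * v)"
  shows "q * (q - 1) * S powr (q - 2) * (4 * (u * u + v * v) * e) + q * S powr (q - 1) * (4 * e)
    \<le> 2 * q\<^sup>2 * (2 * e * S powr (q - 1) + (q - 1) * S powr (q - 1 - 1) * (8 * (u * u) * e)
      + u * u * ((q - 1) * (q - 1 - 1) * S powr (q - 1 - 2) * (4 * (u * u + v * v) * e) + (q - 1) * S powr (q - 1 - 1) * (4 * e)))"
proof -
  have S: "S > 0" using \<epsilon> by (simp add: S_def add_pos_nonneg)
  have s: "u * u + v * v \<le> S" "0 \<le> u * u + v * v" using \<epsilon> by (simp_all add: S_def)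
  have p1: "S powr (q - 1) = S powr (q - 2) * S" using powr_mult_cancel[OF S] .
  have p2: "S powr (q - 1 - 1) = S powr (q - 1 - 2) * S" using powr_mult_cancel[OF S, of "q - 1"] .
  have "q * (q - 1) * S powr (q - 2) * (4 * (u * u + v * v) * e) \<le> q * (q - 1) * S powr (q - 2) * (4 * S * e)"
    using q e s by (intro mult_left_mono mult_right_mono) auto
  then have "q * (q - 1) * S powr (q - 2) * (4 * (u * u + v * v) * e) + q * S powr (q - 1) * (4 * e)
      \<le> q * (q - 1) * S powr (q - 2) * (4 * S * e) + q * S powr (q - 1) * (4 * e)"
    by simp
  also have "\<dots> = 2 * q\<^sup>2 * (2 * e * S powr (q - 1))"
    unfolding p1 by (simp add: power2_eq_square algebra_simps)
  also have "\<dots> \<le> 2 * q\<^sup>2 * (2 * e * S powr (q - 1) + (q - 1) * S powr (q - 1 - 1) * (8 * (u * u) * e)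
      + u * u * ((q - 1) * (q - 1 - 1) * S powr (q - 1 - 2) * (4 * (u * u + v * v) * e) + (q - 1) * S powr (q - 1 - 1) * (4 * e)))"
  proof -
    \<comment> \<open>This is the Laplacian of S^(q-1). Writing S = \<epsilon> + u^2 + v^2 turns the
      coefficient q - 2 of u^2 + v^2 into q - 1, so the sign is right also for q < 2.\<close>
    have "(q - 1) * S powr (q - 1 - 2) * (4 * e) * ((q - 1) * (u * u + v * v) + \<epsilon>) \<ge> 0"
    proof -
      have "(q - 1) * (u * u + v * v) \<ge> 0" by (rule mult_nonneg_nonneg) (use q s(2) in auto)
      then show ?thesis using q e \<epsilon> by simp
    qed
    also have "(q - 1) * S powr (q - 1 - 2) * (4 * e) * ((q - 1) * (u * u + v * v) + \<epsilon>) =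
      (q - 1) * (q - 1 - 1) * S powr (q - 1 - 2) * (4 * (u * u + v * v) * e) + (q - 1) * S powr (q - 1 - 1) * (4 * e)"
      unfolding p2 by (simp add: S_def algebra_simps)
    finally have "0 \<le> u * u * ((q - 1) * (q - 1 - 1) * S powr (q - 1 - 2) * (4 * (u * u + v * v) * e) + (q - 1) * S powr (q - 1 - 1) * (4 * e))"
      by (rule mult_nonneg_nonneg[rotated]) simp
    moreover have "(q - 1) * S powr (q - 1 - 1) * (8 * (u * u) * e) \<ge> 0" using q e by simp
    ultimately show ?thesis by (intro mult_left_mono) auto
  qed
  finally show ?thesis .
qed

text \<open>The bracket subtracted is the comparison function \<Phi> for p \<ge> 2, whose first term
  still contains \<open>S\<close>. That term is absorbed pointwise: either 4 q^2 u^2 \<le> S and it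
  is at most S^q, or \<open>S\<close> is itself dominated by u^2.\<close>

lemma riesz_pointwise_ge_2:
  fixes q u \<epsilon> S :: real
  assumes q: "1 \<le> q" and \<epsilon>: "\<epsilon> > 0" and S: "S > 0"
  shows "S powr q \<le> 2 * (4 * q\<^sup>2) powr q * (\<epsilon> + u * u) powr q - 2 * (2 * q\<^sup>2 * (u * u * S powr (q - 1)) - S powr q)"
proof -
  have Sq: "S powr q = S powr (q - 1) * S" using powr_add[of S "q - 1" 1] S by simp
  have "4 * q\<^sup>2 * (u * u * S powr (q - 1)) \<le> 2 * (4 * q\<^sup>2) powr q * (\<epsilon> + u * u) powr q + S powr q"
  proof (cases "4 * q\<^sup>2 * (u * u) \<le> S")
    case True
    then have "4 * q\<^sup>2 * (u * u) * S powr (q - 1) \<le> S * S powr (q - 1)"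
      by (intro mult_right_mono) auto
    then have "4 * q\<^sup>2 * (u * u * S powr (q - 1)) \<le> S powr q"
      by (simp add: Sq mult_ac)
    moreover have "0 \<le> 2 * (4 * q\<^sup>2) powr q * (\<epsilon> + u * u) powr q" by simp
    ultimately show ?thesis by linarith
  next
    case False
    \<comment> \<open>\<open>Y\<close> dominates both \<open>S\<close> and 4 q^2 u^2, so the product
      collapses to the single power Y^q.\<close>
    define Y where "Y = 4 * q\<^sup>2 * (\<epsilon> + u * u)"
    have Y: "Y > 0" "S \<le> Y" "4 * q\<^sup>2 * (u * u) \<le> Y"
    proof -
      have "4 * q\<^sup>2 * \<epsilon> > 0" using \<epsilon> q by simp
      then show "4 * q\<^sup>2 * (u * u) \<le> Y" "Y > 0" "S \<le> Y"
        using False S unfolding Y_def ring_distribs by linarith+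
    qed
    have "4 * q\<^sup>2 * (u * u) * S powr (q - 1) \<le> Y * Y powr (q - 1)"
      using Y S q by (intro mult_mono powr_mono2) auto
    also have "\<dots> = Y powr q" using powr_add[of Y 1 "q - 1"] Y by simp
    also have "\<dots> = (4 * q\<^sup>2) powr q * (\<epsilon> + u * u) powr q"
      unfolding Y_def using \<epsilon> by (intro powr_mult) 
    also have "\<dots> \<le> 2 * (4 * q\<^sup>2) powr q * (\<epsilon> + u * u) powr q + S powr q" by simp
    finally show ?thesis by (simp add: mult.assoc)
  qed
  then show ?thesis by (simp add: algebra_simps)
qed

text \<open>Integrating \<open>riesz_pointwise_ge_2\<close> eliminates |F| from the right-hand side.
  Its term -2 \<Phi> is bounded by the sub-mean value inequality, and the factor 2 turns the central
  contribution into 4 pi times a power.\<close>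

lemma riesz_energy_ge_2:
  fixes q \<epsilon> :: real
  assumes F: "F holomorphic_on UNIV" and q: "1 \<le> q" and \<epsilon>: "\<epsilon> > 0"
  shows "integral {0..2*pi} (\<lambda>t. (\<epsilon> + (cmod (F (cis t)))\<^sup>2) powr q) \<le>
    2 * (4 * q\<^sup>2) powr q * integral {0..2*pi} (\<lambda>t. (\<epsilon> + (Re (F (cis t)))\<^sup>2) powr q)
     + 4 * pi * (\<epsilon> + (cmod (F 0))\<^sup>2) powr q"
proof -
  obtain U1 U2 V1 V2 e where
    U: "twice_diff (\<lambda>z. Re (F (exp z))) U1 U2" and V: "twice_diff (\<lambda>z. Im (F (exp z))) V1 V2"
    and lap: "\<And>z. U2 1 z + U2 \<i> z = 0" "\<And>z. V2 1 z + V2 \<i> z = 0"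
    and grad: "\<And>z. (U1 1 z)\<^sup>2 + (U1 \<i> z)\<^sup>2 = e z" "\<And>z. (V1 1 z)\<^sup>2 + (V1 \<i> z)\<^sup>2 = e z"
      "\<And>z. U1 1 z * V1 1 z + U1 \<i> z * V1 \<i> z = 0"
    using entire_exp_twice_diff[OF F] by blast
  define K where "K = 2 * q\<^sup>2"
  have K: "K \<ge> 0" by (simp add: K_def)
  define \<Phi> where "\<Phi> w = K * ((Re (F w) * Re (F w)) * (\<epsilon> + (Re (F w) * Re (F w) + Im (F w) * Im (F w))) powr (q - 1))
     + (-1) * (\<epsilon> + (Re (F w) * Re (F w) + Im (F w) * Im (F w))) powr q" for w
  have pos: "\<epsilon> + Re w * Re w > 0" "\<epsilon> + (Re w * Re w + Im w * Im w) > 0" for w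
    using \<epsilon> by (simp_all add: add_pos_nonneg)
  have cF: "continuous_on UNIV F" using F by (rule holomorphic_on_imp_continuous_on)
  have c1: "continuous_on A (\<lambda>x. (\<epsilon> + Re (F (g x)) * Re (F (g x))) powr r)"
    "continuous_on A (\<lambda>x. (\<epsilon> + (Re (F (g x)) * Re (F (g x)) + Im (F (g x)) * Im (F (g x)))) powr r)"
    "continuous_on A (\<lambda>x. Re (F (g x)) * Re (F (g x)))"
    if "continuous_on A g" for A and g :: "'b::topological_space \<Rightarrow> complex" and r
    using pos by (intro continuous_intros continuous_on_compose2[OF cF that]; simp add: less_imp_neq[symmetric])+
  have c\<Phi>: "continuous_on A (\<lambda>x. \<Phi> (g x))" if "continuous_on A g" for A and g :: "'b::topological_space \<Rightarrow> complex"
    unfolding \<Phi>_def[abs_def] using that by (intro continuous_on_add continuous_on_mult continuous_on_const c1)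
  note tS = twice_diff_add[OF twice_diff_const[of \<epsilon>] twice_diff_add[OF twice_diff_mult[OF U U] twice_diff_mult[OF V V]]]
  note tY' = twice_diff_mult[OF twice_diff_mult[OF U U] twice_diff_powr[OF tS, of "q - 1", OF pos(2)]]
  note tS' = twice_diff_powr[OF tS, of q, OF pos(2)]
  note t\<Phi> = twice_diff_add[OF twice_diff_mult[OF twice_diff_const[of K] tY'] twice_diff_mult[OF twice_diff_const[of "-1"] tS']]
  have "2 * pi * \<Phi> 0 \<le> integral {0..2*pi} (\<lambda>t. \<Phi> (cis t))"
  proof (rule submean_inequality[OF c\<Phi>[OF continuous_on_id] t\<Phi>[folded \<Phi>_def]], goal_cases)
    case (1 z)
    define u v where "u = Re (F (exp z))" and "v = Im (F (exp z))"
    define a a' b b' c c' d d' where vars: "a = U1 1 z" "a' = U1 \<i> z" "b = V1 1 z" "b' = V1 \<i> z"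
      "c = U2 1 z" "c' = U2 \<i> z" "d = V2 1 z" "d' = V2 \<i> z"
    define X1 X2 Z1 Z2 where pw: "X1 = (\<epsilon> + (u * u + v * v)) powr (q - 1)" "X2 = (\<epsilon> + (u * u + v * v)) powr (q - 2)"
      "Z1 = (\<epsilon> + (u * u + v * v)) powr (q - 1 - 1)" "Z2 = (\<epsilon> + (u * u + v * v)) powr (q - 1 - 2)"
    have e: "e z \<ge> 0" using grad(1)[of z] by (metis sum_power2_ge_zero)
    have c': "c' = - c" "d' = - d" and e1: "e z = a\<^sup>2 + a'\<^sup>2" and e2: "a\<^sup>2 + a'\<^sup>2 = b\<^sup>2 + b'\<^sup>2"
      and e3: "a * b + a' * b' = 0"
      using lap[of z] grad[of z] by (simp_all add: vars)
    define A A' B B' where AB: "A = a * u + u * a" "A' = a' * u + u * a'" "B = b * v + v * b" "B' = b' * v + v * b'"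
    define C C' D D' where CD: "C = c * u + 2 * a * a + u * c" "C' = c' * u + 2 * a' * a' + u * c'"
      "D = d * v + 2 * b * b + v * d" "D' = d' * v + 2 * b' * b' + v * d'"
    have "0 \<le> K * (2 * e z * X1 + (q - 1) * Z1 * (8 * (u * u) * e z)
      + u * u * ((q - 1) * (q - 1 - 1) * Z2 * (4 * (u * u + v * v) * e z) + (q - 1) * Z1 * (4 * e z)))
      - (q * (q - 1) * X2 * (4 * (u * u + v * v) * e z) + q * X1 * (4 * e z))"
      using riesz_algebra_ge_2[OF q \<epsilon> e, of u v] by (simp add: pw K_def)
    also have "8 * (u * u) * e z = 2 * A * (A + B) + 2 * A' * (A' + B')"
      using e1 e2 e3 unfolding AB by algebra
    also have "2 * e z = C + C'"
      by (simp add: CD e1 c' power2_eq_square)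
    also have "4 * (u * u + v * v) * e z = (A + B)\<^sup>2 + (A' + B')\<^sup>2"
      using e1 e2 e3 unfolding AB by algebra
    also have "4 * e z = (C + D) + (C' + D')"
      using e1 e2 c' unfolding CD by algebra
    finally show ?case
      unfolding vars[symmetric] u_def[symmetric] v_def[symmetric] pw[symmetric] AB[symmetric] CD[symmetric]
      by (simp add: algebra_simps)
  qed
  moreover have "2 * pi * \<Phi> 0 \<ge> 2 * pi * - ((\<epsilon> + (cmod (F 0))\<^sup>2) powr q)"
    using K by (intro mult_left_mono) (auto simp: \<Phi>_def cmod_power2')
  moreover have "integral {0..2*pi} (\<lambda>t. (\<epsilon> + (cmod (F (cis t)))\<^sup>2) powr q)
     \<le> 2 * (4 * q\<^sup>2) powr q * integral {0..2*pi} (\<lambda>t. (\<epsilon> + (Re (F (cis t)))\<^sup>2) powr q)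
      - 2 * integral {0..2*pi} (\<lambda>t. \<Phi> (cis t))"
  proof -
    have cis: "continuous_on {0..2*pi} cis" by (intro continuous_intros)
    have i: "(\<lambda>t. (\<epsilon> + (Re (F (cis t)))\<^sup>2) powr q) integrable_on {0..2*pi}"
      "(\<lambda>t. (\<epsilon> + (cmod (F (cis t)))\<^sup>2) powr q) integrable_on {0..2*pi}"
      "(\<lambda>t. \<Phi> (cis t)) integrable_on {0..2*pi}"
      unfolding cmod_power2' by (unfold power2_eq_square) (intro integrable_continuous_interval c1 c\<Phi> cis)+
    have "integral {0..2*pi} (\<lambda>t. (\<epsilon> + (cmod (F (cis t)))\<^sup>2) powr q)
     \<le> integral {0..2*pi} (\<lambda>t. 2 * (4 * q\<^sup>2) powr q * (\<epsilon> + (Re (F (cis t)))\<^sup>2) powr q - 2 * \<Phi> (cis t))"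
    proof (rule integral_le)
      show "(\<epsilon> + (cmod (F (cis t)))\<^sup>2) powr q \<le> 2 * (4 * q\<^sup>2) powr q * (\<epsilon> + (Re (F (cis t)))\<^sup>2) powr q - 2 * \<Phi> (cis t)" for t
        using riesz_pointwise_ge_2[OF q \<epsilon> pos(2)[of "F (cis t)"], of "Re (F (cis t))"]
        unfolding \<Phi>_def K_def cmod_power2' power2_eq_square[of "Re _"] by simp
    qed (use i integrable_on_cmult_left[OF i(1), of "2 * (4 * q\<^sup>2) powr q"] in \<open>auto intro!: integrable_diff\<close>)
    also have "\<dots> = 2 * (4 * q\<^sup>2) powr q * integral {0..2*pi} (\<lambda>t. (\<epsilon> + (Re (F (cis t)))\<^sup>2) powr q)
      - 2 * integral {0..2*pi} (\<lambda>t. \<Phi> (cis t))"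
      using integral_diff[OF integrable_on_cmult_left[OF i(1), of "2 * (4 * q\<^sup>2) powr q"] integrable_on_cmult_left[OF i(3), of 2]] by simp
    finally show ?thesis .
  qed
  ultimately show ?thesis by linarith
qed

text \<open>Both ranges of \<open>p\<close> give an energy inequality of the same shape. Splitting
  (\<epsilon> + x^2)^q \<le> 2^q \<epsilon>^q + 2^q |x|^p isolates \<epsilon> in a summand that
  vanishes as \<epsilon> tends to 0 from the right.\<close>

lemma riesz_entire:
  fixes p :: real
  assumes p: "1 < p"
  obtains C where "C \<ge> 0" and "\<And>F. F holomorphic_on UNIV \<Longrightarrow>
    integral {0..2*pi} (\<lambda>t. cmod (F (cis t)) powr p)
      \<le> C * (integral {0..2*pi} (\<lambda>t. \<bar>Re (F (cis t))\<bar> powr p) + cmod (F 0) powr p)"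
proof -
  define q where "q = p / 2"
  have q: "q > 1/2" using p by (simp add: q_def)
  obtain C where C: "C \<ge> 0" and en: "\<And>F \<epsilon>. F holomorphic_on UNIV \<Longrightarrow> \<epsilon> > 0 \<Longrightarrow>
    integral {0..2*pi} (\<lambda>t. (\<epsilon> + (cmod (F (cis t)))\<^sup>2) powr q) \<le>
     C * integral {0..2*pi} (\<lambda>t. (\<epsilon> + (Re (F (cis t)))\<^sup>2) powr q) + 4 * pi * (\<epsilon> + (cmod (F 0))\<^sup>2) powr q"
  proof (cases "q \<le> 1")
    case True
    show ?thesis
    proof (rule that[of "2 / (2 * q - 1)"])
      fix F :: "complex \<Rightarrow> complex" and \<epsilon> :: real
      assume F: "F holomorphic_on UNIV" "\<epsilon> > 0"
      have "2 * pi * (\<epsilon> + (cmod (F 0))\<^sup>2) powr q \<le> 4 * pi * (\<epsilon> + (cmod (F 0))\<^sup>2) powr q"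
        by (intro mult_right_mono) auto
      then show "integral {0..2*pi} (\<lambda>t. (\<epsilon> + (cmod (F (cis t)))\<^sup>2) powr q) \<le>
        2 / (2 * q - 1) * integral {0..2*pi} (\<lambda>t. (\<epsilon> + (Re (F (cis t)))\<^sup>2) powr q) + 4 * pi * (\<epsilon> + (cmod (F 0))\<^sup>2) powr q"
        using riesz_energy_le_2[OF F(1) q True F(2)] by linarith
    qed (use q in simp)
  next
    case False
    then show ?thesis
      by (intro that[of "2 * (4 * q\<^sup>2) powr q"] riesz_energy_ge_2) auto
  qed
  have sq: "(x\<^sup>2) powr q = \<bar>x\<bar> powr p" for x :: real
  proof -
    have "x\<^sup>2 = \<bar>x\<bar> powr 2" by simp
    then show ?thesis by (simp only: powr_powr) (simp add: q_def)
  qed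
  have two: "(\<epsilon> + x\<^sup>2) powr q \<le> 2 powr q * \<epsilon> powr q + 2 powr q * \<bar>x\<bar> powr p" if "\<epsilon> > 0" for \<epsilon> x :: real
  proof -
    have "(\<epsilon> + x\<^sup>2) powr q \<le> (2 * max \<epsilon> (x\<^sup>2)) powr q" using that q by (intro powr_mono2) auto
    also have "\<dots> = 2 powr q * max \<epsilon> (x\<^sup>2) powr q" using that by (intro powr_mult)
    also have "max \<epsilon> (x\<^sup>2) powr q \<le> \<epsilon> powr q + (x\<^sup>2) powr q" by (auto simp: max_def)
    finally show ?thesis by (simp add: sq ring_distribs)
  qed
  define C' where "C' = (C + 4 * pi) * 2 powr q"
  show ?thesis
  proof (rule that)
    show "C' \<ge> 0" using C by (simp add: C'_def)
    fix F :: "complex \<Rightarrow> complex" assume F: "F holomorphic_on UNIV"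
    have cF: "continuous_on UNIV F" using F by (rule holomorphic_on_imp_continuous_on)
    have cFc: "continuous_on {0..2*pi} (\<lambda>t. F (cis t))"
      by (intro continuous_on_compose2[OF cF] continuous_intros) auto
    define I J where "I = integral {0..2*pi} (\<lambda>t. cmod (F (cis t)) powr p)"
      and "J = integral {0..2*pi} (\<lambda>t. \<bar>Re (F (cis t))\<bar> powr p)"
    have intI: "(\<lambda>t. cmod (F (cis t)) powr p) integrable_on {0..2*pi}"
      and intJ: "(\<lambda>t. \<bar>Re (F (cis t))\<bar> powr p) integrable_on {0..2*pi}"
      using p by (intro integrable_continuous_interval continuous_on_powr' continuous_intros cFc; simp)+
    have J0: "J \<ge> 0" unfolding J_def by (rule integral_nonneg[OF intJ]) auto
    have bound: "I \<le> C' * (J + cmod (F 0) powr p) + C'' * \<epsilon> powr q"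
      if \<epsilon>: "\<epsilon> > 0" and C'': "C'' = C * (2 * pi * 2 powr q) + 4 * pi * 2 powr q" for \<epsilon> C''
    proof -
      have pos: "\<epsilon> + x\<^sup>2 \<noteq> 0" for x using \<epsilon> by (smt (verit) zero_le_power2)
      have i1: "(\<lambda>t. (\<epsilon> + (cmod (F (cis t)))\<^sup>2) powr q) integrable_on {0..2*pi}"
        and i2: "(\<lambda>t. (\<epsilon> + (Re (F (cis t)))\<^sup>2) powr q) integrable_on {0..2*pi}"
        by (intro integrable_continuous_interval continuous_intros cFc; simp add: pos)+
      have "I \<le> integral {0..2*pi} (\<lambda>t. (\<epsilon> + (cmod (F (cis t)))\<^sup>2) powr q)"
        unfolding I_def
      proof (rule integral_le[OF intI i1])
        show "cmod (F (cis t)) powr p \<le> (\<epsilon> + (cmod (F (cis t)))\<^sup>2) powr q" for t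
          using sq[of "cmod (F (cis t))"] powr_mono2[of q "(cmod (F (cis t)))\<^sup>2" "\<epsilon> + (cmod (F (cis t)))\<^sup>2"] q \<epsilon> by simp
      qed
      also have "\<dots> \<le> C * integral {0..2*pi} (\<lambda>t. (\<epsilon> + (Re (F (cis t)))\<^sup>2) powr q) + 4 * pi * (\<epsilon> + (cmod (F 0))\<^sup>2) powr q"
        by (rule en[OF F \<epsilon>])
      also have "\<dots> \<le> C * (2 * pi * (2 powr q * \<epsilon> powr q) + 2 powr q * J) + 4 * pi * (2 powr q * \<epsilon> powr q + 2 powr q * cmod (F 0) powr p)"
      proof (intro add_mono mult_left_mono)
        have "integral {0..2*pi} (\<lambda>t. (\<epsilon> + (Re (F (cis t)))\<^sup>2) powr q)
          \<le> integral {0..2*pi} (\<lambda>t. 2 powr q * \<epsilon> powr q + 2 powr q * \<bar>Re (F (cis t))\<bar> powr p)"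
          by (rule integral_le[OF i2]) (use two[OF \<epsilon>] in \<open>auto intro!: integrable_add integrable_on_cmult_left intJ\<close>)
        also have "\<dots> = 2 * pi * (2 powr q * \<epsilon> powr q) + 2 powr q * J"
          using integral_add[OF integrable_const_ivl[of "2 powr q * \<epsilon> powr q" 0 "2*pi"] integrable_on_cmult_left[OF intJ, of "2 powr q"]]
          by (simp add: J_def)
        finally show "integral {0..2*pi} (\<lambda>t. (\<epsilon> + (Re (F (cis t)))\<^sup>2) powr q) \<le> 2 * pi * (2 powr q * \<epsilon> powr q) + 2 powr q * J" .
        show "(\<epsilon> + (cmod (F 0))\<^sup>2) powr q \<le> 2 powr q * \<epsilon> powr q + 2 powr q * cmod (F 0) powr p"
          using two[OF \<epsilon>, of "cmod (F 0)"] by simp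
      qed (use C in auto)
      also have "\<dots> = (C * 2 powr q) * J + (4 * pi * 2 powr q) * cmod (F 0) powr p + C'' * \<epsilon> powr q"
        by (simp add: C'' algebra_simps)
      also have "\<dots> \<le> C' * J + C' * cmod (F 0) powr p + C'' * \<epsilon> powr q"
        using C J0 by (intro add_mono mult_right_mono order_refl) (auto simp: C'_def algebra_simps)
      finally show ?thesis by (simp add: ring_distribs)
    qed
    have "((\<lambda>\<epsilon>. C' * (J + cmod (F 0) powr p) + (C * (2 * pi * 2 powr q) + 4 * pi * 2 powr q) * \<epsilon> powr q) \<longlongrightarrow>
       C' * (J + cmod (F 0) powr p) + (C * (2 * pi * 2 powr q) + 4 * pi * 2 powr q) * 0) (at_right 0)"
      using q by (intro tendsto_intros tendsto_zero_powrI[of "\<lambda>x. x"]) (auto simp: eventually_at_filter)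
    then have "I \<le> C' * (J + cmod (F 0) powr p) + (C * (2 * pi * 2 powr q) + 4 * pi * 2 powr q) * 0"
      by (rule tendsto_lowerbound) (use bound in \<open>auto simp: eventually_at_right_less intro: eventually_at_right_less[THEN eventually_mono]\<close>)
    then show "integral {0..2*pi} (\<lambda>t. cmod (F (cis t)) powr p)
      \<le> C' * (integral {0..2*pi} (\<lambda>t. \<bar>Re (F (cis t))\<bar> powr p) + cmod (F 0) powr p)"
      by (simp add: I_def J_def)
  qed
qed

section \<open>Projections and partial sums of trigonometric polynomials\<close>

lemma has_integral_cis_multiple:
  "((\<lambda>t. cis (of_int k * t)) has_integral (if k = 0 then 2 * pi else 0)) {0..2*pi}"
proof (cases "k = 0")
  case True
  then show ?thesis using has_integral_const_real[of "1::complex" 0 "2*pi"] by (simp add: scaleR_conv_of_real)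
next
  case False
  have "((\<lambda>t. cis (of_int k * t)) has_integral
      cis (of_int k * (2*pi)) / (\<i> * of_int k) - cis (of_int k * 0) / (\<i> * of_int k)) {0..2*pi}"
  proof (rule fundamental_theorem_of_calculus)
    fix t :: real
    have "((\<lambda>w. exp (\<i> * of_int k * w) / (\<i> * of_int k)) has_field_derivative exp (\<i> * of_int k * of_real t)) (at (of_real t))"
      using False by (auto intro!: derivative_eq_intros)
    then have "((\<lambda>t. exp (\<i> * of_int k * of_real t) / (\<i> * of_int k)) has_vector_derivative exp (\<i> * of_int k * of_real t)) (at t within {0..2*pi})"
      by (rule has_vector_derivative_real_field[THEN has_vector_derivative_at_within])
    then show "((\<lambda>t. cis (of_int k * t) / (\<i> * of_int k)) has_vector_derivative cis (of_int k * t)) (at t within {0..2*pi})"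
      by (simp add: cis_conv_exp mult_ac)
  qed simp
  moreover have "cis (of_int k * (2*pi)) = 1"
    using cis_multiple_2pi[of "of_int k"] by (simp add: mult_ac)
  ultimately show ?thesis using False by simp
qed

text \<open>Jensen's inequality with a cheaper constant.\<close>

lemma powr_mean_le:
  fixes g :: "real \<Rightarrow> complex"
  assumes p: "1 < p" and g: "continuous_on {0..2*pi} g"
  shows "cmod (integral {0..2*pi} g / (2 * pi)) powr p
    \<le> 2 powr p * integral {0..2*pi} (\<lambda>t. cmod (g t) powr p)"
proof -
  define m where "m = cmod (integral {0..2*pi} g / (2 * pi))"
  define I where "I = integral {0..2*pi} (\<lambda>t. cmod (g t) powr p)"
  have int: "(\<lambda>t. cmod (g t) powr p) integrable_on {0..2*pi}"
    using p g by (intro integrable_continuous_interval continuous_on_powr' continuous_intros) auto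
  have I0: "I \<ge> 0" unfolding I_def by (rule integral_nonneg[OF int]) auto
  show ?thesis
  proof (cases "m = 0")
    case True
    then show ?thesis using I0 by (simp add: m_def I_def)
  next
    case False
    then have m: "m > 0" by (simp add: m_def)
    \<comment> \<open>Values below m / 2 contribute at most half of the mean and are absorbed on the
      left; above m / 2 the negative exponent 1 - p allows |g|^(1-p) to be replaced by
      (m/2)^(1-p).\<close>
    have pt: "cmod (g t) \<le> m / 2 + (m / 2) powr (1 - p) * cmod (g t) powr p" for t
    proof (cases "cmod (g t) \<le> m / 2")
      case False
      have "cmod (g t) = cmod (g t) powr (1 - p) * cmod (g t) powr p"
        using False m powr_add[of "cmod (g t)" "1 - p" p] by simp
      also have "\<dots> \<le> (m / 2) powr (1 - p) * cmod (g t) powr p"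
        using False m p by (intro mult_right_mono powr_mono2') auto
      finally show ?thesis using m by simp
    qed (simp add: add_increasing2)
    have "m = cmod (integral {0..2*pi} g) / (2 * pi)" by (simp add: m_def norm_divide)
    also have "cmod (integral {0..2*pi} g) \<le> integral {0..2*pi} (\<lambda>t. m / 2 + (m / 2) powr (1 - p) * cmod (g t) powr p)"
    proof (rule integral_norm_bound_integral)
      show "(\<lambda>t. m / 2 + (m / 2) powr (1 - p) * cmod (g t) powr p) integrable_on {0..2*pi}"
        using integrable_on_cmult_left[OF int, of "(m / 2) powr (1 - p)"] by (intro integrable_add) auto
    qed (use pt g in \<open>auto intro: integrable_continuous_interval\<close>)
    also have "\<dots> = 2 * pi * (m / 2) + (m / 2) powr (1 - p) * I"
      using integral_add[OF integrable_const_ivl[of "m / 2" 0 "2*pi"] integrable_on_cmult_left[OF int, of "(m / 2) powr (1 - p)"]]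
      by (simp add: I_def)
    finally have "m \<le> m / 2 + (m / 2) powr (1 - p) * I / (2 * pi)"
      by (simp add: divide_right_mono add_divide_distrib)
    then have "m / 2 \<le> (m / 2) powr (1 - p) * (I / (2 * pi))"
      unfolding times_divide_eq_right by linarith
    then have "(m / 2) * (m / 2) powr (p - 1) \<le> (m / 2) powr (1 - p) * (I / (2 * pi)) * (m / 2) powr (p - 1)"
      by (intro mult_right_mono) auto
    also have "\<dots> = I / (2 * pi)"
      using m powr_add[of "m / 2" "1 - p" "p - 1"] by (simp add: mult_ac)
    also have "(m / 2) * (m / 2) powr (p - 1) = (m / 2) powr p"
      using m powr_add[of "m / 2" 1 "p - 1"] by simp
    also have "I / (2 * pi) \<le> I"
      using I0 pi_gt3 by (simp add: divide_le_eq mult_le_cancel_left1)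
    finally have "2 powr p * (m / 2) powr p \<le> 2 powr p * I" by simp
    also have "2 powr p * (m / 2) powr p = m powr p"
      using m by (simp flip: powr_mult)
    finally show ?thesis by (simp add: m_def I_def)
  qed
qed

lemma continuous_on_trig_sum:
  "continuous_on A (\<lambda>t. \<Sum>k\<in>G. c k * cis (real_of_int k * t))"
  by (intro continuous_intros)

lemma continuous_on_powr_norm:
  fixes f :: "'a::topological_space \<Rightarrow> complex"
  assumes "p > 0" "continuous_on A f"
  shows "continuous_on A (\<lambda>x. cmod (f x) powr p)"
  using assms by (intro continuous_on_powr' continuous_intros) auto

text \<open>A bound by the real part of an entire function controls the projection onto non-negative
  frequencies, provided that the value at 0 is controlled too; that value is the mean of the
  polynomial.\<close>

lemma riesz_analytic_projection:
  fixes p :: real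
  assumes p: "1 < p"
  obtains C where "C \<ge> 0" and "\<And>(G :: int set) c. finite G \<Longrightarrow>
    integral {0..2*pi} (\<lambda>t. cmod (\<Sum>k\<in>{k\<in>G. 0 \<le> k}. c k * cis (of_int k * t)) powr p)
      \<le> C * integral {0..2*pi} (\<lambda>t. cmod (\<Sum>k\<in>G. c k * cis (of_int k * t)) powr p)"
proof -
  obtain C where C: "C \<ge> 0" and riesz: "\<And>F. F holomorphic_on UNIV \<Longrightarrow>
    integral {0..2*pi} (\<lambda>t. cmod (F (cis t)) powr p)
      \<le> C * (integral {0..2*pi} (\<lambda>t. \<bar>Re (F (cis t))\<bar> powr p) + cmod (F 0) powr p)"
    using riesz_entire[OF p] by blast
  have p0: "p > 0" using p by simp
  show ?thesis
  proof (rule that)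
    show "2 * C * (1 + 2 powr p) \<ge> 0" using C by simp
    fix G :: "int set" and c :: "int \<Rightarrow> complex"
    assume G: "finite G"
    define g where "g t = (\<Sum>k\<in>G. c k * cis (of_int k * t))" for t
    define P where "P = {k\<in>G. 0 \<le> k}"
    define Q where "Q = {k\<in>G. k < 0}"
    have PQ: "finite P" "finite Q" "P \<inter> Q = {}" "P \<union> Q = G" using G by (auto simp: P_def Q_def)
    define A where "A z = (\<Sum>k\<in>P. c k * z ^ nat k)" for z
    \<comment> \<open>Conjugating the negative frequencies makes \<open>B\<close> a polynomial, and
      on the circle \<open>g\<close> becomes \<open>A + cnj B\<close>.\<close>
    define B where "B z = (\<Sum>k\<in>Q. cnj (c k) * z ^ nat (- k))" for z
    have A: "A (cis t) = (\<Sum>k\<in>P. c k * cis (of_int k * t))" for t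
      unfolding A_def
    proof (rule sum.cong)
      fix k assume "k \<in> P"
      then show "c k * cis t ^ nat k = c k * cis (of_int k * t)"
        using Complex.DeMoivre[of t "nat k"] by (simp add: P_def)
    qed simp
    have B: "cnj (B (cis t)) = (\<Sum>k\<in>Q. c k * cis (of_int k * t))" for t
      unfolding B_def cnj_sum by (rule sum.cong) (auto simp: Q_def Complex.DeMoivre cis_cnj)
    text \<open>\<open>A\<close> is recovered from the entire functions \<open>A + B\<close> and \<open>-\<i>(A - B)\<close>, whose real parts on the
      circle are \<open>Re g\<close> and \<open>Im g\<close>.\<close>
    have g: "g t = A (cis t) + cnj (B (cis t))" for t
      unfolding g_def A B using sum.union_disjoint[OF PQ(1,2,3), of "\<lambda>k. c k * cis (of_int k * t)"] PQ(4) by simp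
    define F1 F2 where "F1 z = A z + B z" and "F2 z = - \<i> * (A z - B z)" for z
    have hol: "F1 holomorphic_on UNIV" "F2 holomorphic_on UNIV"
      unfolding F1_def[abs_def] F2_def[abs_def] A_def B_def by (intro holomorphic_intros)+
    have cg: "continuous_on {0..2*pi} g"
      unfolding g_def[abs_def] by (rule continuous_on_trig_sum)
    have cF: "continuous_on {0..2*pi} (\<lambda>t. F1 (cis t))" "continuous_on {0..2*pi} (\<lambda>t. F2 (cis t))"
      "continuous_on {0..2*pi} (\<lambda>t. A (cis t))"
      unfolding F1_def F2_def A_def B_def by (intro continuous_intros)+
    note [simp] = integrable_continuous_interval[OF continuous_on_powr_norm[OF p0 cg]]
      integrable_continuous_interval[OF continuous_on_powr_norm[OF p0 cF(1)]]
      integrable_continuous_interval[OF continuous_on_powr_norm[OF p0 cF(2)]]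
      integrable_continuous_interval[OF continuous_on_powr_norm[OF p0 cF(3)]]
    define I where "I = integral {0..2*pi} (\<lambda>t. cmod (g t) powr p)"
    have Re_F: "Re (F1 (cis t)) = Re (g t)" "Re (F2 (cis t)) = Im (g t)" for t
      by (simp_all add: g F1_def F2_def)
    have iRe: "(\<lambda>t. \<bar>Re (F (cis t))\<bar> powr p) integrable_on {0..2*pi}"
      if "continuous_on {0..2*pi} (\<lambda>t. F (cis t))" for F
      using p that by (intro integrable_continuous_interval continuous_on_powr' continuous_intros) auto
    \<comment> \<open>Since \<open>B\<close> has no constant term, |F1(0)| = |F2(0)| = |A(0)|, and
      A(0) is the mean of \<open>g\<close>, to which \<open>powr_mean_le\<close> applies.\<close>
    have B0: "B 0 = 0" unfolding B_def by (rule sum.neutral) (auto simp: Q_def)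
    have "(g has_integral (\<Sum>k\<in>G. c k * (if k = 0 then 2 * pi else 0))) {0..2*pi}"
      unfolding g_def[abs_def] by (intro has_integral_sum G has_integral_mult_right has_integral_cis_multiple)
    moreover have "(\<Sum>k\<in>G. c k * (if k = 0 then 2 * pi else 0)) = (\<Sum>k\<in>P. c k * 0 ^ nat k) * (2 * pi)"
      unfolding sum_distrib_right by (rule sum.mono_neutral_cong_right) (use G in \<open>auto simp: P_def\<close>)
    ultimately have A0: "A 0 = integral {0..2*pi} g / (2 * pi)"
      unfolding A_def by (simp add: integral_unique)
    have A0p: "cmod (A 0) powr p \<le> 2 powr p * I"
      unfolding A0 I_def by (rule powr_mean_le[OF p cg])
    have b: "integral {0..2*pi} (\<lambda>t. cmod (F (cis t)) powr p) \<le> C * (I + 2 powr p * I)"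
      if F: "F holomorphic_on UNIV" "continuous_on {0..2*pi} (\<lambda>t. F (cis t))" "cmod (F 0) = cmod (A 0)"
       "\<And>t. \<bar>Re (F (cis t))\<bar> \<le> cmod (g t)" for F
    proof -
      have "integral {0..2*pi} (\<lambda>t. \<bar>Re (F (cis t))\<bar> powr p) \<le> I"
        unfolding I_def by (rule integral_le[OF iRe[OF F(2)]]) (use F(4) p in \<open>auto intro: powr_mono2\<close>)
      then show ?thesis using riesz[OF F(1)] A0p C F(3)
        by (smt (verit) mult_left_mono)
    qed
    have "cmod (A w) powr p \<le> cmod (F1 w) powr p + cmod (F2 w) powr p" for w
    proof -
      have "2 * A w = F1 w + \<i> * F2 w" by (simp add: F1_def F2_def)
      then have "2 * cmod (A w) \<le> cmod (F1 w) + cmod (F2 w)"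
        by (metis norm_triangle_ineq norm_mult norm_numeral norm_ii mult_1)
      then have "cmod (A w) \<le> cmod (F1 w) \<or> cmod (A w) \<le> cmod (F2 w)" by linarith
      then show ?thesis using p powr_mono2[of p "cmod (A w)"] by (smt (verit) norm_ge_zero powr_ge_zero)
    qed
    then have "integral {0..2*pi} (\<lambda>t. cmod (A (cis t)) powr p)
      \<le> integral {0..2*pi} (\<lambda>t. cmod (F1 (cis t)) powr p + cmod (F2 (cis t)) powr p)"
      by (intro integral_le integrable_add) auto
    also have "\<dots> = integral {0..2*pi} (\<lambda>t. cmod (F1 (cis t)) powr p) + integral {0..2*pi} (\<lambda>t. cmod (F2 (cis t)) powr p)"
      by (rule integral_add) auto
    also have "\<dots> \<le> C * (I + 2 powr p * I) + C * (I + 2 powr p * I)"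
    proof (intro add_mono b hol cF)
      show "cmod (F1 0) = cmod (A 0)" "cmod (F2 0) = cmod (A 0)"
        by (simp_all add: F1_def F2_def B0 norm_mult)
      show "\<bar>Re (F1 (cis t))\<bar> \<le> cmod (g t)" "\<bar>Re (F2 (cis t))\<bar> \<le> cmod (g t)" for t
        unfolding Re_F by (rule abs_Re_le_cmod abs_Im_le_cmod)+
    qed
    also have "\<dots> = 2 * C * (1 + 2 powr p) * I" by (simp add: algebra_simps)
    finally show "integral {0..2*pi} (\<lambda>t. cmod (\<Sum>k\<in>{k\<in>G. 0 \<le> k}. c k * cis (of_int k * t)) powr p)
      \<le> 2 * C * (1 + 2 powr p) * integral {0..2*pi} (\<lambda>t. cmod (\<Sum>k\<in>G. c k * cis (of_int k * t)) powr p)"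
      by (simp add: A I_def g_def P_def)
  qed
qed

lemma norm_diff_powr_le:
  fixes a b :: "'a::real_normed_vector"
  assumes "0 < p"
  shows "norm (a - b) powr p \<le> 2 powr p * (norm a powr p + norm b powr p)"
proof -
  have "norm (a - b) powr p \<le> (2 * max (norm a) (norm b)) powr p"
    using assms norm_triangle_ineq4[of a b] by (intro powr_mono2) auto
  also have "\<dots> = 2 powr p * max (norm a) (norm b) powr p" by (intro powr_mult)
  also have "max (norm a) (norm b) powr p \<le> norm a powr p + norm b powr p" by (auto simp: max_def)
  finally show ?thesis by simp
qed

text \<open>The block |k| \<le> N is the tail k \<ge> -N minus the tail k \<ge> N + 1. Each tail is
  an analytic projection after multiplication by a character, which leaves moduli unchanged; so the
  constant is independent of \<open>N\<close>.\<close>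

lemma riesz_partial_sum:
  fixes p :: real
  assumes p: "1 < p"
  obtains C where "C \<ge> 0" and "\<And>(G :: int set) c N. finite G \<Longrightarrow>
    integral {0..2*pi} (\<lambda>t. cmod (\<Sum>k\<in>{k\<in>G. \<bar>k\<bar> \<le> int N}. c k * cis (of_int k * t)) powr p)
      \<le> C * integral {0..2*pi} (\<lambda>t. cmod (\<Sum>k\<in>G. c k * cis (of_int k * t)) powr p)"
proof -
  obtain C where C: "C \<ge> 0" and riesz: "\<And>(G :: int set) c. finite G \<Longrightarrow>
    integral {0..2*pi} (\<lambda>t. cmod (\<Sum>k\<in>{k\<in>G. 0 \<le> k}. c k * cis (of_int k * t)) powr p)
      \<le> C * integral {0..2*pi} (\<lambda>t. cmod (\<Sum>k\<in>G. c k * cis (of_int k * t)) powr p)"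
    using riesz_analytic_projection[OF p] by blast
  have p0: "p > 0" using p by simp
  show ?thesis
  proof (rule that)
    show "2 powr p * (C + C) \<ge> 0" using C by simp
    fix G :: "int set" and c :: "int \<Rightarrow> complex" and N :: nat
    assume G: "finite G"
    define T where "T H t = (\<Sum>k\<in>H. c k * cis (of_int k * t))" for H t
    have int: "(\<lambda>t. cmod (T H t) powr p) integrable_on {0..2*pi}" for H
      unfolding T_def by (intro integrable_continuous_interval continuous_on_powr_norm p0 continuous_on_trig_sum)
    have tail: "integral {0..2*pi} (\<lambda>t. cmod (T {k\<in>G. m \<le> k} t) powr p)
       \<le> C * integral {0..2*pi} (\<lambda>t. cmod (T G t) powr p)" for m
    proof -
      have shift: "cmod (\<Sum>k\<in>(\<lambda>k. k - m) ` H. c (k + m) * cis (of_int k * t)) = cmod (T H t)" for H t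
      proof -
        have "(\<Sum>k\<in>(\<lambda>k. k - m) ` H. c (k + m) * cis (of_int k * t)) = (\<Sum>k\<in>H. c k * cis (of_int (k - m) * t))"
          by (subst sum.reindex) (auto simp: inj_on_def)
        also have "\<dots> = cis (- (of_int m * t)) * T H t"
          unfolding T_def sum_distrib_left
          by (rule sum.cong) (simp_all add: cis_mult left_diff_distrib mult.left_commute[of "cis _"] add.commute)
        finally show ?thesis by (simp add: norm_mult)
      qed
      have im: "{k \<in> (\<lambda>k. k - m) ` G. 0 \<le> k} = (\<lambda>k. k - m) ` {k\<in>G. m \<le> k}" by auto
      show ?thesis
        using riesz[of "(\<lambda>k. k - m) ` G" "\<lambda>k. c (k + m)"] G unfolding im shift by simp
    qed
    have split: "T {k\<in>G. \<bar>k\<bar> \<le> int N} t = T {k\<in>G. - int N \<le> k} t - T {k\<in>G. int N + 1 \<le> k} t" for t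
    proof -
      have "{k\<in>G. - int N \<le> k} = {k\<in>G. \<bar>k\<bar> \<le> int N} \<union> {k\<in>G. int N + 1 \<le> k}" by auto
      then have "T {k\<in>G. - int N \<le> k} t = T {k\<in>G. \<bar>k\<bar> \<le> int N} t + T {k\<in>G. int N + 1 \<le> k} t"
        unfolding T_def using G by (simp only:) (rule sum.union_disjoint; auto)
      then show ?thesis by simp
    qed
    have "integral {0..2*pi} (\<lambda>t. cmod (T {k\<in>G. \<bar>k\<bar> \<le> int N} t) powr p)
      \<le> integral {0..2*pi} (\<lambda>t. 2 powr p * (cmod (T {k\<in>G. - int N \<le> k} t) powr p + cmod (T {k\<in>G. int N + 1 \<le> k} t) powr p))"
    proof (rule integral_le[OF int])
      show "(\<lambda>t. 2 powr p * (cmod (T {k\<in>G. - int N \<le> k} t) powr p + cmod (T {k\<in>G. int N + 1 \<le> k} t) powr p)) integrable_on {0..2*pi}"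
        using integrable_on_cmult_left[OF integrable_add[OF int int], of "2 powr p"] by simp
    qed (simp add: split norm_diff_powr_le[OF p0])
    also have "\<dots> = 2 powr p * (integral {0..2*pi} (\<lambda>t. cmod (T {k\<in>G. - int N \<le> k} t) powr p) +
       integral {0..2*pi} (\<lambda>t. cmod (T {k\<in>G. int N + 1 \<le> k} t) powr p))"
      by (simp add: integral_add[OF int int])
    also have "\<dots> \<le> 2 powr p * (C * integral {0..2*pi} (\<lambda>t. cmod (T G t) powr p) + C * integral {0..2*pi} (\<lambda>t. cmod (T G t) powr p))"
      by (intro mult_left_mono add_mono tail) auto
    finally show "integral {0..2*pi} (\<lambda>t. cmod (\<Sum>k\<in>{k\<in>G. \<bar>k\<bar> \<le> int N}. c k * cis (of_int k * t)) powr p)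
      \<le> 2 powr p * (C + C) * integral {0..2*pi} (\<lambda>t. cmod (\<Sum>k\<in>G. c k * cis (of_int k * t)) powr p)"
      by (simp add: T_def algebra_simps)
  qed
qed

section \<open>Fourier coefficients in one coordinate\<close>

definition upd :: "'a ^ 'n \<Rightarrow> 'n \<Rightarrow> 'a \<Rightarrow> 'a ^ 'n" where
  "upd z j w = (\<chi> i. if i = j then w else z $ i)"

lemma upd_nth [simp]: "upd z j w $ i = (if i = j then w else z $ i)"
  by (simp add: upd_def)

lemma upd_upd [simp]: "upd (upd z j v) j w = upd z j w"
  by (simp add: vec_eq_iff)

lemma upd_triv [simp]: "upd z j (z $ j) = z"
  by (simp add: vec_eq_iff)

lemma continuous_on_upd [continuous_intros]:
  fixes f :: "'b::topological_space \<Rightarrow> ('a::topological_space) ^ 'n"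
  assumes "continuous_on A f" "continuous_on A g"
  shows "continuous_on A (\<lambda>x. upd (f x) j (g x))"
  unfolding upd_def
proof (intro continuous_on_vec_lambda)
  show "continuous_on A (\<lambda>x. if i = j then g x else f x $ i)" for i
    using assms by (cases "i = j") (auto intro: continuous_on_component)
qed

definition rot :: "'n \<Rightarrow> real \<Rightarrow> complex ^ 'n \<Rightarrow> complex ^ 'n" where
  "rot j t z = upd z j (cis t * z $ j)"

lemma rot_nth [simp]: "rot j t z $ i = (if i = j then cis t * z $ j else z $ i)"
  by (simp add: rot_def)

lemma continuous_on_rot [continuous_intros]:
  assumes "continuous_on A f" "continuous_on A g"
  shows "continuous_on A (\<lambda>x. rot j (g x) (f x))"
  unfolding rot_def by (intro continuous_intros assms)

text \<open>Only rotations of a single coordinate, which generate the torus action: averages and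
  Fourier coefficients are taken in one coordinate at a time.\<close>

definition torus_invariant :: "(complex ^ 'n) set \<Rightarrow> bool" where
  "torus_invariant T \<longleftrightarrow> (\<forall>z\<in>T. \<forall>j t. rot j t z \<in> T)"

lemma torus_invariantD: "torus_invariant T \<Longrightarrow> z \<in> T \<Longrightarrow> rot j t z \<in> T"
  by (simp add: torus_invariant_def)

lemma reinhardt_imp_torus_invariant:
  assumes "reinhardt R"
  shows "torus_invariant R"
  unfolding torus_invariant_def
proof (intro ballI allI)
  fix z j t assume z: "z \<in> R"
  have "rot j t z = (\<chi> i. cis ((\<chi> i. if i = j then t else 0) $ i) * z $ i)"
    by (simp add: vec_eq_iff)
  then show "rot j t z \<in> R" using assms z unfolding reinhardt_def by metis
qed

lemma rot_commute: "rot i s (rot j t z) = rot j t (rot i s z)"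
  by (simp add: vec_eq_iff)

lemma rot_rot: "rot j s (rot j t z) = rot j (s + t) z"
  by (simp add: vec_eq_iff flip: cis_mult)

lemma rot_2pi: "rot j (t + 2 * pi) z = rot j t z"
  by (simp add: vec_eq_iff flip: cis_mult)

lemma laurent_monomial_rot:
  "laurent_monomial \<alpha> (rot j t z) = cis (of_int (\<alpha> $ j) * t) * laurent_monomial \<alpha> z"
proof -
  have "laurent_monomial \<alpha> (rot j t z) = (\<Prod>i\<in>UNIV. (if i = j then cis t powi (\<alpha> $ j) else 1) * (z $ i) powi (\<alpha> $ i))"
    unfolding laurent_monomial_def by (intro prod.cong) (auto simp: power_int_mult_distrib)
  also have "\<dots> = cis t powi (\<alpha> $ j) * laurent_monomial \<alpha> z"
    unfolding prod.distrib laurent_monomial_def by simp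
  also have "cis t powi (\<alpha> $ j) = cis (of_int (\<alpha> $ j) * t)"
    by (rule cis_power_int)
  finally show ?thesis .
qed

text \<open>Morera's theorem: triangle integrals of the integrand vanish by Cauchy, and joint
  continuity permits the two integrations to be exchanged.\<close>

lemma holomorphic_on_integral:
  fixes \<Phi> :: "complex \<Rightarrow> real \<Rightarrow> complex"
  assumes W: "open W" and cont: "continuous_on (W \<times> {a..b}) (\<lambda>(w, t). \<Phi> w t)"
    and hol: "\<And>t. t \<in> {a..b} \<Longrightarrow> (\<lambda>w. \<Phi> w t) holomorphic_on W"
  shows "(\<lambda>w. integral {a..b} (\<Phi> w)) holomorphic_on W"
proof -
  define g where "g w = integral {a..b} (\<Phi> w)" for w
  have cg: "continuous_on W g"
    using integral_continuous_on_param[of W a b \<Phi>] cont unfolding g_def[abs_def] by simp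
  have swap: "contour_integral (linepath u v) g = integral {a..b} (\<lambda>t. contour_integral (linepath u v) (\<lambda>w. \<Phi> w t))"
    and sc: "(\<lambda>t. contour_integral (linepath u v) (\<lambda>w. \<Phi> w t)) integrable_on {a..b}"
    if uv: "closed_segment u v \<subseteq> W" for u v
  proof -
    have c: "continuous_on ({0..1} \<times> {a..b}) (\<lambda>(x, t). \<Phi> (linepath u v x) t * (v - u))"
      unfolding case_prod_unfold
      by (intro continuous_intros continuous_on_compose2[OF continuous_on_linepath[of UNIV u v], where f = fst]
           continuous_on_compose2[OF cont, unfolded case_prod_unfold, where f = "\<lambda>x. (linepath u v (fst x), snd x)", simplified])
         (use uv linepath_in_path in \<open>auto simp: path_image_linepath[symmetric] path_image_def\<close>)
    have c': "continuous_on ({a..b} \<times> {0..1}) (\<lambda>(t, x). \<Phi> (linepath u v x) t * (v - u))"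
    proof -
      have "continuous_on ({a..b} \<times> {0..1}) (\<lambda>x. (snd x, fst x) :: real \<times> real)" by (intro continuous_intros)
      from continuous_on_compose2[OF c this] show ?thesis by (simp add: case_prod_unfold image_subset_iff)
    qed
    have "contour_integral (linepath u v) g = integral {0..1} (\<lambda>x. integral {a..b} (\<lambda>t. \<Phi> (linepath u v x) t * (v - u)))"
      by (simp add: contour_integral_integral g_def)
    also have "\<dots> = integral {a..b} (\<lambda>t. integral {0..1} (\<lambda>x. \<Phi> (linepath u v x) t * (v - u)))"
      using integral_swap_continuous[of 0 a 1 b "\<lambda>x t. \<Phi> (linepath u v x) t * (v - u)"] c
      by (simp add: cbox_Pair_eq)
    finally show "contour_integral (linepath u v) g = integral {a..b} (\<lambda>t. contour_integral (linepath u v) (\<lambda>w. \<Phi> w t))"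
      by (simp add: contour_integral_integral)
    show "(\<lambda>t. contour_integral (linepath u v) (\<lambda>w. \<Phi> w t)) integrable_on {a..b}"
      unfolding contour_integral_integral
      using integrable_continuous_interval[OF integral_continuous_on_param[of "{a..b}" 0 1 "\<lambda>t x. \<Phi> (linepath u v x) t * (v - u)"]] c'
      by simp
  qed
  have "g analytic_on W"
  proof (rule Morera_triangle[OF cg W], intro impI)
    fix u v w assume sub: "convex hull {u, v, w} \<subseteq> W"
    have seg: "closed_segment u v \<subseteq> W" "closed_segment v w \<subseteq> W" "closed_segment w u \<subseteq> W"
      unfolding segment_convex_hull by (rule subset_trans[OF hull_mono sub]; simp)+
    have "contour_integral (linepath u v) (\<lambda>w. \<Phi> w t) + contour_integral (linepath v w) (\<lambda>w. \<Phi> w t)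
        + contour_integral (linepath w u) (\<lambda>w. \<Phi> w t) = 0" if t: "t \<in> {a..b}" for t
      by (rule has_chain_integral_chain_integral3[OF Cauchy_theorem_triangle])
         (rule holomorphic_on_subset[OF hol[OF t] sub])
    then have "integral {a..b} (\<lambda>t. contour_integral (linepath u v) (\<lambda>w. \<Phi> w t) + contour_integral (linepath v w) (\<lambda>w. \<Phi> w t)
        + contour_integral (linepath w u) (\<lambda>w. \<Phi> w t)) = integral {a..b} (\<lambda>t. 0)"
      by (intro integral_cong) auto
    then show "contour_integral (linepath u v) g + contour_integral (linepath v w) g + contour_integral (linepath w u) g = 0"
      using seg by (simp add: swap sc integral_add integrable_add)
  qed
  then show ?thesis unfolding g_def[abs_def] by (rule analytic_imp_holomorphic)
qed

text \<open>Continuity plus holomorphy in each variable passes through one-coordinate integrals by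
  one-variable arguments alone. Slices are taken through every \<open>z\<close>, also outside
  \<open>R\<close>.\<close>

definition sep_holo :: "(complex ^ 'n) set \<Rightarrow> (complex ^ 'n \<Rightarrow> complex) \<Rightarrow> bool" where
  "sep_holo R h \<longleftrightarrow> continuous_on R h \<and> (\<forall>z j. (\<lambda>w. h (upd z j w)) holomorphic_on {w. upd z j w \<in> R})"

lemma open_slice:
  fixes R :: "(complex ^ 'n) set"
  assumes "open R" shows "open {w. upd z j w \<in> R}"
proof -
  have "continuous_on UNIV (\<lambda>w. upd z j w)" by (intro continuous_intros)
  then show ?thesis using open_vimage[OF assms] by (simp add: vimage_def)
qed

text \<open>Complex linearity of the derivative makes its restriction to a coordinate line the
  multiplication by \<open>D (axis j 1)\<close>, that is, a complex derivative.\<close>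

lemma holo_on_imp_sep_holo:
  fixes f :: "complex ^ 'n \<Rightarrow> complex"
  assumes R: "open R" and f: "holo_on f R"
  shows "sep_holo R f"
  unfolding sep_holo_def
proof (intro conjI allI)
  show "continuous_on R f"
    using f unfolding holo_on_def by (meson continuous_at_imp_continuous_on has_derivative_continuous)
  fix z j
  show "(\<lambda>w. f (upd z j w)) holomorphic_on {w. upd z j w \<in> R}"
    unfolding holomorphic_on_def
  proof
    fix w assume "w \<in> {w. upd z j w \<in> R}"
    then obtain D where D: "(f has_derivative D) (at (upd z j w))" "\<And>c v. D (c *s v) = c * D v"
      using f unfolding holo_on_def by blast
    have u: "upd z j w' = upd z j 0 + w' *s axis j 1" for w'
      by (simp add: vec_eq_iff axis_def)
    have "bounded_linear (\<lambda>w'::complex. w' *s axis j (1::complex) :: complex ^ 'n)"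
      by (rule linear_conv_bounded_linear[THEN iffD1]) (auto intro!: linearI simp: vec_eq_iff algebra_simps)
    then have "((\<lambda>w'. upd z j 0 + w' *s axis j 1) has_derivative (\<lambda>w'. w' *s axis j 1)) (at w)"
      using has_derivative_add[OF has_derivative_const bounded_linear_imp_has_derivative] by fastforce
    moreover have "(\<lambda>w'. upd z j 0 + w' *s axis j 1) = (\<lambda>w'. upd z j w')"
      using u by (intro ext) (rule sym)
    ultimately have "((\<lambda>w'. upd z j w') has_derivative (\<lambda>w'. w' *s axis j 1)) (at w)"
      by simp
    from diff_chain_at[OF this D(1)]
    have "((\<lambda>w'. f (upd z j w')) has_derivative (\<lambda>w'. D (w' *s axis j 1))) (at w)"
      by (simp add: o_def)
    then have "((\<lambda>w'. f (upd z j w')) has_field_derivative D (axis j 1)) (at w)"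
      unfolding has_field_derivative_def D(2) by (simp add: mult.commute[of _ "D _"])
    then show "(\<lambda>w. f (upd z j w)) field_differentiable at w within {w. upd z j w \<in> R}"
      using field_differentiable_at_within field_differentiable_def by blast
  qed
qed

text \<open>The component of \<open>h\<close> of degree \<open>k\<close> in coordinate
  \<open>j\<close>, as a function of \<open>z\<close> without division by a power of
  \<open>z $ j\<close>. So it is meaningful where \<open>z $ j = 0\<close>, and a coefficient in
  another coordinate can be taken of it.\<close>

definition fourier_coeff :: "'n \<Rightarrow> int \<Rightarrow> (complex ^ 'n \<Rightarrow> complex) \<Rightarrow> complex ^ 'n \<Rightarrow> complex" where
  "fourier_coeff j k h z = integral {0..2*pi} (\<lambda>t. h (rot j t z) * cis (- (of_int k * t))) / (2 * pi)"

lemma continuous_on_fourier_coeff: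
  assumes T: "torus_invariant T" and h: "continuous_on T h"
  shows "continuous_on T (fourier_coeff j k h)"
proof -
  have "continuous_on T (\<lambda>z. integral (cbox 0 (2*pi)) (\<lambda>t. h (rot j t z) * cis (- (of_int k * t))))"
    by (rule integral_continuous_on_param, unfold case_prod_unfold)
      (intro continuous_intros continuous_on_compose2[OF h]; auto intro: torus_invariantD[OF T])
  then show ?thesis unfolding fourier_coeff_def[abs_def] by (intro continuous_intros) auto
qed

lemma sep_holo_fourier_coeff:
  assumes R: "open R" "torus_invariant R" and h: "sep_holo R h"
  shows "sep_holo R (fourier_coeff j k h)"
proof -
  have ch: "continuous_on R h" using h by (simp add: sep_holo_def)
  have c: "continuous_on R (fourier_coeff j k h)"
    by (rule continuous_on_fourier_coeff[OF R(2) ch])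
  have "(\<lambda>w. fourier_coeff j k h (upd z i w)) holomorphic_on {w. upd z i w \<in> R}" (is "_ holomorphic_on ?W") for z i
  proof -
    have W: "open ?W" by (rule open_slice[OF R(1)])
    have "(\<lambda>w. integral {0..2*pi} (\<lambda>t. h (rot j t (upd z i w)) * cis (- (of_int k * t)))) holomorphic_on ?W"
    proof (rule holomorphic_on_integral[OF W])
      show "continuous_on (?W \<times> {0..2*pi}) (\<lambda>(w, t). h (rot j t (upd z i w)) * cis (- (of_int k * t)))"
        unfolding case_prod_unfold
        by (intro continuous_intros continuous_on_compose2[OF ch]) (auto intro: torus_invariantD[OF R(2)])
      fix t
      have "(\<lambda>w. h (rot j t (upd z i w))) holomorphic_on ?W"
      \<comment> \<open>For i = j the rotation acts on the slice variable itself; otherwise it only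
        moves the base point of the slice.\<close>
      proof (cases "i = j")
        case True
        have "(\<lambda>w. h (upd z j w)) \<circ> (\<lambda>w. cis t * w) holomorphic_on ?W"
        proof (rule holomorphic_on_compose_gen)
          show "(\<lambda>w. h (upd z j w)) holomorphic_on {w. upd z j w \<in> R}" using h by (simp add: sep_holo_def)
          show "(\<lambda>w. cis t * w) ` ?W \<subseteq> {w. upd z j w \<in> R}"
            using torus_invariantD[OF R(2), of "upd z j _" j t] True by (auto simp: rot_def)
        qed (intro holomorphic_intros)
        then show ?thesis using True by (simp add: o_def rot_def)
      next
        case False
        have eq: "rot j t (upd z i w) = upd (rot j t z) i w" for w
          using False by (auto simp: vec_eq_iff)
        have "(\<lambda>w. h (upd (rot j t z) i w)) holomorphic_on {w. upd (rot j t z) i w \<in> R}"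
          using h by (simp add: sep_holo_def)
        then show ?thesis unfolding eq
        proof (rule holomorphic_on_subset)
          show "?W \<subseteq> {w. upd (rot j t z) i w \<in> R}"
            using torus_invariantD[OF R(2), of "upd z i _" j t] unfolding eq by auto
        qed
      qed
      then show "(\<lambda>w. h (rot j t (upd z i w)) * cis (- (of_int k * t))) holomorphic_on ?W"
        by (intro holomorphic_intros)
    qed
    then show ?thesis unfolding fourier_coeff_def by (intro holomorphic_intros) auto
  qed
  with c show ?thesis by (simp add: sep_holo_def)
qed

definition homogeneous_on :: "(complex ^ 'n) set \<Rightarrow> 'n \<Rightarrow> int \<Rightarrow> (complex ^ 'n \<Rightarrow> complex) \<Rightarrow> bool" where
  "homogeneous_on R j k h \<longleftrightarrow> (\<forall>z\<in>R. \<forall>t. h (rot j t z) = cis (of_int k * t) * h z)"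

lemma integral_periodic_shift:
  fixes F :: "real \<Rightarrow> complex"
  assumes c: "continuous_on UNIV F" and per: "\<And>t. F (t + 2 * pi) = F t" and s: "0 \<le> s" "s \<le> 2 * pi"
  shows "integral {0..2*pi} (\<lambda>t. F (t + s)) = integral {0..2*pi} F"
proof -
  have int: "F integrable_on {x..y}" for x y
    using c by (intro integrable_continuous_interval) (auto intro: continuous_on_subset)
  have "integral {0..2*pi} (\<lambda>t. F (t + s)) = integral {s..2*pi + s} F"
    using integral_shift_real_ivl[of s s "2*pi + s" F] by simp
  also have "\<dots> = integral {s..2*pi} F + integral {2*pi..2*pi + s} F"
    using s by (intro Henstock_Kurzweil_Integration.integral_combine[symmetric] int) auto
  also have "integral {2*pi..2*pi + s} F = integral {0..s} F"
    using integral_shift_real_ivl[of "2*pi" "2*pi" "2*pi + s" F] per by simp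
  also have "integral {s..2*pi} F + integral {0..s} F = integral {0..2*pi} F"
    using Henstock_Kurzweil_Integration.integral_combine[of 0 s "2*pi" F] s int by (simp add: add.commute)
  finally show ?thesis .
qed

text \<open>Brings a rotation angle into the range in which \<open>integral_periodic_shift\<close>
  applies, for all frequencies simultaneously.\<close>

lemma cis_eq_cis_0_2pi:
  obtains s' where "0 \<le> s'" "s' \<le> 2 * pi" "\<And>k::int. cis (of_int k * s) = cis (of_int k * s')"
proof -
  define n where "n = \<lfloor>s / (2 * pi)\<rfloor>"
  define s' where "s' = s - of_int n * (2 * pi)"
  have "of_int n \<le> s / (2*pi)" "s / (2*pi) < of_int n + 1" unfolding n_def by linarith+
  then have "0 \<le> s'" "s' \<le> 2 * pi" by (simp_all add: s'_def field_simps)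
  moreover have "cis (of_int k * s) = cis (of_int k * s')" for k :: int
  proof -
    have "of_int k * s = of_int k * s' + 2 * pi * of_int (k * n)" by (simp add: s'_def algebra_simps)
    then show ?thesis using cis_multiple_2pi[of "of_int (k * n)"] by (simp flip: cis_mult)
  qed
  ultimately show ?thesis using that by blast
qed

lemma continuous_on_rot_orbit:
  assumes "torus_invariant R" "continuous_on R h" "z \<in> R"
  shows "continuous_on A (\<lambda>t. h (rot j t z))"
  by (intro continuous_on_compose2[OF assms(2)] continuous_intros) (auto intro: torus_invariantD assms)

lemma homogeneous_fourier_coeff:
  assumes R: "torus_invariant R" and h: "continuous_on R h"
  shows "homogeneous_on R j k (fourier_coeff j k h)"
  unfolding homogeneous_on_def
proof (intro ballI allI)
  fix z and s :: real assume z: "z \<in> R"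
  obtain s' where s': "0 \<le> s'" "s' \<le> 2 * pi" "\<And>k::int. cis (of_int k * s) = cis (of_int k * s')"
    using cis_eq_cis_0_2pi by blast
  then have rs: "rot j s z = rot j s' z" using s'(3)[of 1] by (simp add: vec_eq_iff)
  define F where "F t = h (rot j t z) * cis (- (of_int k * t))" for t
  have "integral {0..2*pi} (\<lambda>t. h (rot j t (rot j s' z)) * cis (- (of_int k * t)))
     = integral {0..2*pi} (\<lambda>t. cis (of_int k * s') * F (t + s'))"
    by (rule integral_cong) (simp add: F_def rot_rot cis_mult mult.left_commute[of "cis _"] algebra_simps)
  also have "\<dots> = cis (of_int k * s') * integral {0..2*pi} F"
  proof (subst integral_mult_right, subst integral_periodic_shift)
    show "continuous_on UNIV F"
      unfolding F_def[abs_def] by (intro continuous_intros continuous_on_rot_orbit[OF R h z])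
    show "F (t + 2*pi) = F t" for t
    proof -
      have "cis (- (of_int k * (t + 2*pi))) = cis (- (of_int k * t)) * cis (2 * pi * of_int (- k))"
        by (simp add: cis_mult algebra_simps)
      then show ?thesis using cis_multiple_2pi[of "of_int (- k)"] by (simp add: F_def rot_2pi)
    qed
  qed (use s' in auto)
  finally show "fourier_coeff j k h (rot j s z) = cis (of_int k * s) * fourier_coeff j k h z"
    by (simp add: fourier_coeff_def rs s'(3) F_def[abs_def])
qed

lemma homogeneous_fourier_coeff_preserve:
  assumes R: "torus_invariant R" and h: "homogeneous_on R i l h"
  shows "homogeneous_on R i l (fourier_coeff j k h)"
  unfolding homogeneous_on_def
proof (intro ballI allI)
  fix z s assume z: "z \<in> R"
  have "h (rot j t (rot i s z)) = cis (of_int l * s) * h (rot j t z)" for t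
    using h torus_invariantD[OF R z, of j t] unfolding homogeneous_on_def rot_commute[of j t i s z] by blast
  then show "fourier_coeff j k h (rot i s z) = cis (of_int l * s) * fourier_coeff j k h z"
    by (simp add: fourier_coeff_def mult.assoc)
qed

lemma norm_fourier_coeff_le:
  assumes R: "torus_invariant T" and h: "continuous_on T h" and z: "z \<in> T"
    and M: "\<And>w. w \<in> T \<Longrightarrow> cmod (h w) \<le> M"
  shows "cmod (fourier_coeff j k h z) \<le> M"
proof -
  have "cmod (integral {0..2*pi} (\<lambda>t. h (rot j t z) * cis (- (of_int k * t)))) \<le> M * (2 * pi - 0)"
    by (rule integral_bound)
      (use M torus_invariantD[OF R z] in \<open>auto intro!: continuous_intros continuous_on_rot_orbit[OF R h z] simp: norm_mult\<close>)
  then show ?thesis by (simp add: fourier_coeff_def norm_divide divide_le_eq)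
qed

text \<open>Integration by parts: the derivative of q(e^(it)) e^(-ikt) integrates to 0 over a
  period, so \<i> k times the coefficient is an integral bounded independently of
  \<open>k\<close>.\<close>

lemma circle_coeff_decay:
  fixes q :: "complex \<Rightarrow> complex"
  assumes W: "open W" and q: "q holomorphic_on W" and sub: "sphere 0 1 \<subseteq> W"
  obtains M where "\<And>k::int. k \<noteq> 0 \<Longrightarrow>
    cmod (integral {0..2*pi} (\<lambda>t. q (cis t) * cis (- (of_int k * t)))) \<le> M / \<bar>of_int k\<bar>"
proof -
  have cis: "cis t \<in> W" for t using sub by auto
  have cd: "continuous_on {0..2*pi} (\<lambda>t. deriv q (cis t))" and cq: "continuous_on {0..2*pi} (\<lambda>t. q (cis t))"
    using holomorphic_on_imp_continuous_on[OF holomorphic_deriv[OF q W]] holomorphic_on_imp_continuous_on[OF q] cis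
    by (auto intro!: continuous_on_compose2[where f = cis] continuous_intros)
  have "bounded ((\<lambda>t. deriv q (cis t)) ` {0..2*pi})"
    by (intro compact_imp_bounded compact_continuous_image cd) simp
  then obtain M where M: "\<And>t. t \<in> {0..2*pi} \<Longrightarrow> cmod (deriv q (cis t)) \<le> M"
    unfolding bounded_iff ball_simps by (auto simp del: atLeastAtMost_iff)
  show ?thesis
  proof (rule that)
    fix k :: int assume k: "k \<noteq> 0"
    define I where "I = integral {0..2*pi} (\<lambda>t. q (cis t) * cis (- (of_int k * t)))"
    define D where "D t = deriv q (cis t) * (\<i> * cis t) * cis (- (of_int k * t))" for t
    have der: "((\<lambda>t. q (cis t) * cis (- (of_int k * t))) has_vector_derivative
       (D t - \<i> * of_int k * (q (cis t) * cis (- (of_int k * t))))) (at t within A)" for t A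
    proof -
      have "((\<lambda>w. q (exp (\<i> * w)) * exp (- (\<i> * of_int k * w))) has_field_derivative
        (deriv q (cis t) * (\<i> * cis t) * cis (- (of_int k * t)) - \<i> * of_int k * (q (cis t) * cis (- (of_int k * t))))) (at (of_real t))"
      proof -
        have "(q has_field_derivative deriv q (cis t)) (at (exp (\<i> * of_real t)))"
          using holomorphic_derivI[OF q W cis] by (simp add: cis_conv_exp)
        moreover have "((\<lambda>w. exp (\<i> * w)) has_field_derivative \<i> * cis t) (at (of_real t))"
          by (auto intro!: derivative_eq_intros simp: cis_conv_exp)
        ultimately have "((\<lambda>w. q (exp (\<i> * w))) has_field_derivative deriv q (cis t) * (\<i> * cis t)) (at (of_real t))"
          by (rule DERIV_chain2)
        then show ?thesis
          by (auto intro!: derivative_eq_intros simp: cis_conv_exp algebra_simps)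
      qed
      from has_vector_derivative_real_field[OF this]
      have "((\<lambda>x. q (exp (\<i> * of_real x)) * exp (- (\<i> * of_int k * of_real x))) has_vector_derivative
        (D t - \<i> * of_int k * (q (cis t) * cis (- (of_int k * t))))) (at t within A)"
        unfolding D_def by (rule has_vector_derivative_at_within)
      moreover have "exp (\<i> * of_real x) = cis x" "exp (- (\<i> * of_int k * of_real x)) = cis (- (of_int k * x))" for x
        by (simp_all add: cis_conv_exp mult.assoc)
      ultimately show ?thesis by simp
    qed
    have "((\<lambda>t. D t - \<i> * of_int k * (q (cis t) * cis (- (of_int k * t)))) has_integral
       (q (cis (2*pi)) * cis (- (of_int k * (2*pi))) - q (cis 0) * cis (- (of_int k * 0)))) {0..2*pi}"
      by (rule fundamental_theorem_of_calculus) (auto intro: der)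
    moreover have "cis (- (of_int k * (2*pi))) = 1"
      using cis_multiple_2pi[of "of_int (- k)"] by (simp add: mult_ac)
    ultimately have z: "((\<lambda>t. D t - \<i> * of_int k * (q (cis t) * cis (- (of_int k * t)))) has_integral 0) {0..2*pi}"
      by simp
    have cD: "continuous_on {0..2*pi} D"
      unfolding D_def[abs_def] by (intro continuous_intros cd)
    have "((\<lambda>t. \<i> * of_int k * (q (cis t) * cis (- (of_int k * t)))) has_integral \<i> * of_int k * I) {0..2*pi}"
      unfolding I_def by (intro has_integral_mult_right integrable_integral integrable_continuous_interval continuous_intros cq)
    from has_integral_add[OF z this] have "(D has_integral \<i> * of_int k * I) {0..2*pi}" by simp
    then have "cmod (\<i> * of_int k * I) = cmod (integral {0..2*pi} D)" by (simp add: integral_unique)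
    also have "\<dots> \<le> M * (2 * pi - 0)"
      by (rule integral_bound[OF _ cD]) (use M in \<open>auto simp: D_def norm_mult\<close>)
    finally show "cmod (integral {0..2*pi} (\<lambda>t. q (cis t) * cis (- (of_int k * t)))) \<le> (M * (2 * pi)) / \<bar>of_int k\<bar>"
      using k by (simp add: I_def norm_mult field_simps)
  qed
qed

text \<open>Chernoff's argument: dividing \<open>g \<tau> - g 1\<close> by \<open>\<tau> - 1\<close> makes the partial sums telescope.\<close>

lemma circle_fourier_inversion:
  fixes g :: "complex \<Rightarrow> complex"
  assumes W: "open W" and g: "g holomorphic_on W" and sub: "sphere 0 1 \<subseteq> W"
  shows "(\<lambda>N. \<Sum>k\<in>{- int N..int N}. integral {0..2*pi} (\<lambda>t. g (cis t) * cis (- (of_int k * t))) / (2 * pi)) \<longlonglongrightarrow> g 1"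
proof -
  define q where "q z = (if z = 1 then deriv g 1 else (g z - g 1) / (z - 1))" for z
  have hq: "q holomorphic_on W"
    unfolding q_def[abs_def] by (rule pole_lemma_open[OF g W])
  have gq: "g z = g 1 + (z - 1) * q z" for z by (simp add: q_def)
  define Q where "Q k = integral {0..2*pi} (\<lambda>t. q (cis t) * cis (- (of_int k * t))) / (2 * pi)" for k :: int
  have cq: "continuous_on {0..2*pi} (\<lambda>t. q (cis t))"
    using holomorphic_on_imp_continuous_on[OF hq] sub
    by (auto intro!: continuous_on_compose2[where f = cis] continuous_intros)
  have coeff: "integral {0..2*pi} (\<lambda>t. g (cis t) * cis (- (of_int k * t))) / (2 * pi)
     = (if k = 0 then g 1 else 0) + Q (k - 1) - Q k" for k :: int
  proof -
    have Qi: "((\<lambda>t. q (cis t) * cis (- (of_int l * t))) has_integral (2 * pi) * Q l) {0..2*pi}" for l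
      unfolding Q_def using cq by (auto intro!: integrable_integral integrable_continuous_interval continuous_intros)
    have "((\<lambda>t. g 1 * cis (of_int (- k) * t) + q (cis t) * cis (- (of_int (k - 1) * t)) - q (cis t) * cis (- (of_int k * t)))
      has_integral (g 1 * (if - k = 0 then 2 * pi else 0) + (2 * pi) * Q (k - 1) - (2 * pi) * Q k)) {0..2*pi}"
      by (intro has_integral_diff has_integral_add has_integral_mult_right has_integral_cis_multiple Qi)
    moreover have "g 1 * cis (of_int (- k) * t) + q (cis t) * cis (- (of_int (k - 1) * t)) - q (cis t) * cis (- (of_int k * t))
      = g (cis t) * cis (- (of_int k * t))" for t
    proof -
      have "cis (- (of_int (k - 1) * t)) = cis t * cis (- (of_int k * t))"
        by (simp add: cis_mult algebra_simps)
      then show ?thesis by (subst (2) gq) (simp add: algebra_simps)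
    qed
    ultimately have "integral {0..2*pi} (\<lambda>t. g (cis t) * cis (- (of_int k * t)))
       = g 1 * (if - k = 0 then 2 * pi else 0) + (2 * pi) * Q (k - 1) - (2 * pi) * Q k"
      by (simp add: integral_unique)
    then show ?thesis by (auto simp: field_simps)
  qed
  have tele: "(\<Sum>k\<in>{- int N..int N}. (if k = 0 then g 1 else 0) + Q (k - 1) - Q k) = g 1 + Q (- int N - 1) - Q (int N)" for N
  proof (induction N)
    case (Suc N)
    have "{- int (Suc N)..int (Suc N)} = insert (- int N - 1) (insert (int N + 1) {- int N..int N})" by auto
    then show ?case using Suc by (simp add: add.commute)
  qed simp
  obtain M where M: "\<And>k::int. k \<noteq> 0 \<Longrightarrow>
    cmod (integral {0..2*pi} (\<lambda>t. q (cis t) * cis (- (of_int k * t)))) \<le> M / \<bar>of_int k\<bar>"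
    using circle_coeff_decay[OF W hq sub] by blast
  have QM: "cmod (Q k) \<le> (M / (2 * pi)) * (1 / \<bar>of_int k\<bar>)" if "k \<noteq> 0" for k
    using divide_right_mono[OF M[OF that], of "2*pi"] by (simp add: Q_def norm_divide field_simps)
  have lim: "(\<lambda>N. (M / (2 * pi)) * (1 / real (Suc N))) \<longlonglongrightarrow> 0"
    using tendsto_mult_right_zero[OF LIMSEQ_inverse_real_of_nat, of "M / (2*pi)"] by (simp add: inverse_eq_divide)
  have "(\<lambda>N. Q (- int N - 1)) \<longlonglongrightarrow> 0"
  proof (rule Lim_null_comparison[OF _ lim], rule always_eventually, rule allI)
    have "\<bar>real_of_int (- int N - 1)\<bar> = real (Suc N)" for N by simp
    then show "cmod (Q (- int N - 1)) \<le> (M / (2 * pi)) * (1 / real (Suc N))" for N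
      using QM[of "- int N - 1"] by (simp only:)
  qed
  moreover have "(\<lambda>N. Q (int N)) \<longlonglongrightarrow> 0"
  proof (rule LIMSEQ_imp_Suc, rule Lim_null_comparison[OF _ lim], rule always_eventually, rule allI)
    show "cmod (Q (int (Suc N))) \<le> (M / (2 * pi)) * (1 / real (Suc N))" for N
      using QM[of "int (Suc N)"] by simp
  qed
  ultimately have "(\<lambda>N. g 1 + Q (- int N - 1) - Q (int N)) \<longlonglongrightarrow> g 1 + 0 - 0"
    by (intro tendsto_intros)
  then show ?thesis unfolding coeff tele by simp
qed

text \<open>The circle is parametrised by the multiplier \<open>w\<close> of \<open>z $ j\<close>,
  not by the coordinate: the unit circle then always lies in the slice domain \<open>W\<close>, also
  when \<open>z $ j = 0\<close>, and \<open>z\<close> corresponds to w = 1.\<close>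

lemma fourier_inversion:
  assumes R: "open R" "torus_invariant R" and h: "sep_holo R h" and z: "z \<in> R"
  shows "(\<lambda>N. \<Sum>k\<in>{- int N..int N}. fourier_coeff j k h z) \<longlonglongrightarrow> h z"
proof -
  define W where "W = {w. upd z j (w * z $ j) \<in> R}"
  have "open W"
  proof -
    have "continuous_on UNIV (\<lambda>w. upd z j (w * z $ j))" by (intro continuous_intros)
    then show ?thesis using open_vimage[OF R(1)] by (simp add: W_def vimage_def)
  qed
  moreover have "(\<lambda>w. h (upd z j (w * z $ j))) holomorphic_on W"
  proof -
    have "(\<lambda>w. h (upd z j w)) \<circ> (\<lambda>w. w * z $ j) holomorphic_on W"
      by (rule holomorphic_on_compose_gen[where t = "{w. upd z j w \<in> R}"])
        (use h in \<open>auto simp: sep_holo_def W_def intro!: holomorphic_intros\<close>)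
    then show ?thesis by (simp add: o_def)
  qed
  moreover have "sphere 0 1 \<subseteq> W"
  proof
    fix w :: complex assume "w \<in> sphere 0 1"
    then have "w = cis (Arg w)" using rcis_cmod_Arg[of w] by (simp add: rcis_def)
    then have "upd z j (w * z $ j) = rot j (Arg w) z" by (simp add: rot_def)
    then show "w \<in> W" using torus_invariantD[OF R(2) z] by (simp add: W_def)
  qed
  ultimately have "(\<lambda>N. \<Sum>k\<in>{- int N..int N}. integral {0..2*pi} (\<lambda>t. h (upd z j (cis t * z $ j)) * cis (- (of_int k * t))) / (2 * pi)) \<longlonglongrightarrow> h (upd z j (1 * z $ j))"
    by (rule circle_fourier_inversion)
  then show ?thesis by (simp add: fourier_coeff_def rot_def)
qed

lemma fourier_coeff_laurent_sum:
  assumes F: "finite F"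
  shows "fourier_coeff j k (\<lambda>z. \<Sum>\<alpha>\<in>F. a \<alpha> * laurent_monomial \<alpha> z)
    = (\<lambda>z. \<Sum>\<alpha>\<in>{\<alpha>\<in>F. \<alpha> $ j = k}. a \<alpha> * laurent_monomial \<alpha> z)"
proof
  fix z
  have "((\<lambda>t. \<Sum>\<alpha>\<in>F. a \<alpha> * laurent_monomial \<alpha> z * cis (of_int (\<alpha> $ j - k) * t)) has_integral
     (\<Sum>\<alpha>\<in>F. a \<alpha> * laurent_monomial \<alpha> z * (if \<alpha> $ j - k = 0 then 2 * pi else 0))) {0..2*pi}"
    by (intro has_integral_sum has_integral_mult_right has_integral_cis_multiple F)
  moreover have "(\<Sum>\<alpha>\<in>F. a \<alpha> * laurent_monomial \<alpha> z * cis (of_int (\<alpha> $ j - k) * t))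
     = (\<Sum>\<alpha>\<in>F. a \<alpha> * laurent_monomial \<alpha> (rot j t z)) * cis (- (of_int k * t))" for t
    unfolding sum_distrib_right laurent_monomial_rot
    by (rule sum.cong) (simp_all add: mult_ac cis_mult algebra_simps)
  moreover have "(\<Sum>\<alpha>\<in>F. a \<alpha> * laurent_monomial \<alpha> z * (if \<alpha> $ j - k = 0 then 2 * pi else 0))
     = (\<Sum>\<alpha>\<in>{\<alpha>\<in>F. \<alpha> $ j = k}. a \<alpha> * laurent_monomial \<alpha> z) * (2 * pi)"
    unfolding sum_distrib_right by (rule sum.mono_neutral_cong_right) (use F in auto)
  ultimately show "fourier_coeff j k (\<lambda>z. \<Sum>\<alpha>\<in>F. a \<alpha> * laurent_monomial \<alpha> z) z
    = (\<Sum>\<alpha>\<in>{\<alpha>\<in>F. \<alpha> $ j = k}. a \<alpha> * laurent_monomial \<alpha> z)"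
    by (simp add: fourier_coeff_def integral_unique)
qed

section \<open>Iterated Fourier coefficients\<close>

fun iter_coeff :: "'n list \<Rightarrow> int ^ 'n \<Rightarrow> (complex ^ 'n \<Rightarrow> complex) \<Rightarrow> complex ^ 'n \<Rightarrow> complex" where
  "iter_coeff [] \<alpha> h = h"
| "iter_coeff (j # js) \<alpha> h = iter_coeff js \<alpha> (fourier_coeff j (\<alpha> $ j) h)"

lemma sep_holo_iter_coeff:
  assumes "open R" "torus_invariant R" "sep_holo R h"
  shows "sep_holo R (iter_coeff js \<alpha> h)"
  using assms(3) by (induction js arbitrary: h) (auto intro: sep_holo_fourier_coeff[OF assms(1,2)])

lemma homogeneous_iter_coeff:
  assumes R: "open R" "torus_invariant R"
  shows "sep_holo R h \<Longrightarrow> i \<in> set js \<or> homogeneous_on R i (\<alpha> $ i) h \<Longrightarrow> homogeneous_on R i (\<alpha> $ i) (iter_coeff js \<alpha> h)"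
proof (induction js arbitrary: h)
  case (Cons j js)
  have "homogeneous_on R j (\<alpha> $ j) (fourier_coeff j (\<alpha> $ j) h)"
    using Cons.prems(1) by (intro homogeneous_fourier_coeff R) (simp add: sep_holo_def)
  then show ?case
    using Cons.prems by (auto intro!: Cons.IH sep_holo_fourier_coeff[OF R] intro: homogeneous_fourier_coeff_preserve[OF R(2)])
qed simp

text \<open>Cauchy's estimate in averaged form. The bound is uniform in \<alpha>, which is what
  \<open>laurent_term_decay\<close> converts into geometric decay.\<close>

lemma norm_iter_coeff_le:
  assumes T: "torus_invariant T" and z: "z \<in> T"
  shows "continuous_on T h \<Longrightarrow> (\<And>w. w \<in> T \<Longrightarrow> cmod (h w) \<le> M) \<Longrightarrow> cmod (iter_coeff js \<alpha> h z) \<le> M"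
proof (induction js arbitrary: h)
  case Nil
  then show ?case using z by simp
next
  case (Cons j js)
  show ?case
    unfolding iter_coeff.simps using Cons.prems
    by (intro Cons.IH continuous_on_fourier_coeff[OF T] norm_fourier_coeff_le[OF T])
qed

lemma iter_coeff_cong:
  assumes "\<And>i. i \<in> set js \<Longrightarrow> \<alpha> $ i = \<beta> $ i"
  shows "iter_coeff js \<alpha> h = iter_coeff js \<beta> h"
  using assms by (induction js arbitrary: h) auto

lemma iter_coeff_laurent_sum:
  assumes "finite F"
  shows "iter_coeff js \<beta> (\<lambda>z. \<Sum>\<alpha>\<in>F. a \<alpha> * laurent_monomial \<alpha> z)
    = (\<lambda>z. \<Sum>\<alpha>\<in>{\<alpha>\<in>F. \<forall>i\<in>set js. \<alpha> $ i = \<beta> $ i}. a \<alpha> * laurent_monomial \<alpha> z)"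
  using assms
proof (induction js arbitrary: F)
  case (Cons j js)
  have "{\<alpha> \<in> {\<alpha> \<in> F. \<alpha> $ j = \<beta> $ j}. \<forall>i\<in>set js. \<alpha> $ i = \<beta> $ i} = {\<alpha> \<in> F. \<forall>i\<in>set (j # js). \<alpha> $ i = \<beta> $ i}"
    by auto
  then show ?case using Cons by (simp add: fourier_coeff_laurent_sum)
qed simp

lemma filterlim_finite_subsets_at_topI:
  fixes f :: "'a \<Rightarrow> 'b set"
  assumes "\<And>y. finite (f y)" and "\<And>x. \<forall>\<^sub>F y in G. x \<in> f y"
  shows "filterlim f (finite_subsets_at_top UNIV) G"
  unfolding filterlim_finite_subsets_at_top
proof (intro allI impI)
  fix X :: "'b set" assume "finite X \<and> X \<subseteq> UNIV"
  then have "\<forall>\<^sub>F y in G. \<forall>x\<in>X. x \<in> f y"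
    using assms(2) by (intro eventually_ball_finite) auto
  then show "\<forall>\<^sub>F y in G. finite (f y) \<and> X \<subseteq> f y \<and> f y \<subseteq> UNIV"
    by eventually_elim (use assms(1) in auto)
qed

lemma filterlim_int_symmetric: "filterlim (\<lambda>N. {- int N..int N}) (finite_subsets_at_top UNIV) sequentially"
proof (rule filterlim_finite_subsets_at_topI)
  show "\<forall>\<^sub>F N in sequentially. x \<in> {- int N..int N}" for x
    using eventually_ge_at_top[of "nat \<bar>x\<bar>"] by eventually_elim auto
qed simp

text \<open>Summability over the whole index set is what allows the one-variable inversion formulas,
  which converge only along symmetric partial sums, to be iterated.\<close>

lemma infsum_iter_coeff:
  assumes R: "open R" "torus_invariant R" and z: "z \<in> R"
  shows "distinct js \<Longrightarrow> sep_holo R h \<Longrightarrow>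
    (\<lambda>\<alpha>. iter_coeff js \<alpha> h z) summable_on {\<alpha>. \<forall>i. i \<notin> set js \<longrightarrow> \<alpha> $ i = 0} \<Longrightarrow>
    infsum (\<lambda>\<alpha>. iter_coeff js \<alpha> h z) {\<alpha>. \<forall>i. i \<notin> set js \<longrightarrow> \<alpha> $ i = 0} = h z"
proof (induction js arbitrary: h)
  case Nil
  have "{\<alpha> :: int ^ 'a. \<forall>i. i \<notin> set [] \<longrightarrow> \<alpha> $ i = 0} = {0}" by (auto simp: vec_eq_iff)
  then show ?case by simp
next
  case (Cons j js)
  \<comment> \<open>Indices supported in \<open>js\<close> and padded with 0 elsewhere, so that all
    stages of the induction live in one type; \<phi> below splits off the entry at
    \<open>j\<close>.\<close>
  define A where "A js = {\<alpha> :: int ^ 'a. \<forall>i. i \<notin> set js \<longrightarrow> \<alpha> $ i = 0}" for js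
  define F where "F k \<beta> = iter_coeff js \<beta> (fourier_coeff j k h) z" for k \<beta>
  define \<phi> where "\<phi> = (\<lambda>(k, \<beta> :: int ^ 'a). upd \<beta> j k)"
  have j: "j \<notin> set js" using Cons.prems by simp
  have bij: "bij_betw \<phi> (UNIV \<times> A js) (A (j # js))"
  proof (rule bij_betwI[where g = "\<lambda>\<alpha>. (\<alpha> $ j, upd \<alpha> j 0)"])
    show "\<phi> \<in> UNIV \<times> A js \<rightarrow> A (j # js)" by (auto simp: \<phi>_def A_def)
    show "(\<lambda>\<alpha>. (\<alpha> $ j, upd \<alpha> j 0)) \<in> A (j # js) \<rightarrow> UNIV \<times> A js" by (auto simp: A_def)
    show "(\<phi> x $ j, upd (\<phi> x) j 0) = x" if "x \<in> UNIV \<times> A js" for x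
      using that j by (auto simp: \<phi>_def A_def vec_eq_iff)
    show "\<phi> (\<alpha> $ j, upd \<alpha> j 0) = \<alpha>" for \<alpha> by (simp add: \<phi>_def)
  qed
  have eq: "iter_coeff (j # js) (\<phi> (k, \<beta>)) h z = F k \<beta>" for k \<beta>
  proof -
    have "iter_coeff js (\<phi> (k, \<beta>)) g = iter_coeff js \<beta> g" for g
      by (rule iter_coeff_cong) (use j in \<open>auto simp: \<phi>_def\<close>)
    then show ?thesis by (simp add: F_def \<phi>_def)
  qed
  have sum: "(\<lambda>(k, \<beta>). F k \<beta>) summable_on UNIV \<times> A js"
    using summable_on_reindex_bij_betw[OF bij, of "\<lambda>\<alpha>. iter_coeff (j # js) \<alpha> h z"] Cons.prems(3)
    by (simp add: A_def eq case_prod_unfold flip: eq)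
  have tot: "infsum (\<lambda>\<alpha>. iter_coeff (j # js) \<alpha> h z) (A (j # js)) = infsum (\<lambda>(k, \<beta>). F k \<beta>) (UNIV \<times> A js)"
    using infsum_reindex_bij_betw[OF bij, of "\<lambda>\<alpha>. iter_coeff (j # js) \<alpha> h z"]
    by (simp add: case_prod_unfold flip: eq)
  have inner: "infsum (F k) (A js) = fourier_coeff j k h z" for k
    unfolding F_def A_def
    using Cons.prems summable_on_SigmaD1[OF sum, of k]
    by (intro Cons.IH sep_holo_fourier_coeff[OF R]) (simp_all add: F_def[abs_def] A_def)
  have "(\<lambda>k. fourier_coeff j k h z) summable_on UNIV"
    using summable_on_Sigma_banach[OF sum] by (simp add: inner)
  then have "((\<lambda>k. fourier_coeff j k h z) has_sum infsum (\<lambda>k. fourier_coeff j k h z) UNIV) UNIV"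
    by (rule has_sum_infsum)
  then have "(\<lambda>N. \<Sum>k\<in>{- int N..int N}. fourier_coeff j k h z) \<longlonglongrightarrow> infsum (\<lambda>k. fourier_coeff j k h z) UNIV"
    unfolding has_sum_def by (rule filterlim_compose[OF _ filterlim_int_symmetric])
  then have "infsum (\<lambda>k. fourier_coeff j k h z) UNIV = h z"
    by (rule LIMSEQ_unique[OF _ fourier_inversion[OF R Cons.prems(2) z]])
  then have "infsum (\<lambda>(k, \<beta>). F k \<beta>) (UNIV \<times> A js) = h z"
    using infsum_Sigma'_banach[OF sum] by (simp only: inner)
  with tot have "infsum (\<lambda>\<alpha>. iter_coeff (j # js) \<alpha> h z) (A (j # js)) = h z"
    by (rule trans)
  then show ?case
    unfolding A_def .
qed

section \<open>Laurent expansions on Reinhardt domains\<close>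

text \<open>Differentiating the homogeneity at t = 0 gives Euler's equation w g'(w) = k g(w), hence
  g(w) w^(-k) has derivative 0. The connected set \<open>C\<close> is separate from
  \<open>W\<close>, since a slice of the domain may have several components.\<close>

lemma homogeneous_slice_constant:
  fixes g :: "complex \<Rightarrow> complex"
  assumes W: "open W" and g: "g holomorphic_on W"
    and hom: "\<And>w t. w \<in> W \<Longrightarrow> g (cis t * w) = cis (of_int k * t) * g w"
    and C: "open C" "connected C" "C \<subseteq> W - {0}" and xy: "x \<in> C" "y \<in> C"
  shows "g x * x powi (- k) = g y * y powi (- k)"
proof -
  have euler: "w * deriv g w = of_int k * g w" if w: "w \<in> W" for w
  proof -
    have "(g has_field_derivative deriv g w) (at (exp (\<i> * of_real 0) * w))"
      using holomorphic_derivI[OF g W w] by simp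
    moreover have "((\<lambda>\<tau>. exp (\<i> * \<tau>) * w) has_field_derivative \<i> * w) (at (of_real 0))"
      by (auto intro!: derivative_eq_intros)
    ultimately have "((\<lambda>\<tau>. g (exp (\<i> * \<tau>) * w)) has_field_derivative deriv g w * (\<i> * w)) (at (of_real 0))"
      by (rule DERIV_chain2)
    then have 1: "((\<lambda>t. g (exp (\<i> * of_real t) * w)) has_vector_derivative deriv g w * (\<i> * w)) (at 0)"
      by (rule has_vector_derivative_real_field)
    have "((\<lambda>\<tau>. exp (\<i> * of_int k * \<tau>) * g w) has_field_derivative \<i> * of_int k * g w) (at (of_real 0))"
      by (auto intro!: derivative_eq_intros)
    then have "((\<lambda>t. exp (\<i> * of_int k * of_real t) * g w) has_vector_derivative \<i> * of_int k * g w) (at 0)"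
      by (rule has_vector_derivative_real_field)
    moreover have "(\<lambda>t. exp (\<i> * of_int k * of_real t) * g w) = (\<lambda>t. g (exp (\<i> * of_real t) * w))"
      using hom[OF w] by (simp add: cis_conv_exp mult_ac)
    ultimately have "\<i> * (w * deriv g w) = \<i> * (of_int k * g w)"
      using vector_derivative_unique_at[OF 1] by (simp add: mult_ac)
    then show ?thesis by simp
  qed
  have "((\<lambda>w. g w * w powi (- k)) has_field_derivative 0) (at w)" if w: "w \<in> C" for w
  proof -
    have w': "w \<in> W" "w \<noteq> 0" using w C(3) by auto
    have "((\<lambda>w. g w * w powi (- k)) has_field_derivative
        deriv g w * w powi (- k) + of_int (- k) * w powi (- k - 1) * 1 * g w) (at w)"
      by (intro DERIV_mult DERIV_power_int holomorphic_derivI[OF g W w'(1)] DERIV_ident) (use w' in simp)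
    also have "w powi (- k) = w * w powi (- k - 1)"
      using w' power_int_add[of w 1 "- k - 1"] by simp
    also have "deriv g w * (w * w powi (- k - 1)) + of_int (- k) * w powi (- k - 1) * 1 * g w = w powi (- k - 1) * (w * deriv g w - of_int k * g w)"
      by (simp add: algebra_simps)
    finally show ?thesis using euler[OF w'(1)] by simp
  qed
  then have "(\<lambda>w. g w * w powi (- k)) constant_on C"
    using has_field_derivative_0_imp_constant_on C by blast
  then show ?thesis using xy unfolding constant_on_def by metis
qed

lemma laurent_monomial_upd:
  "laurent_monomial \<alpha> (upd z j w) = w powi (\<alpha> $ j) * (\<Prod>i\<in>UNIV - {j}. (z $ i) powi (\<alpha> $ i))"
  unfolding laurent_monomial_def by (subst prod.remove[of UNIV j]) (auto intro!: prod.cong)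

lemma laurent_monomial_nonzero:
  assumes "\<forall>i. z $ i \<noteq> 0" shows "laurent_monomial \<alpha> z \<noteq> 0"
  using assms by (simp add: laurent_monomial_def)

lemma laurent_monomial_uminus:
  "laurent_monomial (- \<alpha>) z = inverse (laurent_monomial \<alpha> z)"
  by (simp add: laurent_monomial_def power_int_minus prod_inversef[unfolded o_def])

text \<open>The coordinates of \<open>w\<close> are replaced by those of \<open>w'\<close> one after
  the other. Each replacement stays in a disc with 0 removed, which is still connected.\<close>

lemma homogeneous_polydisc_constant:
  fixes h :: "complex ^ 'n \<Rightarrow> complex"
  assumes R: "open R" and h: "sep_holo R h"
    and hom: "\<And>j. homogeneous_on R j (\<alpha> $ j) h"
    and P: "\<And>v. (\<forall>i. v $ i \<in> ball (z $ i) (r i)) \<Longrightarrow> v \<in> R" and inv: "torus_invariant R"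
    and w: "\<forall>i. w $ i \<in> ball (z $ i) (r i)" "\<forall>i. w $ i \<noteq> 0"
    and w': "\<forall>i. w' $ i \<in> ball (z $ i) (r i)" "\<forall>i. w' $ i \<noteq> 0"
  shows "h w' * laurent_monomial (- \<alpha>) w' = h w * laurent_monomial (- \<alpha>) w"
proof -
  define mix where "mix J = (\<chi> i. if i \<in> J then w' $ i else w $ i)" for J
  have "h (mix J) * laurent_monomial (- \<alpha>) (mix J) = h w * laurent_monomial (- \<alpha>) w" if "finite J" for J
    using that
  proof (induction J)
    case empty
    have "mix {} = w" by (simp add: mix_def vec_eq_iff)
    then show ?case by simp
  next
    case (insert j J)
    define v where "v = mix J"
    have v: "v $ i \<in> ball (z $ i) (r i)" "v $ i \<noteq> 0" for i
      using w w' by (auto simp: v_def mix_def)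
    have new: "mix (insert j J) = upd v j (w' $ j)" and old: "v = upd v j (w $ j)"
      using insert.hyps by (auto simp: v_def mix_def vec_eq_iff)
    define W where "W = {x. upd v j x \<in> R}"
    have "h (upd v j (w' $ j)) * (w' $ j) powi (- (\<alpha> $ j)) = h (upd v j (w $ j)) * (w $ j) powi (- (\<alpha> $ j))"
    proof (rule homogeneous_slice_constant)
      show "open W" unfolding W_def by (rule open_slice[OF R])
      show "(\<lambda>x. h (upd v j x)) holomorphic_on W" using h by (simp add: sep_holo_def W_def)
      show "h (upd v j (cis t * x)) = cis (of_int (\<alpha> $ j) * t) * h (upd v j x)" if "x \<in> W" for x t
      proof -
        have "rot j t (upd v j x) = upd v j (cis t * x)" by (simp add: rot_def)
        moreover have "h (rot j t (upd v j x)) = cis (of_int (\<alpha> $ j) * t) * h (upd v j x)"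
          using hom[of j] that unfolding homogeneous_on_def W_def by blast
        ultimately show ?thesis by simp
      qed
      show "open (ball (z $ j) (r j) - {0})" by (intro open_delete open_ball)
      show "connected (ball (z $ j) (r j) - {0})"
        by (rule connected_open_delete) auto
      show "ball (z $ j) (r j) - {0} \<subseteq> W - {0}"
        using v(1) by (auto simp: W_def intro!: P)
    qed (use w w' in auto)
    then have "h (mix (insert j J)) * laurent_monomial (- \<alpha>) (mix (insert j J)) = h v * laurent_monomial (- \<alpha>) v"
      unfolding new laurent_monomial_upd by (subst (2) old, subst (4) old, unfold laurent_monomial_upd) (simp add: mult.assoc[symmetric])
    then show ?case using insert.IH by (simp add: v_def)
  qed
  from this[of UNIV] have "h (mix UNIV) * laurent_monomial (- \<alpha>) (mix UNIV) = h w * laurent_monomial (- \<alpha>) w" by simp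
  moreover have "mix UNIV = w'" by (simp add: mix_def vec_eq_iff)
  ultimately show ?thesis by simp
qed

lemma open_contains_nonzero_vec:
  fixes U :: "(complex ^ 'n) set"
  assumes U: "open U" and z: "z \<in> U"
  obtains w where "w \<in> U" "\<forall>i. w $ i \<noteq> 0"
proof -
  obtain A where A: "\<And>i. open (A i) \<and> z $ i \<in> A i" and sub: "\<And>y. (\<forall>i. y $ i \<in> A i) \<Longrightarrow> y \<in> U"
    using U z unfolding open_vec_def by meson
  have "\<exists>x. x \<in> A i \<and> x \<noteq> 0" for i
  proof (rule ccontr)
    assume "\<not> ?thesis"
    then have "A i = {0}" using A[of i] by auto
    then show False using A[of i] not_open_singleton[of "0::complex"] by simp
  qed
  then obtain w where w: "\<And>i. w i \<in> A i \<and> w i \<noteq> 0" by metis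
  show ?thesis by (rule that[of "\<chi> i. w i"]) (use w in \<open>auto intro!: sub\<close>)
qed

lemma open_contains_polydisc:
  fixes U :: "(complex ^ 'n) set"
  assumes U: "open U" and z: "z \<in> U"
  obtains r where "\<forall>i. r i > 0" "\<And>v. (\<forall>i. v $ i \<in> ball (z $ i) (r i)) \<Longrightarrow> v \<in> U"
    "open {v. \<forall>i. v $ i \<in> ball (z $ i) (r i)}"
proof -
  obtain A where A: "\<And>i. open (A i) \<and> z $ i \<in> A i" and sub: "\<And>y. (\<forall>i. y $ i \<in> A i) \<Longrightarrow> y \<in> U"
    using U z unfolding open_vec_def by meson
  have "\<exists>r>0. ball (z $ i) r \<subseteq> A i" for i using A[of i] openE by blast
  then obtain r where r: "\<And>i. r i > 0 \<and> ball (z $ i) (r i) \<subseteq> A i" by metis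
  show ?thesis
  proof (rule that[of r])
    show "open {v. \<forall>i. v $ i \<in> ball (z $ i) (r i)}"
      unfolding open_vec_def by (auto intro!: exI[of _ "\<lambda>i. ball (z $ i) (r i)"])
  qed (use r in \<open>auto intro!: sub dest: subsetD simp flip: mem_ball\<close>)
qed

text \<open>The quotient of \<open>h\<close> by the monomial is locally constant off the coordinate
  hyperplanes, and connectedness of \<open>R\<close> makes it globally constant there. Points with
  vanishing coordinates are treated separately at the end.\<close>

lemma homogeneous_imp_monomial:
  fixes h :: "complex ^ 'n \<Rightarrow> complex"
  assumes R: "is_domain R" "torus_invariant R" and h: "sep_holo R h"
    and hom: "\<And>j. homogeneous_on R j (\<alpha> $ j) h"
  obtains a where "\<And>z. z \<in> R \<Longrightarrow> h z = a * laurent_monomial \<alpha> z"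
proof -
  have oR: "open R" and cR: "connected R" and "R \<noteq> {}" using R(1) by (auto simp: is_domain_def)
  define nz where "nz w \<longleftrightarrow> (\<forall>i. w $ i \<noteq> 0)" for w :: "complex ^ 'n"
  define q where "q w = h w * laurent_monomial (- \<alpha>) w" for w
  obtain z0 where z0: "z0 \<in> R" using \<open>R \<noteq> {}\<close> by blast
  have loc: "\<exists>T. open T \<and> z \<in> T \<and> T \<subseteq> R \<and> (\<forall>w\<in>T. \<forall>w'\<in>T. nz w \<longrightarrow> nz w' \<longrightarrow> q w = q w')" if z: "z \<in> R" for z
  proof -
    obtain r where r: "\<forall>i. r i > 0" "\<And>v. (\<forall>i. v $ i \<in> ball (z $ i) (r i)) \<Longrightarrow> v \<in> R"
      "open {v. \<forall>i. v $ i \<in> ball (z $ i) (r i)}"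
      using open_contains_polydisc[OF oR z] by blast
    show ?thesis
    proof (intro exI conjI ballI impI)
      show "open {v. \<forall>i. v $ i \<in> ball (z $ i) (r i)}" by fact
      show "z \<in> {v. \<forall>i. v $ i \<in> ball (z $ i) (r i)}" using r(1) by simp
      show "{v. \<forall>i. v $ i \<in> ball (z $ i) (r i)} \<subseteq> R" using r(2) by blast
      fix w w' assume *: "w \<in> {v. \<forall>i. v $ i \<in> ball (z $ i) (r i)}" "w' \<in> {v. \<forall>i. v $ i \<in> ball (z $ i) (r i)}" "nz w" "nz w'"
      show "q w = q w'" unfolding q_def
        by (rule homogeneous_polydisc_constant[OF oR h hom r(2) R(2)]) (use * in \<open>auto simp: nz_def\<close>)
    qed
  qed
  obtain T0 where T0: "open T0" "z0 \<in> T0" "T0 \<subseteq> R" "\<And>w w'. w \<in> T0 \<Longrightarrow> w' \<in> T0 \<Longrightarrow> nz w \<Longrightarrow> nz w' \<Longrightarrow> q w = q w'"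
    using loc[OF z0] by blast
  obtain w0 where w0: "w0 \<in> T0" "nz w0" using open_contains_nonzero_vec[OF T0(1,2)] unfolding nz_def by blast
  define a where "a = q w0"
  \<comment> \<open>\<open>P\<close> speaks of all nearby points without zero coordinates, so it
    makes sense on the hyperplanes too; connected induction can therefore run over \<open>R\<close>
    itself.\<close>
  define P where "P z \<longleftrightarrow> (\<exists>T. open T \<and> z \<in> T \<and> (\<forall>w\<in>T. nz w \<longrightarrow> q w = a))" for z
  have P: "P z" if z: "z \<in> R" for z
  proof (rule connected_induction_simple[OF cR z0 z])
    show "P z0" unfolding P_def a_def using T0 w0 by blast
    fix y assume y: "y \<in> R"
    obtain T where T: "open T" "y \<in> T" "T \<subseteq> R" "\<And>w w'. w \<in> T \<Longrightarrow> w' \<in> T \<Longrightarrow> nz w \<Longrightarrow> nz w' \<Longrightarrow> q w = q w'"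
      using loc[OF y] by blast
    have "P u \<longrightarrow> P v" if uv: "u \<in> T" "v \<in> T" for u v
    proof
      assume "P u"
      then obtain T' where T': "open T'" "u \<in> T'" "\<And>w. w \<in> T' \<Longrightarrow> nz w \<Longrightarrow> q w = a"
        unfolding P_def by blast
      obtain w where w: "w \<in> T \<inter> T'" "nz w"
        using open_contains_nonzero_vec[of "T \<inter> T'" u] T(1) T' uv unfolding nz_def by blast
      have "q w' = a" if "w' \<in> T" "nz w'" for w' using T(4)[OF _ _ that(2) w(2)] T'(3) w that by auto
      then show "P v" unfolding P_def using T(1) uv by blast
    qed
    moreover have "openin (top_of_set R) T" using T(1,3) oR by (simp add: openin_open_eq)
    ultimately show "\<exists>T. openin (top_of_set R) T \<and> y \<in> T \<and> (\<forall>x\<in>T. \<forall>y\<in>T. P x \<longrightarrow> P y)"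
      using T(2) by blast
  qed
  have main: "h z = a * laurent_monomial \<alpha> z" if "z \<in> R" "nz z" for z
  proof -
    have "q z = a" using P[OF that(1)] that(2) unfolding P_def by blast
    then show ?thesis
      using laurent_monomial_nonzero[of z \<alpha>] that(2) unfolding q_def laurent_monomial_uminus nz_def
      by (auto simp: field_simps)
  qed
  show ?thesis
  proof (rule that[of a])
    fix z assume z: "z \<in> R"
    show "h z = a * laurent_monomial \<alpha> z"
    proof (cases "\<exists>i. z $ i = 0 \<and> \<alpha> $ i \<noteq> 0")
      case True
      then obtain i where i: "z $ i = 0" "\<alpha> $ i \<noteq> 0" by blast
      \<comment> \<open>This rotation fixes \<open>z\<close> but multiplies \<open>h z\<close> by
        cis pi = -1, so \<open>h z = 0\<close>. The monomial vanishes as well, for negative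
        exponents by the convention for \<open>0 powi k\<close>.\<close>
      have "rot i (pi / of_int (\<alpha> $ i)) z = z" using i by (simp add: vec_eq_iff)
      then have "h z = cis (of_int (\<alpha> $ i) * (pi / of_int (\<alpha> $ i))) * h z"
        using hom[of i] z unfolding homogeneous_on_def by metis
      then have "h z = 0" using i by simp
      moreover have "laurent_monomial \<alpha> z = 0"
        unfolding laurent_monomial_def by (rule prod_zero) (use i in \<open>auto intro!: exI[of _ i] simp: power_int_0_left_if\<close>)
      ultimately show ?thesis by simp
    next
      case False
      \<comment> \<open>Only vanishing coordinates are perturbed. Their exponents are 0 in this
        case, so the monomial is constant along the sequence and continuity of \<open>h\<close>
        suffices.\<close>
      define y where "y n = (\<chi> i. if z $ i = 0 then of_real (inverse (real (Suc n))) else z $ i)" for n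
      have lim: "y \<longlonglongrightarrow> z"
      proof (rule vec_tendstoI)
        fix i
        show "(\<lambda>n. y n $ i) \<longlonglongrightarrow> z $ i"
        proof (cases "z $ i = 0")
          case True
          then show ?thesis using tendsto_of_real[OF LIMSEQ_inverse_real_of_nat, where 'a = complex] by (simp add: y_def)
        qed (simp add: y_def)
      qed
      have ev: "\<forall>\<^sub>F n in sequentially. y n \<in> R" using topological_tendstoD[OF lim oR z] .
      have "\<forall>\<^sub>F n in sequentially. h (y n) = a * laurent_monomial \<alpha> z"
        using ev
      proof eventually_elim
        fix n assume "y n \<in> R"
        moreover have "nz (y n)" by (auto simp: nz_def y_def simp del: of_nat_Suc)
        moreover have "laurent_monomial \<alpha> (y n) = laurent_monomial \<alpha> z"
          unfolding laurent_monomial_def by (rule prod.cong) (use False in \<open>auto simp: y_def\<close>)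
        ultimately show "h (y n) = a * laurent_monomial \<alpha> z" using main by metis
      qed
      then have "(\<lambda>n. h (y n)) \<longlonglongrightarrow> a * laurent_monomial \<alpha> z" by (rule tendsto_eventually)
      moreover have "(\<lambda>n. h (y n)) \<longlonglongrightarrow> h z"
      proof (rule isCont_tendsto_compose[OF _ lim])
        show "isCont h z" using h z oR by (simp add: sep_holo_def continuous_on_eq_continuous_at)
      qed
      ultimately show ?thesis using LIMSEQ_unique by blast
    qed
  qed
qed

section \<open>Geometric majorants and compact invariant exhaustion\<close>

lemma sum_power_abs_int_le:
  fixes r :: real
  assumes "0 < r" "r < 1"
  shows "(\<Sum>k\<in>{- int N..int N}. r ^ nat \<bar>k\<bar>) \<le> 2 / (1 - r)"
proof -
  have "(\<Sum>k\<in>{- int N..int N}. r ^ nat \<bar>k\<bar>) * (1 - r) = 2 * (1 - r ^ Suc N) - (1 - r)"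
  proof (induction N)
    case (Suc N)
    have eq: "{- int (Suc N)..int (Suc N)} = insert (- int (Suc N)) (insert (int (Suc N)) {- int N..int N})" by auto
    have "(\<Sum>k\<in>{- int (Suc N)..int (Suc N)}. r ^ nat \<bar>k\<bar>) = 2 * r ^ Suc N + (\<Sum>k\<in>{- int N..int N}. r ^ nat \<bar>k\<bar>)"
      unfolding eq by (simp add: nat_add_distrib del: of_nat_Suc)
    then show ?case using Suc by (simp only: distrib_right) (simp add: algebra_simps)
  qed simp
  also have "\<dots> \<le> 2"
  proof -
    define x where "x = r ^ Suc N"
    have "x \<ge> 0" using assms by (simp add: x_def)
    then show ?thesis unfolding x_def[symmetric] using assms by simp
  qed
  finally show ?thesis using assms by (simp add: field_simps)
qed

text \<open>Every finite index set lies in a box, over which the sum factors into two-sided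
  geometric sums.\<close>

lemma summable_on_prod_power_abs:
  fixes r :: real
  assumes r: "0 < r" "r < 1"
  shows "(\<lambda>\<alpha> :: int ^ 'n. \<Prod>i\<in>UNIV. r ^ nat \<bar>\<alpha> $ i\<bar>) summable_on UNIV"
proof (rule nonneg_bdd_above_summable_on)
  show "bdd_above (sum (\<lambda>\<alpha> :: int ^ 'n. \<Prod>i\<in>UNIV. r ^ nat \<bar>\<alpha> $ i\<bar>) ` {F. F \<subseteq> UNIV \<and> finite F})"
  proof (rule bdd_aboveI2)
    fix F :: "(int ^ 'n) set" assume "F \<in> {F. F \<subseteq> UNIV \<and> finite F}"
    then have F: "finite F" by simp
    have "finite ((\<lambda>(\<alpha>, i). nat \<bar>\<alpha> $ i\<bar>) ` (F \<times> UNIV))" using F by simp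
    then obtain N where "\<forall>n\<in>(\<lambda>(\<alpha>, i). nat \<bar>\<alpha> $ i\<bar>) ` (F \<times> UNIV). n \<le> N"
      unfolding finite_nat_set_iff_bounded_le by blast
    then have N: "nat \<bar>\<alpha> $ i\<bar> \<le> N" if "\<alpha> \<in> F" for \<alpha> i using that by auto
    define B where "B = PiE (UNIV :: 'n set) (\<lambda>_. {- int N..int N})"
    have fB: "finite B" unfolding B_def by (intro finite_PiE) auto
    have inj: "inj_on vec_lambda B" by (auto simp: inj_on_def vec_lambda_inject)
    have "(\<Sum>\<alpha>\<in>F. \<Prod>i\<in>UNIV. r ^ nat \<bar>\<alpha> $ i\<bar>) \<le> (\<Sum>\<alpha>\<in>vec_lambda ` B. \<Prod>i\<in>UNIV. r ^ nat \<bar>\<alpha> $ i\<bar>)"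
    proof (rule sum_mono2)
      show "F \<subseteq> vec_lambda ` B"
      proof
        fix \<alpha> assume "\<alpha> \<in> F"
        then have "\<bar>\<alpha> $ i\<bar> \<le> int N" for i using N[of \<alpha> i] by (simp add: nat_le_iff)
        then have "vec_nth \<alpha> \<in> B" by (auto simp: B_def abs_le_iff minus_le_iff)
        then show "\<alpha> \<in> vec_lambda ` B" by (metis imageI vec_nth_inverse)
      qed
    qed (use fB r in \<open>auto intro!: prod_nonneg\<close>)
    also have "\<dots> = (\<Sum>g\<in>B. \<Prod>i\<in>UNIV. r ^ nat \<bar>g i\<bar>)"
      by (subst sum.reindex[OF inj]) simp
    also have "\<dots> = (\<Prod>i\<in>(UNIV :: 'n set). \<Sum>k\<in>{- int N..int N}. r ^ nat \<bar>k\<bar>)"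
      unfolding B_def by (rule prod_sum_PiE[symmetric]) auto
    also have "\<dots> \<le> (\<Prod>i\<in>(UNIV :: 'n set). 2 / (1 - r))"
      using r sum_power_abs_int_le[OF r] by (intro prod_mono) (auto intro!: sum_nonneg)
    finally show "(\<Sum>\<alpha>\<in>F. \<Prod>i\<in>UNIV. r ^ nat \<bar>\<alpha> $ i\<bar>) \<le> (\<Prod>i\<in>(UNIV :: 'n set). 2 / (1 - r))" .
  qed
qed (use r in \<open>auto intro!: prod_nonneg\<close>)

definition inner_region :: "(complex ^ 'n) set \<Rightarrow> real \<Rightarrow> (complex ^ 'n) set" where
  "inner_region R d = {z. \<forall>y. y \<notin> R \<longrightarrow> d \<le> dist z y}"

lemma inner_region_subset: "d > 0 \<Longrightarrow> inner_region R d \<subseteq> R"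
  unfolding inner_region_def by (metis (mono_tags, lifting) dist_self leD mem_Collect_eq subsetI)

lemma inner_region_antimono: "d \<le> d' \<Longrightarrow> inner_region R d' \<subseteq> inner_region R d"
  unfolding inner_region_def by (auto intro: order.trans)

lemma closed_inner_region: "closed (inner_region R d)"
proof -
  have "inner_region R d = (\<Inter>y\<in>-R. {z. d \<le> dist z y})" by (auto simp: inner_region_def)
  then show ?thesis
    by (auto intro!: closed_INT closed_Collect_le continuous_intros)
qed

lemma compact_inner_region:
  assumes "bounded R" "d > 0"
  shows "compact (inner_region R d)"
proof -
  have "bounded (inner_region R d)"
    using bounded_subset[OF assms(1) inner_region_subset[OF assms(2)]] .
  then show ?thesis by (simp add: compact_eq_bounded_closed closed_inner_region)
qed

lemma dist_rot: "dist (rot j t z) (rot j t w) = dist z w"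
proof -
  have "norm ((rot j t z - rot j t w) $ i) = norm ((z - w) $ i)" for i
    by (simp add: norm_mult flip: right_diff_distrib)
  then show ?thesis unfolding dist_norm norm_vec_def by simp
qed

lemma rot_uminus [simp]: "rot j t (rot j (- t) z) = z"
  by (simp add: rot_rot vec_eq_iff)

lemma torus_invariant_inner_region:
  assumes R: "torus_invariant R"
  shows "torus_invariant (inner_region R d)"
  unfolding torus_invariant_def inner_region_def
proof (safe)
  fix z j t y assume z: "\<forall>y. y \<notin> R \<longrightarrow> d \<le> dist z y" and y: "y \<notin> R"
  have "rot j (- t) y \<notin> R" using torus_invariantD[OF R, of "rot j (- t) y" j t] y by auto
  then show "d \<le> dist (rot j t z) y" using z dist_rot[of j t z "rot j (- t) y"] by simp
qed

lemma compact_subset_inner_region: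
  assumes "open R" "compact K" "K \<subseteq> R"
  obtains d where "d > 0" "K \<subseteq> inner_region R d"
proof -
  obtain d where "d > 0" "\<forall>x\<in>K. \<forall>y\<in>-R. d \<le> dist x y"
    using separate_compact_closed[of K "- R"] assms by (auto simp: closed_Compl)
  then show ?thesis by (intro that[of d]) (use assms(3) in \<open>auto simp: inner_region_def\<close>)
qed

lemma laurent_monomial_scale:
  "laurent_monomial \<alpha> (\<chi> i. \<rho> i * z $ i) = (\<Prod>i\<in>UNIV. \<rho> i powi (\<alpha> $ i)) * laurent_monomial \<alpha> z"
  by (simp add: laurent_monomial_def power_int_mult_distrib prod.distrib)

text \<open>Multiplying each coordinate of \<open>z\<close> by \<open>b\<close> or \<open>1 / b\<close>, according to the sign of \<open>\<alpha> $ i\<close>,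
  stays inside the domain and multiplies the monomial by \<open>b\<close> to the power \<open>\<Sum>i. \<bar>\<alpha> $ i\<bar>\<close>.\<close>

lemma laurent_term_decay:
  fixes R :: "(complex ^ 'n) set"
  assumes R: "bounded R" and d: "d > 0"
    and M: "\<And>\<alpha> z. z \<in> inner_region R d \<Longrightarrow> cmod (a \<alpha> * laurent_monomial \<alpha> z) \<le> M"
  obtains r where "0 < r" "r < 1"
    "\<And>\<alpha> z. z \<in> inner_region R (2 * d) \<Longrightarrow> cmod (a \<alpha> * laurent_monomial \<alpha> z) \<le> M * (\<Prod>i\<in>UNIV. r ^ nat \<bar>\<alpha> $ i\<bar>)"
proof -
  obtain B where B: "B > 0" "\<And>z. z \<in> R \<Longrightarrow> norm z \<le> B"
    using R unfolding bounded_pos by blast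
  \<comment> \<open>Scaling by \<open>b\<close> or its inverse changes each coordinate by at most d
    / B times its modulus, because 1 - 1/b \<le> b - 1. With norm z \<le> B the point moves by at
    most \<open>d\<close>, from the region at depth 2d into the one at depth
    \<open>d\<close>.\<close>
  define b where "b = 1 + d / B"
  have b: "b > 1" using d B by (simp add: b_def)
  show ?thesis
  proof (rule that[of "inverse b"])
    fix \<alpha> :: "int ^ 'n" and z assume z: "z \<in> inner_region R (2 * d)"
    define \<rho> where "\<rho> i = (if \<alpha> $ i \<ge> 0 then b else inverse b)" for i
    define w where "w = (\<chi> i. of_real (\<rho> i) * z $ i)"
    have \<rho>: "\<bar>\<rho> i - 1\<bar> \<le> d / B" for i
    proof -
      have "1 - inverse b = (b - 1) / b" using b by (simp add: field_simps)
      also have "\<dots> \<le> (b - 1) / 1" using b by (intro divide_left_mono) auto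
      finally have "1 - inverse b \<le> d / B" by (simp add: b_def)
      moreover have "inverse b < 1" using b by (simp add: inverse_less_1_iff)
      moreover have "b - 1 = d / B" "d / B > 0" using d B by (simp_all add: b_def)
      ultimately show ?thesis unfolding \<rho>_def by auto
    qed
    have "dist w z \<le> norm ((d / B) *\<^sub>R z)"
      unfolding dist_norm
    proof (rule norm_le_componentwise_cart)
      fix i
      have "(w - z) $ i = of_real (\<rho> i - 1) * z $ i" by (simp add: w_def algebra_simps)
      then have "norm ((w - z) $ i) = \<bar>\<rho> i - 1\<bar> * cmod (z $ i)" by (simp only: norm_mult norm_of_real)
      also have "\<dots> \<le> d / B * cmod (z $ i)" using \<rho>[of i] by (intro mult_right_mono) auto
      also have "\<dots> = norm (((d / B) *\<^sub>R z) $ i)" using d B by simp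
      finally show "norm ((w - z) $ i) \<le> norm (((d / B) *\<^sub>R z) $ i)" .
    qed
    also have "\<dots> = d * (norm z / B)" using d B by simp
    also have "\<dots> \<le> d * 1"
      using B d z inner_region_subset[of "2 * d" R] by (intro mult_left_mono) (auto simp: divide_le_eq)
    finally have wz: "dist w z \<le> d" by simp
    have "w \<in> inner_region R d"
      unfolding inner_region_def
    proof (safe)
      fix y assume "y \<notin> R"
      then have "2 * d \<le> dist z y" using z by (simp add: inner_region_def)
      also have "\<dots> \<le> dist w z + dist w y" by (metis dist_commute dist_triangle)
      finally show "d \<le> dist w y" using wz by simp
    qed
    then have "cmod (a \<alpha> * laurent_monomial \<alpha> w) \<le> M" by (rule M)
    also have "laurent_monomial \<alpha> w = (\<Prod>i\<in>UNIV. of_real (\<rho> i) powi (\<alpha> $ i)) * laurent_monomial \<alpha> z"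
      unfolding w_def by (rule laurent_monomial_scale)
    also have "(\<Prod>i\<in>UNIV. of_real (\<rho> i) powi (\<alpha> $ i)) = (of_real (\<Prod>i\<in>UNIV. b ^ nat \<bar>\<alpha> $ i\<bar>) :: complex)"
      unfolding of_real_prod
    proof (rule prod.cong)
      fix i
      show "of_real (\<rho> i) powi (\<alpha> $ i) = (of_real (b ^ nat \<bar>\<alpha> $ i\<bar>) :: complex)"
        by (auto simp: \<rho>_def power_int_def)
    qed simp
    finally have "cmod (a \<alpha> * laurent_monomial \<alpha> z) * (\<Prod>i\<in>UNIV. b ^ nat \<bar>\<alpha> $ i\<bar>) \<le> M"
      using b by (simp add: norm_mult mult_ac abs_of_nonneg prod_nonneg flip: of_real_prod)
    moreover have "(\<Prod>i\<in>UNIV. b ^ nat \<bar>\<alpha> $ i\<bar>) > 0" using b by (intro prod_pos) auto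
    ultimately have "cmod (a \<alpha> * laurent_monomial \<alpha> z) \<le> M * inverse (\<Prod>i\<in>UNIV. b ^ nat \<bar>\<alpha> $ i\<bar>)"
      by (simp add: field_simps)
    then show "cmod (a \<alpha> * laurent_monomial \<alpha> z) \<le> M * (\<Prod>i\<in>UNIV. inverse b ^ nat \<bar>\<alpha> $ i\<bar>)"
      by (simp add: power_inverse prod_inversef[unfolded o_def])
  qed (use b in \<open>auto simp: inverse_less_1_iff\<close>)
qed

text \<open>The coefficient at \<alpha> is the factor in front of the monomial in the iterated
  Fourier coefficient. Cauchy's estimate and the decay lemma give a summable majorant on each
  compact set; this yields uniform convergence and also the summability that
  \<open>infsum_iter_coeff\<close> demands in order to identify the sum with
  \<open>f\<close>.\<close>

lemma laurent_expansion_exists: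
  fixes R :: "(complex ^ 'n) set"
  assumes R: "is_domain R" "torus_invariant R" "bounded R" and f: "sep_holo R f"
  obtains a where "has_laurent_expansion f a R"
proof -
  have oR: "open R" using R(1) by (simp add: is_domain_def)
  obtain js :: "'n list" where js: "set js = UNIV" "distinct js"
    using finite_distinct_list[of "UNIV :: 'n set"] by auto
  have "\<exists>c. \<forall>z\<in>R. iter_coeff js \<alpha> f z = c * laurent_monomial \<alpha> z" for \<alpha>
  proof -
    have "homogeneous_on R j (\<alpha> $ j) (iter_coeff js \<alpha> f)" for j
      by (rule homogeneous_iter_coeff[OF oR R(2) f]) (simp add: js)
    then show ?thesis
      using homogeneous_imp_monomial[OF R(1,2) sep_holo_iter_coeff[OF oR R(2) f], of \<alpha> js \<alpha>] by metis
  qed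
  then obtain a where a: "\<And>\<alpha> z. z \<in> R \<Longrightarrow> iter_coeff js \<alpha> f z = a \<alpha> * laurent_monomial \<alpha> z"
    by metis
  have "has_laurent_expansion f a R"
    unfolding has_laurent_expansion_def
  proof (intro allI impI)
    fix K assume K: "compact K \<and> K \<subseteq> R"
    obtain e where e: "e > 0" "K \<subseteq> inner_region R e"
      using compact_subset_inner_region[OF oR] K by blast
    \<comment> \<open>Two nested regions: the terms are bounded at depth \<open>d\<close> and decay
      geometrically at depth 2d = e, where \<open>K\<close> lies.\<close>
    define d where "d = e / 2"
    have d: "d > 0" "2 * d = e" using e by (simp_all add: d_def)
    note sub = inner_region_subset[OF d(1), of R]
    have cf: "continuous_on (inner_region R d) f"
      using f sub unfolding sep_holo_def by (meson continuous_on_subset)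
    have "bounded (f ` inner_region R d)"
      by (intro compact_imp_bounded compact_continuous_image cf compact_inner_region R d)
    then obtain M where M: "\<And>z. z \<in> inner_region R d \<Longrightarrow> cmod (f z) \<le> M"
      unfolding bounded_iff by blast
    have aM: "cmod (a \<alpha> * laurent_monomial \<alpha> z) \<le> M" if "z \<in> inner_region R d" for \<alpha> z
    proof -
      have "cmod (iter_coeff js \<alpha> f z) \<le> M"
        by (rule norm_iter_coeff_le[OF torus_invariant_inner_region[OF R(2)] that cf M])
      then show ?thesis using a sub that by auto
    qed
    obtain r where r: "0 < r" "r < 1" and dec: "\<And>\<alpha> z. z \<in> inner_region R e \<Longrightarrow>
      cmod (a \<alpha> * laurent_monomial \<alpha> z) \<le> M * (\<Prod>i\<in>UNIV. r ^ nat \<bar>\<alpha> $ i\<bar>)"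
      using laurent_term_decay[OF R(3) d(1) aM] unfolding d(2) by blast
    have sM: "(\<lambda>\<alpha> :: int ^ 'n. M * (\<Prod>i\<in>UNIV. r ^ nat \<bar>\<alpha> $ i\<bar>)) summable_on UNIV"
      by (intro summable_on_cmult_right summable_on_prod_power_abs r)
    have lim: "uniform_limit K (\<lambda>F z. \<Sum>\<alpha>\<in>F. a \<alpha> * laurent_monomial \<alpha> z)
        (\<lambda>z. \<Sum>\<^sub>\<infinity>\<alpha>. a \<alpha> * laurent_monomial \<alpha> z) (finite_subsets_at_top UNIV)"
      by (rule Weierstrass_m_test_general[OF _ sM]) (use e dec in blast)
    have "(\<Sum>\<^sub>\<infinity>\<alpha>. a \<alpha> * laurent_monomial \<alpha> z) = f z" if z: "z \<in> K" for z
    proof -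
      have zR: "z \<in> R" using z K by blast
      have "(\<lambda>\<alpha>. a \<alpha> * laurent_monomial \<alpha> z) summable_on UNIV"
      proof (rule abs_summable_summable, rule summable_on_comparison_test[OF sM])
        show "norm (a \<alpha> * laurent_monomial \<alpha> z) \<le> M * (\<Prod>i\<in>UNIV. r ^ nat \<bar>\<alpha> $ i\<bar>)" for \<alpha>
          using e(2) z by (intro dec) auto
      qed auto
      then have "infsum (\<lambda>\<alpha>. iter_coeff js \<alpha> f z) {\<alpha>. \<forall>i. i \<notin> set js \<longrightarrow> \<alpha> $ i = 0} = f z"
        by (intro infsum_iter_coeff[OF oR R(2) zR js(2) f]) (simp add: js a[OF zR])
      then show ?thesis by (simp add: js a[OF zR])
    qed
    then show "uniform_limit K (\<lambda>F z. \<Sum>\<alpha>\<in>F. a \<alpha> * laurent_monomial \<alpha> z) f (finite_subsets_at_top UNIV)"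
      by (intro uniform_limit_cong'[THEN iffD1, OF _ _ lim]) auto
  qed
  then show ?thesis by (rule that)
qed

text \<open>On the torus through a point without zero coordinates, finite sums of both expansions
  over a common index set containing \<beta> differ by less than any \<epsilon>. The iterated
  coefficient extracts exactly the term at \<beta> from the finite difference and does not increase
  the bound.\<close>

lemma laurent_expansion_unique:
  fixes R :: "(complex ^ 'n) set"
  assumes R: "is_domain R" "reinhardt R" "bounded R"
    and a: "has_laurent_expansion f a R" and a': "has_laurent_expansion f a' R"
  shows "a = a'"
proof
  fix \<beta>
  have oR: "open R" and "R \<noteq> {}" using R(1) by (auto simp: is_domain_def)
  obtain z where z: "z \<in> R" "\<forall>i. z $ i \<noteq> 0"
    using open_contains_nonzero_vec[OF oR] \<open>R \<noteq> {}\<close> by blast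
  define T where "T = {w. \<forall>i. cmod (w $ i) = cmod (z $ i)}"
  have nz: "w $ i \<noteq> 0" if "w \<in> T" for w i
    using that z(2) by (metis (mono_tags, lifting) T_def mem_Collect_eq norm_eq_zero)
  have TR: "T \<subseteq> R"
  proof
    fix w assume w: "w \<in> T"
    define \<theta> where "\<theta> = (\<chi> i. Arg (w $ i / z $ i))"
    have "cis (\<theta> $ i) * z $ i = w $ i" for i
    proof -
      have "cmod (w $ i / z $ i) = 1" using w z(2) by (simp add: T_def norm_divide)
      then have "cis (\<theta> $ i) = w $ i / z $ i"
        using rcis_cmod_Arg[of "w $ i / z $ i"] by (simp add: \<theta>_def rcis_def)
      then show ?thesis using z(2) by simp
    qed
    then have "w = (\<chi> i. cis (\<theta> $ i) * z $ i)" by (simp add: vec_eq_iff)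
    then show "w \<in> R" using R(2) z(1) unfolding reinhardt_def by blast
  qed
  have "closed T"
    unfolding T_def by (intro closed_Collect_all closed_Collect_eq continuous_intros)
  then have T: "compact T" "T \<subseteq> R" "torus_invariant T" "z \<in> T"
    using TR bounded_subset[OF R(3) TR] by (auto simp: compact_eq_bounded_closed torus_invariant_def) (auto simp: T_def norm_mult)
  obtain js :: "'n list" where js: "set js = UNIV" "distinct js"
    using finite_distinct_list[of "UNIV :: 'n set"] by auto
  have "cmod ((a \<beta> - a' \<beta>) * laurent_monomial \<beta> z) \<le> \<epsilon>" if \<epsilon>: "\<epsilon> > 0" for \<epsilon>
  proof -
    have ul: "uniform_limit T (\<lambda>F z. \<Sum>\<alpha>\<in>F. b \<alpha> * laurent_monomial \<alpha> z) f (finite_subsets_at_top UNIV)"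
      if "has_laurent_expansion f b R" for b
      using that T(1,2) by (simp add: has_laurent_expansion_def)
    have "\<epsilon> / 2 > 0" using \<epsilon> by simp
    note uniform_limitD[OF ul[OF a] this] uniform_limitD[OF ul[OF a'] this]
    moreover have "\<forall>\<^sub>F F in finite_subsets_at_top UNIV. finite F \<and> {\<beta>} \<subseteq> F \<and> F \<subseteq> UNIV"
      unfolding eventually_finite_subsets_at_top by (intro exI[of _ "{\<beta>}"]) auto
    ultimately have "\<forall>\<^sub>F F in finite_subsets_at_top UNIV.
       (\<forall>w\<in>T. dist (\<Sum>\<alpha>\<in>F. a \<alpha> * laurent_monomial \<alpha> w) (f w) < \<epsilon> / 2) \<and>
       (\<forall>w\<in>T. dist (\<Sum>\<alpha>\<in>F. a' \<alpha> * laurent_monomial \<alpha> w) (f w) < \<epsilon> / 2) \<and> finite F \<and> \<beta> \<in> F"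
      by eventually_elim auto
    from eventually_happens'[OF finite_subsets_at_top_neq_bot this]
    obtain F where "(\<forall>w\<in>T. dist (\<Sum>\<alpha>\<in>F. a \<alpha> * laurent_monomial \<alpha> w) (f w) < \<epsilon> / 2) \<and>
       (\<forall>w\<in>T. dist (\<Sum>\<alpha>\<in>F. a' \<alpha> * laurent_monomial \<alpha> w) (f w) < \<epsilon> / 2) \<and> finite F \<and> \<beta> \<in> F"
      by (rule exE)
    then have F: "\<And>w. w \<in> T \<Longrightarrow> dist (\<Sum>\<alpha>\<in>F. a \<alpha> * laurent_monomial \<alpha> w) (f w) < \<epsilon> / 2"
        "\<And>w. w \<in> T \<Longrightarrow> dist (\<Sum>\<alpha>\<in>F. a' \<alpha> * laurent_monomial \<alpha> w) (f w) < \<epsilon> / 2" "finite F" "\<beta> \<in> F"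
      by auto
    define u where "u w = (\<Sum>\<alpha>\<in>F. (a \<alpha> - a' \<alpha>) * laurent_monomial \<alpha> w)" for w
    have u: "cmod (u w) \<le> \<epsilon>" if "w \<in> T" for w
    proof -
      have "u w = (\<Sum>\<alpha>\<in>F. a \<alpha> * laurent_monomial \<alpha> w) - (\<Sum>\<alpha>\<in>F. a' \<alpha> * laurent_monomial \<alpha> w)"
        by (simp add: u_def left_diff_distrib sum_subtractf)
      then have "cmod (u w) = dist (\<Sum>\<alpha>\<in>F. a \<alpha> * laurent_monomial \<alpha> w) (\<Sum>\<alpha>\<in>F. a' \<alpha> * laurent_monomial \<alpha> w)"
        by (simp add: dist_norm)
      also have "\<dots> \<le> \<epsilon>" using dist_triangle_half_l[OF F(1,2)[OF that]] by simp
      finally show ?thesis .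
    qed
    have "continuous_on T u"
      unfolding u_def[abs_def] laurent_monomial_def by (intro continuous_intros) (simp add: nz)
    then have "cmod (iter_coeff js \<beta> u z) \<le> \<epsilon>"
      by (rule norm_iter_coeff_le[OF T(3,4) _ u])
    moreover have "{\<alpha>\<in>F. \<forall>i\<in>set js. \<alpha> $ i = \<beta> $ i} = {\<beta>}"
      using F(4) by (auto simp: js vec_eq_iff)
    ultimately show ?thesis
      unfolding u_def[abs_def] iter_coeff_laurent_sum[OF F(3)] by simp
  qed
  then have "cmod ((a \<beta> - a' \<beta>) * laurent_monomial \<beta> z) \<le> 0"
    using field_le_epsilon[of "cmod ((a \<beta> - a' \<beta>) * laurent_monomial \<beta> z)" 0] by simp
  then show "a \<beta> = a' \<beta>" using laurent_monomial_nonzero[OF z(2)] by simp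
qed

lemma has_laurent_expansion_laurent_coeff:
  assumes R: "is_domain R" "reinhardt R" "bounded R" and f: "holo_on f R"
  shows "has_laurent_expansion f (laurent_coeff R f) R"
proof -
  have oR: "open R" using R(1) by (simp add: is_domain_def)
  obtain a where a: "has_laurent_expansion f a R"
    using laurent_expansion_exists[OF R(1) reinhardt_imp_torus_invariant[OF R(2)] R(3) holo_on_imp_sep_holo[OF oR f]] by blast
  have "x = a" if "has_laurent_expansion f x R" for x
    by (rule laurent_expansion_unique[OF R that a])
  then show ?thesis
    unfolding laurent_coeff_def by (rule theI[of "\<lambda>a. has_laurent_expansion f a R", OF a])
qed

lemma index_norm_le_iff: "index_norm \<alpha> \<le> int N \<longleftrightarrow> (\<forall>i. \<bar>\<alpha> $ i\<bar> \<le> int N)"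
  by (auto simp: index_norm_def)

text \<open>Each index eventually lies in the squares, so the squares tend to infinity along the net
  of finite subsets.\<close>

lemma uniform_limit_square_partial_sum:
  fixes R :: "(complex ^ 'n) set"
  assumes R: "is_domain R" "reinhardt R" "bounded R" and f: "holo_on f R" and K: "compact K" "K \<subseteq> R"
  shows "uniform_limit K (\<lambda>N. square_partial_sum R N f) f sequentially"
proof -
  have "filterlim (\<lambda>N. {\<alpha> :: int ^ 'n. index_norm \<alpha> \<le> int N}) (finite_subsets_at_top UNIV) sequentially"
  proof (rule filterlim_finite_subsets_at_topI)
    fix \<alpha> :: "int ^ 'n"
    show "\<forall>\<^sub>F N in sequentially. \<alpha> \<in> {\<alpha>. index_norm \<alpha> \<le> int N}"
      using eventually_ge_at_top[of "nat (index_norm \<alpha>)"] by eventually_elim auto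
  qed (rule finite_index_square)
  moreover have "uniform_limit K (\<lambda>F z. \<Sum>\<alpha>\<in>F. laurent_coeff R f \<alpha> * laurent_monomial \<alpha> z) f (finite_subsets_at_top UNIV)"
    using has_laurent_expansion_laurent_coeff[OF R f] K unfolding has_laurent_expansion_def by blast
  ultimately show ?thesis
    unfolding square_partial_sum_def[abs_def] by (rule filterlim_compose[rotated])
qed

section \<open>Uniform boundedness of the partial sums\<close>

text \<open>The image measure is translation invariant, so Fubini's theorem shows that it is a multiple of
  Lebesgue measure; the unit ball, which the isometry preserves, gives the factor 1.\<close>

lemma distr_lborel_linear_isometry:
  fixes T :: "'a::euclidean_space \<Rightarrow> 'a"
  assumes T: "linear T" "\<And>x. norm (T x) = norm x"
  shows "distr lborel borel T = lborel"
proof (rule measure_eqI)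
  fix A :: "'a set" assume "A \<in> sets (distr lborel borel T)"
  then have A[measurable]: "A \<in> sets borel" by simp
  have Tm[measurable]: "T \<in> borel_measurable borel"
    using T(1) by (intro borel_measurable_continuous_onI linear_continuous_on) (simp add: linear_conv_bounded_linear)
  have "inj T"
    unfolding linear_injective_0[OF T(1)] using T(2) by (metis norm_eq_zero)
  then have surj: "surj T" by (rule linear_inj_imp_surj[OF T(1)])
  define B where "B = ball (0::'a) 1"
  have B[measurable]: "B \<in> sets borel" by (simp add: B_def)
  define b where "b = emeasure lborel B"
  have b: "b \<noteq> 0" "b \<noteq> \<infinity>" unfolding b_def B_def by (simp_all add: emeasure_ball ennreal_eq_0_iff not_le)
  define g where "g x y = (indicator A (T x) * indicator B (T x - y) :: ennreal)" for x y
  have g[measurable]: "case_prod g \<in> borel_measurable (lborel \<Otimes>\<^sub>M lborel)"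
    unfolding g_def by measurable
  have shift: "(\<integral>\<^sup>+x. f (c + x) \<partial>lborel) = (\<integral>\<^sup>+x. f x \<partial>lborel)" if [measurable]: "f \<in> borel_measurable borel" for f :: "'a \<Rightarrow> ennreal" and c
  proof -
    have "(\<integral>\<^sup>+x. f x \<partial>lborel) = (\<integral>\<^sup>+x. f x \<partial>distr lborel borel ((+) c))" by (simp add: lborel_distr_plus)
    also have "\<dots> = (\<integral>\<^sup>+x. f (c + x) \<partial>lborel)" by (rule nn_integral_distr) auto
    finally show ?thesis by simp
  qed
  have "(\<integral>\<^sup>+x. \<integral>\<^sup>+y. g x y \<partial>lborel \<partial>lborel) = (\<integral>\<^sup>+x. indicator A (T x) * b \<partial>lborel)"
  proof (rule nn_integral_cong)
    fix x
    have "(\<integral>\<^sup>+y. g x y \<partial>lborel) = indicator A (T x) * (\<integral>\<^sup>+y. indicator B (T x - y) \<partial>lborel)"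
      unfolding g_def by (rule nn_integral_cmult) measurable
    also have "(\<integral>\<^sup>+y. indicator B (T x - y) \<partial>lborel) = (\<integral>\<^sup>+y. indicator B (T x - (T x + y)) \<partial>lborel)"
      by (rule shift[symmetric]) measurable
    also have "\<dots> = (\<integral>\<^sup>+y. indicator B y \<partial>lborel)" by (simp add: B_def indicator_def)
    finally show "(\<integral>\<^sup>+y. g x y \<partial>lborel) = indicator A (T x) * b" by (simp add: b_def)
  qed
  also have "\<dots> = (\<integral>\<^sup>+x. indicator (T -` A) x * b \<partial>lborel)" by (simp add: indicator_def)
  also have "\<dots> = emeasure lborel (T -` A) * b"
    using measurable_sets[OF Tm A] by (simp add: nn_integral_multc)
  finally have I1: "(\<integral>\<^sup>+x. \<integral>\<^sup>+y. g x y \<partial>lborel \<partial>lborel) = emeasure lborel (T -` A) * b" .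
  have "(\<integral>\<^sup>+x. \<integral>\<^sup>+y. g x y \<partial>lborel \<partial>lborel) = (\<integral>\<^sup>+y. \<integral>\<^sup>+x. g x y \<partial>lborel \<partial>lborel)"
    by (rule lborel_pair.Fubini'[symmetric]) (rule g)
  also have "\<dots> = (\<integral>\<^sup>+y. \<integral>\<^sup>+x. indicator A (T x + y) * indicator B x \<partial>lborel \<partial>lborel)"
  proof (rule nn_integral_cong)
    fix y
    obtain y' where y': "T y' = y" using surj by (metis surjD)
    have "(\<integral>\<^sup>+x. g x y \<partial>lborel) = (\<integral>\<^sup>+x. g (y' + x) y \<partial>lborel)"
      by (rule shift[symmetric]) (simp add: g_def)
    also have "\<dots> = (\<integral>\<^sup>+x. indicator A (T x + y) * indicator B x \<partial>lborel)"
      using T by (simp add: g_def linear_add y' B_def indicator_def add.commute)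
    finally show "(\<integral>\<^sup>+x. g x y \<partial>lborel) = (\<integral>\<^sup>+x. indicator A (T x + y) * indicator B x \<partial>lborel)" .
  qed
  also have "\<dots> = (\<integral>\<^sup>+x. \<integral>\<^sup>+y. indicator A (T x + y) * indicator B x \<partial>lborel \<partial>lborel)"
    by (rule lborel_pair.Fubini') measurable
  also have "\<dots> = (\<integral>\<^sup>+x. emeasure lborel A * indicator B x \<partial>lborel)"
  proof (rule nn_integral_cong)
    fix x
    have "(\<integral>\<^sup>+y. indicator A (T x + y) * indicator B x \<partial>lborel) = (\<integral>\<^sup>+y. indicator A (T x + y) \<partial>lborel) * indicator B x"
      by (rule nn_integral_multc) measurable
    also have "(\<integral>\<^sup>+y. indicator A (T x + y) \<partial>lborel) = (\<integral>\<^sup>+y. indicator A y \<partial>lborel)"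
      by (rule shift) measurable
    finally show "(\<integral>\<^sup>+y. indicator A (T x + y) * indicator B x \<partial>lborel) = emeasure lborel A * indicator B x" by simp
  qed
  also have "\<dots> = emeasure lborel A * b" by (simp add: nn_integral_cmult b_def)
  finally have "emeasure lborel (T -` A) * b = emeasure lborel A * b" using I1 by simp
  then have "emeasure lborel (T -` A) = emeasure lborel A"
    using b by (simp add: ennreal_mult_cancel_left mult.commute[of _ b])
  then show "emeasure (distr lborel borel T) A = emeasure lborel A"
    by (simp add: emeasure_distr)
qed simp

lemma borel_measurable_rot [measurable]:
  "(rot j t :: complex ^ 'n \<Rightarrow> complex ^ 'n) \<in> borel_measurable borel"
  by (intro borel_measurable_continuous_onI continuous_on_rot continuous_intros)

lemma borel_measurable_rot_pair [measurable]:
  "(\<lambda>(z, t). rot j t z :: complex ^ 'n) \<in> borel_measurable (lborel \<Otimes>\<^sub>M lborel)"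
proof -
  have "continuous_on UNIV (\<lambda>x. rot j (snd x) (fst x) :: complex ^ 'n)" by (intro continuous_intros)
  then have "(\<lambda>x. rot j (snd x) (fst x) :: complex ^ 'n) \<in> borel_measurable borel" by (rule borel_measurable_continuous_onI)
  then show ?thesis by (simp add: case_prod_unfold lborel_prod)
qed

lemma nn_integral_rot:
  fixes \<phi> :: "complex ^ 'n \<Rightarrow> ennreal"
  assumes [measurable]: "\<phi> \<in> borel_measurable borel"
  shows "(\<integral>\<^sup>+z. \<phi> (rot j t z) \<partial>lborel) = (\<integral>\<^sup>+z. \<phi> z \<partial>lborel)"
proof -
  have lin: "linear (rot j t :: complex ^ 'n \<Rightarrow> complex ^ 'n)"
    by (auto intro!: linearI simp: vec_eq_iff algebra_simps)
  have norm: "norm (rot j t z) = norm z" for z :: "complex ^ 'n"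
    unfolding norm_vec_def by (rule L2_set_cong) (auto simp: norm_mult)
  have "(\<integral>\<^sup>+z. \<phi> z \<partial>lborel) = (\<integral>\<^sup>+z. \<phi> z \<partial>distr lborel borel (rot j t))"
    by (simp add: distr_lborel_linear_isometry[OF lin norm])
  also have "\<dots> = (\<integral>\<^sup>+z. \<phi> (rot j t z) \<partial>lborel)"
    by (rule nn_integral_distr) auto
  finally show ?thesis by simp
qed

text \<open>Turns an integral over space into one of circle integrals along the orbits of one
  coordinate, where the theorem on the circle can be applied pointwise in \<open>z\<close>.\<close>

lemma nn_integral_rot_average:
  fixes \<phi> :: "complex ^ 'n \<Rightarrow> ennreal"
  assumes \<phi>[measurable]: "\<phi> \<in> borel_measurable borel"
  shows "(\<integral>\<^sup>+z. \<integral>\<^sup>+t. \<phi> (rot j t z) * indicator {0..2*pi} t \<partial>lborel \<partial>lborel) = ennreal (2*pi) * (\<integral>\<^sup>+z. \<phi> z \<partial>lborel)"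
proof -
  have "(\<integral>\<^sup>+z. \<integral>\<^sup>+t. \<phi> (rot j t z) * indicator {0..2*pi} t \<partial>lborel \<partial>lborel)
      = (\<integral>\<^sup>+t. \<integral>\<^sup>+z. \<phi> (rot j t z) * indicator {0..2*pi} t \<partial>lborel \<partial>lborel)"
    by (rule lborel_pair.Fubini'[symmetric]) measurable
  also have "\<dots> = (\<integral>\<^sup>+t. (\<integral>\<^sup>+z. \<phi> z \<partial>lborel) * indicator {0..2*pi} t \<partial>lborel)"
  proof (rule nn_integral_cong)
    fix t
    show "(\<integral>\<^sup>+z. \<phi> (rot j t z) * indicator {0..2*pi} t \<partial>lborel) = (\<integral>\<^sup>+z. \<phi> z \<partial>lborel) * indicator {0..2*pi} t"
      by (subst nn_integral_multc) (simp_all add: nn_integral_rot)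
  qed
  also have "\<dots> = ennreal (2*pi) * (\<integral>\<^sup>+z. \<phi> z \<partial>lborel)"
    by (simp add: nn_integral_cmult mult.commute)
  finally show ?thesis .
qed

text \<open>The p-th power of the norm, without the root and with values in [0, \<infinity>]; the
  set varies because invariant subsets of the domain are needed.\<close>

definition lp_energy :: "real \<Rightarrow> (complex ^ 'n) set \<Rightarrow> (complex ^ 'n \<Rightarrow> complex) \<Rightarrow> ennreal" where
  "lp_energy p X g = (\<integral>\<^sup>+z. ennreal (cmod (g z) powr p) * indicator X z \<partial>lborel)"

lemma borel_measurable_laurent_monomial [measurable]:
  "laurent_monomial \<alpha> \<in> borel_measurable borel"
proof -
  have "(\<lambda>z :: complex ^ 'n. (z $ j) powi k) \<in> borel_measurable borel" for j k
  proof -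
    have "(\<lambda>z :: complex ^ 'n. z $ j) \<in> borel_measurable borel"
      by (intro borel_measurable_continuous_onI continuous_intros)
    then show ?thesis unfolding power_int_def by (cases "k \<ge> 0") auto
  qed
  then show ?thesis unfolding laurent_monomial_def[abs_def] by (intro borel_measurable_prod) auto
qed

text \<open>Along an orbit of coordinate \<open>j\<close> a finite Laurent sum is a trigonometric
  polynomial, whose coefficient of frequency \<open>k\<close> collects the terms with
  \<open>\<alpha> $ j = k\<close>. Invariance of \<open>X\<close> makes its indicator constant on
  the orbit, and integration over the orbits transfers \<open>riesz_partial_sum\<close> with the
  same constant.\<close>

lemma lp_energy_coordinate_partial_sum:
  fixes p :: real
  assumes p: "1 < p"
  obtains C where "C \<ge> 0" and "\<And>X (G :: (int ^ 'n) set) a j N. X \<in> sets borel \<Longrightarrow> torus_invariant X \<Longrightarrow> finite G \<Longrightarrow>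
    lp_energy p X (\<lambda>z. \<Sum>\<alpha>\<in>{\<alpha>\<in>G. \<bar>\<alpha> $ j\<bar> \<le> int N}. a \<alpha> * laurent_monomial \<alpha> z)
      \<le> ennreal C * lp_energy p X (\<lambda>z. \<Sum>\<alpha>\<in>G. a \<alpha> * laurent_monomial \<alpha> z)"
proof -
  obtain C where C: "C \<ge> 0" and riesz: "\<And>(G :: int set) c N. finite G \<Longrightarrow>
    integral {0..2*pi} (\<lambda>t. cmod (\<Sum>k\<in>{k\<in>G. \<bar>k\<bar> \<le> int N}. c k * cis (of_int k * t)) powr p)
      \<le> C * integral {0..2*pi} (\<lambda>t. cmod (\<Sum>k\<in>G. c k * cis (of_int k * t)) powr p)"
    using riesz_partial_sum[OF p] by blast
  have p0: "p > 0" using p by simp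
  show ?thesis
  proof (rule that[OF C])
    fix X :: "(complex ^ 'n) set" and G :: "(int ^ 'n) set" and a :: "int ^ 'n \<Rightarrow> complex" and j N
    assume X[measurable]: "X \<in> sets borel" and inv: "torus_invariant X" and G: "finite G"
    define s where "s H z = (\<Sum>\<alpha>\<in>H. a \<alpha> * laurent_monomial \<alpha> z)" for H z
    have s[measurable]: "s H \<in> borel_measurable borel" for H
      unfolding s_def[abs_def] by (intro borel_measurable_sum borel_measurable_times) measurable
    define H where "H = {\<alpha>\<in>G. \<bar>\<alpha> $ j\<bar> \<le> int N}"
    have fH: "finite H" using G by (simp add: H_def)
    define \<phi> where "\<phi> H z = ennreal (cmod (s H z) powr p) * indicator X z" for H z
    have \<phi>[measurable]: "\<phi> H \<in> borel_measurable borel" for H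
      unfolding \<phi>_def[abs_def] by measurable
    have X_rot: "indicator X (rot j t z) = (indicator X z :: ennreal)" for t z
    proof -
      have "rot j t z \<in> X \<longleftrightarrow> z \<in> X"
        using torus_invariantD[OF inv, of z j t] torus_invariantD[OF inv, of "rot j t z" j "- t"]
        by (auto simp: rot_rot) (simp add: rot_def)
      then show ?thesis by (simp add: indicator_def)
    qed
    have int: "(\<integral>\<^sup>+t. \<phi> H (rot j t z) * indicator {0..2*pi} t \<partial>lborel)
      = ennreal (integral {0..2*pi} (\<lambda>t. cmod (\<Sum>k\<in>(\<lambda>\<alpha>. \<alpha> $ j) ` H. (\<Sum>\<alpha>\<in>{\<alpha>\<in>H. \<alpha> $ j = k}. a \<alpha> * laurent_monomial \<alpha> z) * cis (of_int k * t)) powr p)) * indicator X z"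
      if "finite H" for H z
    proof -
      have eq: "s H (rot j t z) = (\<Sum>k\<in>(\<lambda>\<alpha>. \<alpha> $ j) ` H. (\<Sum>\<alpha>\<in>{\<alpha>\<in>H. \<alpha> $ j = k}. a \<alpha> * laurent_monomial \<alpha> z) * cis (of_int k * t))" for t
      proof -
        have "s H (rot j t z) = (\<Sum>\<alpha>\<in>H. a \<alpha> * laurent_monomial \<alpha> z * cis (of_int (\<alpha> $ j) * t))"
          unfolding s_def laurent_monomial_rot by (rule sum.cong) (simp_all add: mult_ac)
        also have "\<dots> = (\<Sum>k\<in>(\<lambda>\<alpha>. \<alpha> $ j) ` H. \<Sum>\<alpha>\<in>{\<alpha>\<in>H. \<alpha> $ j = k}. a \<alpha> * laurent_monomial \<alpha> z * cis (of_int (\<alpha> $ j) * t))"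
          by (rule sum.image_gen[OF that])
        also have "\<dots> = (\<Sum>k\<in>(\<lambda>\<alpha>. \<alpha> $ j) ` H. (\<Sum>\<alpha>\<in>{\<alpha>\<in>H. \<alpha> $ j = k}. a \<alpha> * laurent_monomial \<alpha> z) * cis (of_int k * t))"
          unfolding sum_distrib_right by (intro sum.cong) auto
        finally show ?thesis .
      qed
      let ?f = "\<lambda>t. cmod (\<Sum>k\<in>(\<lambda>\<alpha>. \<alpha> $ j) ` H. (\<Sum>\<alpha>\<in>{\<alpha>\<in>H. \<alpha> $ j = k}. a \<alpha> * laurent_monomial \<alpha> z) * cis (of_int k * t)) powr p"
      have cont: "continuous_on UNIV ?f" by (rule continuous_on_powr_norm[OF p0 continuous_on_trig_sum])
      then have [measurable]: "?f \<in> borel_measurable borel" by (rule borel_measurable_continuous_onI)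
      have "(\<integral>\<^sup>+t. \<phi> H (rot j t z) * indicator {0..2*pi} t \<partial>lborel) = (\<integral>\<^sup>+t. (ennreal (?f t) * indicator {0..2*pi} t) * indicator X z \<partial>lborel)"
        unfolding \<phi>_def X_rot eq by (simp add: mult_ac)
      also have "\<dots> = (\<integral>\<^sup>+t. ennreal (?f t) * indicator {0..2*pi} t \<partial>lborel) * indicator X z"
        by (rule nn_integral_multc) measurable
      also have "(\<integral>\<^sup>+t. ennreal (?f t) * indicator {0..2*pi} t \<partial>lborel) = ennreal (integral {0..2*pi} ?f)"
        by (rule nn_integral_has_integral_lebesgue')
          (auto intro!: integrable_integral integrable_continuous_interval continuous_on_subset[OF cont])
      finally show ?thesis .
    qed
    have pt: "(\<integral>\<^sup>+t. \<phi> H (rot j t z) * indicator {0..2*pi} t \<partial>lborel) \<le> ennreal C * (\<integral>\<^sup>+t. \<phi> G (rot j t z) * indicator {0..2*pi} t \<partial>lborel)" for z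
    proof -
      have im: "(\<lambda>\<alpha>. \<alpha> $ j) ` H = {k \<in> (\<lambda>\<alpha>. \<alpha> $ j) ` G. \<bar>k\<bar> \<le> int N}" by (auto simp: H_def)
      have "(\<Sum>k\<in>(\<lambda>\<alpha>. \<alpha> $ j) ` H. (\<Sum>\<alpha>\<in>{\<alpha>\<in>H. \<alpha> $ j = k}. a \<alpha> * laurent_monomial \<alpha> z) * cis (of_int k * t))
        = (\<Sum>k\<in>{k \<in> (\<lambda>\<alpha>. \<alpha> $ j) ` G. \<bar>k\<bar> \<le> int N}. (\<Sum>\<alpha>\<in>{\<alpha>\<in>G. \<alpha> $ j = k}. a \<alpha> * laurent_monomial \<alpha> z) * cis (of_int k * t))" for t
        unfolding im by (intro sum.cong arg_cong2[where f = "(*)"]) (auto simp: H_def)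
      then show ?thesis
        unfolding int[OF G] int[OF fH]
        using riesz[where G = "(\<lambda>\<alpha>. \<alpha> $ j) ` G" and N = N and c = "\<lambda>k. \<Sum>\<alpha>\<in>{\<alpha>\<in>G. \<alpha> $ j = k}. a \<alpha> * laurent_monomial \<alpha> z"] G C
        by (simp add: indicator_def ennreal_leI flip: ennreal_mult')
    qed
    have "ennreal (2*pi) * lp_energy p X (s H) = (\<integral>\<^sup>+z. \<integral>\<^sup>+t. \<phi> H (rot j t z) * indicator {0..2*pi} t \<partial>lborel \<partial>lborel)"
      unfolding nn_integral_rot_average[OF \<phi>] by (simp add: lp_energy_def \<phi>_def[abs_def])
    also have "\<dots> \<le> (\<integral>\<^sup>+z. ennreal C * (\<integral>\<^sup>+t. \<phi> G (rot j t z) * indicator {0..2*pi} t \<partial>lborel) \<partial>lborel)"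
      by (intro nn_integral_mono pt)
    also have "\<dots> = ennreal C * (\<integral>\<^sup>+z. \<integral>\<^sup>+t. \<phi> G (rot j t z) * indicator {0..2*pi} t \<partial>lborel \<partial>lborel)"
    proof (rule nn_integral_cmult)
      show "(\<lambda>z. \<integral>\<^sup>+t. \<phi> G (rot j t z) * indicator {0..2*pi} t \<partial>lborel) \<in> borel_measurable lborel"
        by measurable
    qed
    also have "\<dots> = ennreal (2*pi) * (ennreal C * lp_energy p X (s G))"
      unfolding nn_integral_rot_average[OF \<phi>] by (simp add: lp_energy_def \<phi>_def[abs_def] mult.left_commute)
    finally have "lp_energy p X (s H) \<le> ennreal C * lp_energy p X (s G)"
      by (subst (asm) ennreal_mult_le_mult_iff) auto
    then show "lp_energy p X (\<lambda>z. \<Sum>\<alpha>\<in>{\<alpha>\<in>G. \<bar>\<alpha> $ j\<bar> \<le> int N}. a \<alpha> * laurent_monomial \<alpha> z)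
      \<le> ennreal C * lp_energy p X (\<lambda>z. \<Sum>\<alpha>\<in>G. a \<alpha> * laurent_monomial \<alpha> z)"
      by (simp add: s_def[abs_def] H_def)
  qed
qed

text \<open>The square truncation is the composition of the truncations in the single coordinates;
  each of them costs one factor \<open>C\<close>.\<close>

lemma lp_energy_square_partial_sum:
  fixes p :: real
  assumes p: "1 < p"
  obtains C where "C \<ge> 0" and "\<And>X (G :: (int ^ 'n) set) a N. X \<in> sets borel \<Longrightarrow> torus_invariant X \<Longrightarrow> finite G \<Longrightarrow>
    lp_energy p X (\<lambda>z. \<Sum>\<alpha>\<in>{\<alpha>\<in>G. index_norm \<alpha> \<le> int N}. a \<alpha> * laurent_monomial \<alpha> z)
      \<le> ennreal C * lp_energy p X (\<lambda>z. \<Sum>\<alpha>\<in>G. a \<alpha> * laurent_monomial \<alpha> z)"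
proof -
  obtain C where C: "C \<ge> 0" and step: "\<And>X (G :: (int ^ 'n) set) a j N. X \<in> sets borel \<Longrightarrow> torus_invariant X \<Longrightarrow> finite G \<Longrightarrow>
    lp_energy p X (\<lambda>z. \<Sum>\<alpha>\<in>{\<alpha>\<in>G. \<bar>\<alpha> $ j\<bar> \<le> int N}. a \<alpha> * laurent_monomial \<alpha> z)
      \<le> ennreal C * lp_energy p X (\<lambda>z. \<Sum>\<alpha>\<in>G. a \<alpha> * laurent_monomial \<alpha> z)"
    using lp_energy_coordinate_partial_sum[OF p] by blast
  show ?thesis
  proof (rule that[of "C ^ CARD('n)"])
    fix X :: "(complex ^ 'n) set" and G :: "(int ^ 'n) set" and a :: "int ^ 'n \<Rightarrow> complex" and N
    assume X: "X \<in> sets borel" "torus_invariant X" and G: "finite G"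
    have "lp_energy p X (\<lambda>z. \<Sum>\<alpha>\<in>{\<alpha>\<in>G. \<forall>j\<in>J. \<bar>\<alpha> $ j\<bar> \<le> int N}. a \<alpha> * laurent_monomial \<alpha> z)
      \<le> ennreal (C ^ card J) * lp_energy p X (\<lambda>z. \<Sum>\<alpha>\<in>G. a \<alpha> * laurent_monomial \<alpha> z)" if "finite J" for J
      using that
    proof (induction J)
      case (insert j J)
      define G' where "G' = {\<alpha>\<in>G. \<forall>j\<in>J. \<bar>\<alpha> $ j\<bar> \<le> int N}"
      have eq: "{\<alpha>\<in>G. \<forall>j\<in>insert j J. \<bar>\<alpha> $ j\<bar> \<le> int N} = {\<alpha>\<in>G'. \<bar>\<alpha> $ j\<bar> \<le> int N}" by (auto simp: G'_def)
      have "lp_energy p X (\<lambda>z. \<Sum>\<alpha>\<in>{\<alpha>\<in>G. \<forall>j\<in>insert j J. \<bar>\<alpha> $ j\<bar> \<le> int N}. a \<alpha> * laurent_monomial \<alpha> z)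
        \<le> ennreal C * lp_energy p X (\<lambda>z. \<Sum>\<alpha>\<in>G'. a \<alpha> * laurent_monomial \<alpha> z)"
        unfolding eq by (rule step[OF X]) (use G in \<open>simp add: G'_def\<close>)
      also have "\<dots> \<le> ennreal C * (ennreal (C ^ card J) * lp_energy p X (\<lambda>z. \<Sum>\<alpha>\<in>G. a \<alpha> * laurent_monomial \<alpha> z))"
        unfolding G'_def by (intro mult_left_mono insert.IH) auto
      also have "\<dots> = ennreal (C ^ card (insert j J)) * lp_energy p X (\<lambda>z. \<Sum>\<alpha>\<in>G. a \<alpha> * laurent_monomial \<alpha> z)"
        using insert.hyps C by (simp add: ennreal_mult mult.assoc)
      finally show ?case .
    qed simp
    from this[of UNIV] show "lp_energy p X (\<lambda>z. \<Sum>\<alpha>\<in>{\<alpha>\<in>G. index_norm \<alpha> \<le> int N}. a \<alpha> * laurent_monomial \<alpha> z)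
      \<le> ennreal (C ^ CARD('n)) * lp_energy p X (\<lambda>z. \<Sum>\<alpha>\<in>G. a \<alpha> * laurent_monomial \<alpha> z)"
      by (simp add: index_norm_le_iff)
  qed (use C in simp)
qed

section \<open>Convergence in norm\<close>

text \<open>Nothing is known of \<open>f\<close> outside the domain, so measurability is carried by
  the cut-off function and transferred to subsets of \<open>R\<close>.\<close>

lemma borel_measurable_energy:
  assumes h: "(\<lambda>z. indicator R z *\<^sub>R h z) \<in> borel_measurable borel" and X: "X \<in> sets borel" "X \<subseteq> R"
  shows "(\<lambda>z. ennreal (cmod (h z) powr p) * indicator X z) \<in> borel_measurable borel"
proof -
  note h[measurable] X(1)[measurable]
  have "(\<lambda>z. ennreal (cmod (indicator R z *\<^sub>R h z) powr p) * indicator X z) \<in> borel_measurable borel"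
    by measurable
  also have "(\<lambda>z. ennreal (cmod (indicator R z *\<^sub>R h z) powr p) * indicator X z) = (\<lambda>z. ennreal (cmod (h z) powr p) * indicator X z)"
    using X(2) by (auto simp: fun_eq_iff indicator_def)
  finally show ?thesis .
qed

lemma lp_energy_mono_set: "X \<subseteq> Y \<Longrightarrow> lp_energy p X h \<le> lp_energy p Y h"
  unfolding lp_energy_def by (intro nn_integral_mono mult_left_mono) (auto simp: indicator_def)

text \<open>Uniform convergence to a function bounded by \<open>B\<close> on a bounded set
  eventually keeps the functions below B + 1, a constant integrable majorant.\<close>

lemma lp_energy_tendsto:
  fixes g :: "nat \<Rightarrow> complex ^ 'n \<Rightarrow> complex"
  assumes p: "p > 0" and X: "X \<in> sets borel" "bounded X" "X \<subseteq> R" and lim: "uniform_limit X g f sequentially"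
    and bf: "bounded (f ` X)"
    and g: "\<And>N. (\<lambda>z. indicator R z *\<^sub>R g N z) \<in> borel_measurable borel"
    and f: "(\<lambda>z. indicator R z *\<^sub>R f z) \<in> borel_measurable borel"
  shows "(\<lambda>N. lp_energy p X (g N)) \<longlonglongrightarrow> lp_energy p X f"
proof -
  obtain B where B: "\<And>z. z \<in> X \<Longrightarrow> cmod (f z) \<le> B"
    using bf unfolding bounded_iff by blast
  obtain N0 where N0: "\<And>N z. N \<ge> N0 \<Longrightarrow> z \<in> X \<Longrightarrow> dist (g N z) (f z) < 1"
    using uniform_limitD[OF lim, of 1] unfolding eventually_sequentially by auto
  have "(\<lambda>N. lp_energy p X (g (N + N0))) \<longlonglongrightarrow> lp_energy p X f"
    unfolding lp_energy_def
  proof (rule nn_integral_dominated_convergence[where w = "\<lambda>z. ennreal ((B + 1) powr p) * indicator X z"])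
    show "(\<lambda>z. ennreal (cmod (g (N + N0) z) powr p) * indicator X z) \<in> borel_measurable lborel" for N
      using borel_measurable_energy[OF g X(1,3)] by simp
    show "(\<lambda>z. ennreal (cmod (f z) powr p) * indicator X z) \<in> borel_measurable lborel"
      using borel_measurable_energy[OF f X(1,3)] by simp
    show "(\<lambda>z. ennreal ((B + 1) powr p) * indicator X z) \<in> borel_measurable lborel"
      using X(1) by simp
    have "ennreal (cmod (g (N + N0) z) powr p) * indicator X z \<le> ennreal ((B + 1) powr p) * indicator X z" for N z
    proof (cases "z \<in> X")
      case True
      have "cmod (g (N + N0) z) \<le> cmod (f z) + dist (g (N + N0) z) (f z)"
        by (metis dist_norm norm_triangle_sub)
      also have "\<dots> \<le> B + 1" using B[OF True] N0[of "N + N0" z] True by (intro add_mono) auto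
      finally show ?thesis using p True by (auto intro!: ennreal_leI powr_mono2)
    qed simp
    then show "AE z in lborel. ennreal (cmod (g (N + N0) z) powr p) * indicator X z \<le> ennreal ((B + 1) powr p) * indicator X z" for N
      by simp
    show "(\<integral>\<^sup>+z. ennreal ((B + 1) powr p) * indicator X z \<partial>lborel) < \<infinity>"
      using emeasure_bounded_finite[OF X(2)] X(1) by (simp add: nn_integral_cmult ennreal_mult_less_top)
    have "(\<lambda>N. ennreal (cmod (g (N + N0) z) powr p) * indicator X z) \<longlonglongrightarrow> ennreal (cmod (f z) powr p) * indicator X z" for z
    proof (cases "z \<in> X")
      case True
      have "(\<lambda>N. g (N + N0) z) \<longlonglongrightarrow> f z"
        using LIMSEQ_ignore_initial_segment[OF tendsto_uniform_limitI[OF lim True]] .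
      then have "(\<lambda>N. cmod (g (N + N0) z) powr p) \<longlonglongrightarrow> cmod (f z) powr p"
        using p by (intro tendsto_powr' tendsto_norm tendsto_const) auto
      then show ?thesis using True by simp
    qed simp
    then show "AE z in lborel. (\<lambda>N. ennreal (cmod (g (N + N0) z) powr p) * indicator X z) \<longlonglongrightarrow> ennreal (cmod (f z) powr p) * indicator X z"
      by simp
  qed
  then show ?thesis by (rule LIMSEQ_offset)
qed

lemma lp_energy_diff_le:
  assumes p: "p > 0" and X: "X \<in> sets borel" "X \<subseteq> R"
    and g: "(\<lambda>z. indicator R z *\<^sub>R g z) \<in> borel_measurable borel"
    and f: "(\<lambda>z. indicator R z *\<^sub>R f z) \<in> borel_measurable borel"
  shows "lp_energy p X (\<lambda>z. g z - f z) \<le> ennreal (2 powr p) * (lp_energy p X g + lp_energy p X f)"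
proof -
  note [measurable] = borel_measurable_energy[OF g X] borel_measurable_energy[OF f X]
  have "lp_energy p X (\<lambda>z. g z - f z) \<le> (\<integral>\<^sup>+z. ennreal (2 powr p) * (ennreal (cmod (g z) powr p) * indicator X z + ennreal (cmod (f z) powr p) * indicator X z) \<partial>lborel)"
    unfolding lp_energy_def
  proof (rule nn_integral_mono)
    fix z
    have "ennreal (cmod (g z - f z) powr p) \<le> ennreal (2 powr p) * (ennreal (cmod (g z) powr p) + ennreal (cmod (f z) powr p))"
      using norm_diff_powr_le[OF p, of "g z" "f z"] by (simp add: ennreal_leI flip: ennreal_mult' ennreal_plus)
    then show "ennreal (cmod (g z - f z) powr p) * indicator X z \<le> ennreal (2 powr p) * (ennreal (cmod (g z) powr p) * indicator X z + ennreal (cmod (f z) powr p) * indicator X z)"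
      by (simp add: indicator_def)
  qed
  also have "\<dots> = ennreal (2 powr p) * (lp_energy p X g + lp_energy p X f)"
    unfolding lp_energy_def by (subst nn_integral_cmult, measurable) (subst nn_integral_add, auto)
  finally show ?thesis .
qed

lemma borel_inner_region: "inner_region R d \<in> sets borel"
  using closed_inner_region by (rule borel_closed)

text \<open>Passes from finite sums to \<open>f\<close> itself in two limits. Inside a compact inner
  region the partial sums converge uniformly, so the right-hand side of the finite bound tends to
  the energy of \<open>f\<close>; monotone convergence then enlarges the part of the boundary layer
  considered to the whole layer.\<close>

lemma lp_energy_square_partial_sum_le:
  fixes R :: "(complex ^ 'n) set"
  assumes R: "is_domain R" "reinhardt R" "bounded R" and p: "1 < p"
  obtains C where "C \<ge> 0" and "\<And>f d N. holo_on f R \<Longrightarrow> d > 0 \<Longrightarrow>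
    lp_energy p (R - inner_region R d) (square_partial_sum R N f) \<le> ennreal C * lp_energy p (R - inner_region R d) f"
proof -
  obtain C where C: "C \<ge> 0" and riesz: "\<And>X (G :: (int ^ 'n) set) a N. X \<in> sets borel \<Longrightarrow> torus_invariant X \<Longrightarrow> finite G \<Longrightarrow>
    lp_energy p X (\<lambda>z. \<Sum>\<alpha>\<in>{\<alpha>\<in>G. index_norm \<alpha> \<le> int N}. a \<alpha> * laurent_monomial \<alpha> z)
      \<le> ennreal C * lp_energy p X (\<lambda>z. \<Sum>\<alpha>\<in>G. a \<alpha> * laurent_monomial \<alpha> z)"
    using lp_energy_square_partial_sum[OF p] by blast
  have oR: "open R" using R(1) by (simp add: is_domain_def)
  then have bR: "R \<in> sets borel" by simp
  have inv: "torus_invariant R" using R(2) by (rule reinhardt_imp_torus_invariant)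
  show ?thesis
  proof (rule that[OF C])
    fix f and d :: real and N
    assume f: "holo_on f R" and d: "d > 0"
    have cf: "continuous_on R f" using holo_on_imp_sep_holo[OF oR f] by (simp add: sep_holo_def)
    have mf: "(\<lambda>z. indicator R z *\<^sub>R f z) \<in> borel_measurable borel"
      by (rule borel_measurable_continuous_on_indicator[OF bR cf])
    have S[measurable]: "square_partial_sum R M f \<in> borel_measurable borel" for M
      unfolding square_partial_sum_def[abs_def] by (intro borel_measurable_sum borel_measurable_times) measurable
    have mS: "(\<lambda>z. indicator R z *\<^sub>R square_partial_sum R M f z) \<in> borel_measurable borel" for M
      using bR by measurable
    define D where "D l = inner_region R (inverse (real (Suc l)))" for l
    have Dsub: "D l \<subseteq> R" for l unfolding D_def by (rule inner_region_subset) simp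
    have compact: "bounded X \<and> bounded (f ` X) \<and> uniform_limit X (\<lambda>M. square_partial_sum R M f) f sequentially"
      if "X \<subseteq> D l" for X l
    proof -
      have c: "compact (D l)" unfolding D_def by (rule compact_inner_region[OF R(3)]) simp
      have "bounded (f ` D l)" by (intro compact_imp_bounded compact_continuous_image c continuous_on_subset[OF cf Dsub])
      moreover have "uniform_limit (D l) (\<lambda>M. square_partial_sum R M f) f sequentially"
        by (rule uniform_limit_square_partial_sum[OF R f c Dsub])
      ultimately show ?thesis
        using that c by (meson bounded_subset compact_imp_bounded image_mono uniform_limit_on_subset)
    qed
    have bound: "lp_energy p X (square_partial_sum R N f) \<le> ennreal C * lp_energy p X f"
      if X: "X \<in> sets borel" "torus_invariant X" "X \<subseteq> D l" for X l
    proof -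
      have "(\<lambda>M. lp_energy p X (square_partial_sum R M f)) \<longlonglongrightarrow> lp_energy p X f"
        using compact[OF X(3)] X Dsub p by (intro lp_energy_tendsto[where R = R] mf mS) auto
      then have lim: "(\<lambda>M. ennreal C * lp_energy p X (square_partial_sum R M f)) \<longlonglongrightarrow> ennreal C * lp_energy p X f"
        by (intro ennreal_tendsto_cmult) auto
      \<comment> \<open>For M \<ge> N the square sum of order \<open>N\<close> is a truncation of
        the one of order \<open>M\<close>, to which the finite bound applies; \<open>M\<close> then
        tends to infinity with \<open>N\<close> fixed.\<close>
      have "lp_energy p X (square_partial_sum R N f) \<le> ennreal C * lp_energy p X (square_partial_sum R M f)" if "M \<ge> N" for M
      proof -
        have "{\<alpha> \<in> {\<alpha> :: int ^ 'n. index_norm \<alpha> \<le> int M}. index_norm \<alpha> \<le> int N} = {\<alpha>. index_norm \<alpha> \<le> int N}"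
          using that by auto
        then show ?thesis
          using riesz[OF X(1,2) finite_index_square[of M], where N = N and a = "laurent_coeff R f"]
          by (simp add: square_partial_sum_def[abs_def])
      qed
      then show ?thesis by (intro LIMSEQ_le_const[OF lim]) auto
    qed
    define E where "E = R - inner_region R d"
    have bD: "D l \<in> sets borel" for l unfolding D_def by (rule borel_inner_region)
    have E: "E \<in> sets borel" "E \<subseteq> R" using bR borel_inner_region by (auto simp: E_def)
    have tE: "torus_invariant (D l \<inter> E)" for l
    proof -
      have 1: "torus_invariant (inner_region R e)" for e by (rule torus_invariant_inner_region[OF inv])
      have "rot j t z \<notin> inner_region R d" if "z \<notin> inner_region R d" for z j t
        using torus_invariantD[OF 1, of "rot j t z" d j "- t"] that by (auto simp: rot_rot) (simp add: rot_def)
      then show ?thesis using inv 1 unfolding torus_invariant_def E_def D_def by blast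
    qed
    have inc: "D l \<subseteq> D l'" if "l \<le> l'" for l l'
      unfolding D_def by (rule inner_region_antimono) (use that in \<open>auto simp: field_simps\<close>)
    have cover: "\<exists>l. z \<in> D l" if z: "z \<in> R" for z
    proof -
      obtain e where e: "e > 0" "{z} \<subseteq> inner_region R e"
        using compact_subset_inner_region[OF oR, of "{z}"] z by auto
      obtain l where "inverse (real (Suc l)) < e" using reals_Archimedean[OF e(1)] by blast
      then show ?thesis using e(2) inner_region_antimono[of "inverse (real (Suc l))" e R] by (auto simp: D_def)
    qed
    \<comment> \<open>The sets \<open>D l\<close> increase to \<open>R\<close>, so \<open>u\<close>
      increases to the integrand on the whole layer \<open>E\<close>.\<close>
    define u where "u l z = ennreal (cmod (square_partial_sum R N f z) powr p) * indicator (D l \<inter> E) z" for l z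
    have "lp_energy p E (square_partial_sum R N f) = (\<integral>\<^sup>+z. (SUP l. u l z) \<partial>lborel)"
      unfolding lp_energy_def
    proof (rule nn_integral_cong, rule antisym)
      fix z
      show "ennreal (cmod (square_partial_sum R N f z) powr p) * indicator E z \<le> (SUP l. u l z)"
      proof (cases "z \<in> E")
        case True
        then obtain l where "z \<in> D l" using cover E(2) by blast
        then have "ennreal (cmod (square_partial_sum R N f z) powr p) * indicator E z = u l z" using True by (simp add: u_def)
        also have "\<dots> \<le> (SUP l. u l z)" by (rule SUP_upper) simp
        finally show ?thesis .
      qed simp
      show "(SUP l. u l z) \<le> ennreal (cmod (square_partial_sum R N f z) powr p) * indicator E z"
        by (rule SUP_least) (auto simp: u_def indicator_def)
    qed
    also have "\<dots> = (SUP l. integral\<^sup>N lborel (u l))"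
    proof (rule nn_integral_monotone_convergence_SUP)
      show "incseq u" using inc by (fastforce simp: incseq_def le_fun_def u_def indicator_def)
      show "u l \<in> borel_measurable lborel" for l
        using bD[of l] E(1) S unfolding u_def[abs_def] by measurable
    qed
    also have "\<dots> \<le> ennreal C * lp_energy p E f"
    proof (rule SUP_least)
      fix l
      have "integral\<^sup>N lborel (u l) = lp_energy p (D l \<inter> E) (square_partial_sum R N f)"
        by (simp add: u_def[abs_def] lp_energy_def)
      also have "\<dots> \<le> ennreal C * lp_energy p (D l \<inter> E) f"
        using bD E(1) by (intro bound[where l = l] tE) auto
      also have "\<dots> \<le> ennreal C * lp_energy p E f"
        by (intro mult_left_mono lp_energy_mono_set) auto
      finally show "integral\<^sup>N lborel (u l) \<le> ennreal C * lp_energy p E f" .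
    qed
    finally show "lp_energy p (R - inner_region R d) (square_partial_sum R N f) \<le> ennreal C * lp_energy p (R - inner_region R d) f"
      by (simp add: E_def)
  qed
qed

lemma lp_energy_split:
  assumes R: "R \<in> sets borel" and K: "K \<in> sets borel" "K \<subseteq> R"
    and h: "(\<lambda>z. indicator R z *\<^sub>R h z) \<in> borel_measurable borel"
  shows "lp_energy p R h = lp_energy p K h + lp_energy p (R - K) h"
proof -
  have "R - K \<in> sets borel" using R K by auto
  note [measurable] = borel_measurable_energy[OF h K] borel_measurable_energy[OF h this Diff_subset]
  have "lp_energy p R h = (\<integral>\<^sup>+z. ennreal (cmod (h z) powr p) * indicator K z + ennreal (cmod (h z) powr p) * indicator (R - K) z \<partial>lborel)"
    unfolding lp_energy_def using K(2) by (intro nn_integral_cong) (auto simp: indicator_def)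
  also have "\<dots> = lp_energy p K h + lp_energy p (R - K) h"
    unfolding lp_energy_def by (rule nn_integral_add) simp_all
  finally show ?thesis .
qed

text \<open>Each point of the open set eventually leaves the shrinking boundary layer, and the
  finite energy on \<open>R\<close> provides the majorant.\<close>

lemma lp_energy_outer_tendsto_0:
  fixes R :: "(complex ^ 'n) set"
  assumes R: "open R" and h: "(\<lambda>z. indicator R z *\<^sub>R h z) \<in> borel_measurable borel"
    and fin: "lp_energy p R h < \<infinity>"
  shows "(\<lambda>m. lp_energy p (R - inner_region R (inverse (real (Suc m)))) h) \<longlonglongrightarrow> 0"
proof -
  have bR: "R \<in> sets borel" using R by simp
  have "(\<lambda>m. \<integral>\<^sup>+z. ennreal (cmod (h z) powr p) * indicator (R - inner_region R (inverse (real (Suc m)))) z \<partial>lborel)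
    \<longlonglongrightarrow> (\<integral>\<^sup>+z. 0 \<partial>(lborel :: (complex ^ 'n) measure))"
  proof (rule nn_integral_dominated_convergence[where w = "\<lambda>z. ennreal (cmod (h z) powr p) * indicator R z"])
    show "(\<lambda>z. ennreal (cmod (h z) powr p) * indicator (R - inner_region R (inverse (real (Suc m)))) z) \<in> borel_measurable lborel" for m
      using borel_measurable_energy[OF h sets.Diff[OF bR borel_inner_region] Diff_subset] by simp
    show "(\<lambda>z. ennreal (cmod (h z) powr p) * indicator R z) \<in> borel_measurable lborel"
      using borel_measurable_energy[OF h bR order_refl] by simp
    show "AE z in lborel. ennreal (cmod (h z) powr p) * indicator (R - inner_region R (inverse (real (Suc m)))) z \<le> ennreal (cmod (h z) powr p) * indicator R z" for m
      by (auto simp: indicator_def)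
    show "(\<integral>\<^sup>+z. ennreal (cmod (h z) powr p) * indicator R z \<partial>lborel) < \<infinity>"
      using fin by (simp add: lp_energy_def)
    have "(\<lambda>m. ennreal (cmod (h z) powr p) * indicator (R - inner_region R (inverse (real (Suc m)))) z) \<longlonglongrightarrow> 0" for z
    proof (cases "z \<in> R")
      case True
      obtain e where e: "e > 0" "{z} \<subseteq> inner_region R e"
        using compact_subset_inner_region[OF R, of "{z}"] True by auto
      obtain l where l: "inverse (real (Suc l)) < e" using reals_Archimedean[OF e(1)] by blast
      have "\<forall>\<^sub>F m in sequentially. ennreal (cmod (h z) powr p) * indicator (R - inner_region R (inverse (real (Suc m)))) z = 0"
        using eventually_ge_at_top[of l]
      proof eventually_elim
        fix m assume "l \<le> m"
        then have "inverse (real (Suc m)) \<le> inverse (real (Suc l))" by (simp add: field_simps)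
        then have "inverse (real (Suc m)) \<le> e" using l by linarith
        from inner_region_antimono[OF this] have "z \<in> inner_region R (inverse (real (Suc m)))"
          using e(2) by auto
        then show "ennreal (cmod (h z) powr p) * indicator (R - inner_region R (inverse (real (Suc m)))) z = 0" by simp
      qed
      then show ?thesis by (rule tendsto_eventually)
    qed simp
    then show "AE z in lborel. (\<lambda>m. ennreal (cmod (h z) powr p) * indicator (R - inner_region R (inverse (real (Suc m)))) z) \<longlonglongrightarrow> 0"
      by simp
  qed simp
  then show ?thesis by (simp add: lp_energy_def)
qed

text \<open>\<open>lebesgue\<close> completes \<open>lborel\<close>, and completion does not change
  non-negative integrals; so Borel estimates speak about the norm.\<close>

lemma lp_norm_eq_lp_energy:
  "lp_norm p R g = (if lp_energy p R g = \<infinity> then \<infinity> else ennreal (enn2real (lp_energy p R g) powr (1 / p)))"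
  by (simp add: lp_norm_def lp_energy_def nn_integral_completion Let_def)

theorem theorem0p5:
  fixes R :: "(complex ^ 'n) set" and p :: real and f :: "complex ^ 'n \<Rightarrow> complex"
  assumes "is_domain R" and "reinhardt R" and "bounded R"
    and "1 < p"
    and "f \<in> bergman_space p R"
  shows "(\<lambda>N. lp_norm p R (\<lambda>z. square_partial_sum R N f z - f z)) \<longlonglongrightarrow> 0"
proof -
  note R = assms(1-3)
  have p: "p > 0" using assms(4) by simp
  have f: "holo_on f R" and fn: "lp_norm p R f < \<infinity>"
    using assms(5) by (auto simp: bergman_space_def lp_space_def)
  have fin: "lp_energy p R f < \<infinity>"
    using fn unfolding lp_norm_eq_lp_energy by (auto split: if_splits simp: less_top)
  have oR: "open R" using R(1) by (simp add: is_domain_def)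
  then have bR: "R \<in> sets borel" by simp
  have cf: "continuous_on R f" using holo_on_imp_sep_holo[OF oR f] by (simp add: sep_holo_def)
  have mf: "(\<lambda>z. indicator R z *\<^sub>R f z) \<in> borel_measurable borel"
    by (rule borel_measurable_continuous_on_indicator[OF bR cf])
  have S: "square_partial_sum R N f \<in> borel_measurable borel" for N
    unfolding square_partial_sum_def[abs_def] by (intro borel_measurable_sum borel_measurable_times) measurable
  have mS: "(\<lambda>z. indicator R z *\<^sub>R square_partial_sum R N f z) \<in> borel_measurable borel" for N
    using bR S by measurable
  have mSf: "(\<lambda>z. indicator R z *\<^sub>R (square_partial_sum R N f z - f z)) \<in> borel_measurable borel" for N
    using borel_measurable_diff[OF mS mf] by (simp add: scaleR_diff_right)
  define D where "D m = inner_region R (inverse (real (Suc m)))" for m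
  have D: "D m \<in> sets borel" "D m \<subseteq> R" "compact (D m)" for m
    unfolding D_def by (auto intro!: borel_inner_region compact_inner_region R dest: inner_region_subset[THEN subsetD, rotated])
  obtain C where C: "C \<ge> 0" and riesz: "\<And>f d N. holo_on f R \<Longrightarrow> d > 0 \<Longrightarrow>
    lp_energy p (R - inner_region R d) (square_partial_sum R N f) \<le> ennreal C * lp_energy p (R - inner_region R d) f"
    using lp_energy_square_partial_sum_le[OF R assms(4)] by blast
  \<comment> \<open>On the boundary layer \<open>lp_energy_diff_le\<close> contributes 2^p, and S_N
    f and \<open>f\<close> contribute \<open>C\<close> and 1.\<close>
  define C' where "C' = 2 powr p * (C + 1)"
  define I where "I N = lp_energy p R (\<lambda>z. square_partial_sum R N f z - f z)" for N
  have le: "I N \<le> lp_energy p (D m) (\<lambda>z. square_partial_sum R N f z - f z) + ennreal C' * lp_energy p (R - D m) f" for N m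
  proof -
    have RD: "R - D m \<in> sets borel" using bR D(1) by auto
    have "I N = lp_energy p (D m) (\<lambda>z. square_partial_sum R N f z - f z) + lp_energy p (R - D m) (\<lambda>z. square_partial_sum R N f z - f z)"
      unfolding I_def by (rule lp_energy_split[OF bR D(1,2) mSf])
    also have "lp_energy p (R - D m) (\<lambda>z. square_partial_sum R N f z - f z)
      \<le> ennreal (2 powr p) * (lp_energy p (R - D m) (square_partial_sum R N f) + lp_energy p (R - D m) f)"
      by (rule lp_energy_diff_le[OF p RD Diff_subset mS mf])
    also have "\<dots> \<le> ennreal (2 powr p) * (ennreal C * lp_energy p (R - D m) f + lp_energy p (R - D m) f)"
      unfolding D_def by (intro mult_left_mono add_right_mono riesz[OF f]) auto
    also have "\<dots> = ennreal C' * lp_energy p (R - D m) f"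
      using C by (simp add: C'_def ennreal_mult' ennreal_plus distrib_right mult.assoc)
    finally show ?thesis by (simp add: add_left_mono)
  qed
  have inner0: "(\<lambda>N. lp_energy p (D m) (\<lambda>z. square_partial_sum R N f z - f z)) \<longlonglongrightarrow> 0" for m
  proof -
    have "uniform_limit (D m) (\<lambda>N z. square_partial_sum R N f z - f z) (\<lambda>z. f z - f z) sequentially"
      by (intro uniform_limit_intros uniform_limit_square_partial_sum[OF R f D(3,2)])
    moreover have "bounded ((\<lambda>z. f z - f z) ` D m)"
      by (rule bounded_subset[of "{0}"]) auto
    ultimately have "(\<lambda>N. lp_energy p (D m) (\<lambda>z. square_partial_sum R N f z - f z)) \<longlonglongrightarrow> lp_energy p (D m) (\<lambda>z. f z - f z)"
      using D[of m] by (intro lp_energy_tendsto[OF p, where R = R] mSf) (simp_all add: compact_imp_bounded)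
    moreover have "lp_energy p (D m) (\<lambda>z. f z - f z) = 0" by (simp add: lp_energy_def)
    ultimately show ?thesis by simp
  qed
  have outer0: "(\<lambda>m. ennreal C' * lp_energy p (R - D m) f) \<longlonglongrightarrow> 0"
    using ennreal_tendsto_cmult[OF _ lp_energy_outer_tendsto_0[OF oR mf fin], of "ennreal C'"] by (simp add: D_def)
  have I0: "I \<longlonglongrightarrow> 0"
  proof (rule order_tendstoI)
    fix e :: ennreal assume "e > 0"
    then obtain r where r: "0 < r" "ennreal r < e"
      by (metis dense ennreal_cases ennreal_less_zero_iff less_top_ennreal not_less_iff_gr_or_eq top.not_eq_extremum)
    have r2: "ennreal (r / 2) > 0" using r by simp
    \<comment> \<open>The layer is fixed first, since its bound does not depend on \<open>N\<close>;
      afterwards \<open>N\<close> makes the compact part small.\<close>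
    obtain m where m: "ennreal C' * lp_energy p (R - D m) f < ennreal (r / 2)"
      using order_tendstoD(2)[OF outer0 r2] by (auto simp: eventually_sequentially)
    show "\<forall>\<^sub>F N in sequentially. I N < e"
      using order_tendstoD(2)[OF inner0[of m] r2]
    proof eventually_elim
      fix N assume N: "lp_energy p (D m) (\<lambda>z. square_partial_sum R N f z - f z) < ennreal (r / 2)"
      have "I N \<le> ennreal (r / 2) + ennreal (r / 2)"
        by (rule order_trans[OF le[of N m]]) (intro add_mono less_imp_le N m)
      also have "\<dots> = ennreal r" using r by (simp flip: ennreal_plus)
      finally show "I N < e" using r(2) by simp
    qed
  qed simp
  have "(\<lambda>N. enn2real (I N)) \<longlonglongrightarrow> enn2real 0"
    using I0 by (intro tendsto_enn2real) auto
  then have "(\<lambda>N. enn2real (I N) powr (1 / p)) \<longlonglongrightarrow> 0"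
    using p by (intro tendsto_zero_powrI[where b = "1 / p"]) auto
  then have "(\<lambda>N. ennreal (enn2real (I N) powr (1 / p))) \<longlonglongrightarrow> 0"
    using tendsto_ennrealI by fastforce
  \<comment> \<open>Eventually \<open>I N < 1\<close>, which selects the finite branch in the
    definition of \<open>lp_norm\<close>.\<close>
  moreover have "\<forall>\<^sub>F N in sequentially. ennreal (enn2real (I N) powr (1 / p)) = lp_norm p R (\<lambda>z. square_partial_sum R N f z - f z)"
    using order_tendstoD(2)[OF I0 zero_less_one] by eventually_elim (auto simp: lp_norm_eq_lp_energy I_def)
  ultimately show ?thesis by (rule Lim_transform_eventually)
qed

end
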